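(* Let $G=(V,E)$ be a connected, undirected, unweighted graph on $n$ nodes with diameter $D$. Then a $(+4)$-all-pairs spanner of $G$ with $O\!\left(n^{7/5}\log^{4/5} n\right)$ edges can be constructed in $O\!\left(n^{3/5}\log^{1/5} n + D\right)$ rounds in the CONGEST model, with high probability.
   Context: $\delta_H(u,v)$ denotes the distance between $u$ and $v$ in a graph $H$. A subgraph $H$ of $G$ (on the same node set) is a $(+4)$-all-pairs spanner if $\delta_H(u,v)\le\delta_G(u,v)+4$ for all $(u,v)\in V\times V$. CONGEST model: the nodes of $G$ are processors with unique $O(\log n)$-bit identifiers; computation proceeds in synchronous rounds, in each of which every node may send an $O(\log n)$-bit message to each of its neighbors in $G$, followed by unbounded local computation. Initially each node knows its identifier and its neighbors' identifiers; at the end each node must know which of its incident edges belong to $H$. "With high probability" means with probability at least $1-n^{-c}$ for an arbitrarily chosen constant $c$. *)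

theory Defs
  imports "HOL-Probability.Probability" "HOL-Probability.Product_PMF"
begin

section \<open>Finite simple graphs, distances and additive spanners\<close>

text \<open>A graph is a vertex set together with a set of two-element edges. Vertices are natural
  numbers because in the message-passing model below a vertex is its own unique identifier.\<close>

definition simple_graph :: "nat set \<Rightarrow> nat set set \<Rightarrow> bool" where
  "simple_graph V E \<longleftrightarrow> finite V \<and> V \<noteq> {} \<and> (\<forall>e\<in>E. e \<subseteq> V \<and> card e = 2)"

definition nbrs :: "nat set set \<Rightarrow> nat \<Rightarrow> nat set" where
  "nbrs E u = {v. {u, v} \<in> E}"

text \<open>The relational power relates the endpoints of the walks of length \<open>k\<close>, so the infimum is
  the shortest-path distance; it is infinite for disconnected vertices.\<close>

definition graph_dist :: "nat set set \<Rightarrow> nat \<Rightarrow> nat \<Rightarrow> enat" where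
  "graph_dist E u v = Inf {enat k | k. (u, v) \<in> {(x, y). {x, y} \<in> E} ^^ k}"

definition connected_graph :: "nat set \<Rightarrow> nat set set \<Rightarrow> bool" where
  "connected_graph V E \<longleftrightarrow> simple_graph V E \<and> (\<forall>u\<in>V. \<forall>v\<in>V. graph_dist E u v < \<infinity>)"

definition graph_diameter :: "nat set \<Rightarrow> nat set set \<Rightarrow> enat" where
  "graph_diameter V E = (SUP u\<in>V. SUP v\<in>V. graph_dist E u v)"

definition additive_spanner :: "nat \<Rightarrow> nat set \<Rightarrow> nat set set \<Rightarrow> nat set set \<Rightarrow> bool" where
  "additive_spanner k V E F \<longleftrightarrow>
     F \<subseteq> E \<and> (\<forall>u\<in>V. \<forall>v\<in>V. graph_dist F u v \<le> graph_dist E u v + enat k)"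


section \<open>The randomized CONGEST model\<close>

text \<open>
  All nodes run the same program, over local states of type \<open>'s\<close>:
  \<^item> \<open>start i N\<close> is the distribution of the initial state of the node with identifier \<open>i\<close> and set
    \<open>N\<close> of neighbour identifiers, which is all that the node knows initially;
  \<^item> \<open>send s j\<close> is the bit string, if any, that a node in state \<open>s\<close> sends to its neighbour \<open>j\<close>;
  \<^item> \<open>step s inb\<close> is the distribution of the next state after receiving the message \<open>inb j\<close> from
    each neighbour \<open>j\<close>; being an arbitrary function, it models unbounded local computation;
  \<^item> \<open>result s\<close> is \<open>None\<close> while the node is running; \<open>Some N'\<close> means that it has terminated and
    that its incident edges selected for the subgraph are those to the neighbours in \<open>N'\<close>.
\<close>

record 's congest_alg =
  start :: "nat \<Rightarrow> nat set \<Rightarrow> 's pmf"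
  send :: "'s \<Rightarrow> nat \<Rightarrow> bool list option"
  step :: "'s \<Rightarrow> (nat \<Rightarrow> bool list option) \<Rightarrow> 's pmf"
  result :: "'s \<Rightarrow> nat set option"

text \<open>A terminated node sends nothing and never changes its state.\<close>

definition message :: "'s congest_alg \<Rightarrow> (nat \<Rightarrow> 's) \<Rightarrow> nat \<Rightarrow> nat \<Rightarrow> bool list option" where
  "message A \<sigma> u v = (if result A (\<sigma> u) = None then send A (\<sigma> u) v else None)"

definition inbox ::
  "'s congest_alg \<Rightarrow> nat set set \<Rightarrow> (nat \<Rightarrow> 's) \<Rightarrow> nat \<Rightarrow> nat \<Rightarrow> bool list option" where
  "inbox A E \<sigma> v = (\<lambda>u. if u \<in> nbrs E v then message A \<sigma> u v else None)"

text \<open>The product distributions make the random choices of distinct nodes independent. States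
  outside \<open>V\<close> are irrelevant and take the default value \<open>undefined\<close>.\<close>

definition congest_round ::
  "'s congest_alg \<Rightarrow> nat set \<Rightarrow> nat set set \<Rightarrow> (nat \<Rightarrow> 's) \<Rightarrow> (nat \<Rightarrow> 's) pmf" where
  "congest_round A V E \<sigma> = Pi_pmf V undefined
     (\<lambda>v. if result A (\<sigma> v) = None then step A (\<sigma> v) (inbox A E \<sigma> v) else return_pmf (\<sigma> v))"

text \<open>\<open>congest_run A V E t\<close> is the distribution of the global configuration after \<open>t\<close> rounds.\<close>

primrec congest_run ::
  "'s congest_alg \<Rightarrow> nat set \<Rightarrow> nat set set \<Rightarrow> nat \<Rightarrow> (nat \<Rightarrow> 's) pmf" where
  "congest_run A V E 0 = Pi_pmf V undefined (\<lambda>v. start A v (nbrs E v))"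
| "congest_run A V E (Suc t) = bind_pmf (congest_run A V E t) (congest_round A V E)"

text \<open>The bandwidth restriction is part of the model, so it holds in every possible execution
  and not only with high probability.\<close>

definition message_bits_le :: "'s congest_alg \<Rightarrow> nat set \<Rightarrow> nat set set \<Rightarrow> real \<Rightarrow> bool" where
  "message_bits_le A V E b \<longleftrightarrow>
     (\<forall>t. \<forall>\<sigma> \<in> set_pmf (congest_run A V E t). \<forall>u\<in>V. \<forall>v \<in> nbrs E u. \<forall>m.
        message A \<sigma> u v = Some m \<longrightarrow> real (length m) \<le> b)"

text \<open>Every node has terminated and knows exactly its incident edges in \<open>F\<close>.\<close>

definition computed_subgraph ::
  "'s congest_alg \<Rightarrow> nat set \<Rightarrow> (nat \<Rightarrow> 's) \<Rightarrow> nat set set \<Rightarrow> bool" where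
  "computed_subgraph A V \<sigma> F \<longleftrightarrow> (\<forall>v\<in>V. result A (\<sigma> v) = Some (nbrs F v))"

end

theory Submission
  imports Defs
begin

text \<open>
  Every vertex becomes a centre with probability about \<open>n\<^sup>-\<^sup>2\<^sup>/\<^sup>5 log\<^sup>1\<^sup>/\<^sup>5 n\<close> and joins the cluster
  of an adjacent centre if there is one; the unclustered vertices have small degree. An edge is
  missing if both endpoints are clustered and neither is the centre of the other. The spanner has
  all other edges. For each centre \<open>s\<close> and each cluster it also has a shortest path from \<open>s\<close> to a
  member of the cluster, namely to a closest one among those reached with at most \<open>k\<close> missing
  edges. Shortest paths with more than \<open>k\<close> missing edges touch more than \<open>k / 3\<close> clusters, so with
  high probability one of their centres belongs to a small random set of roots, whose full
  breadth-first trees are added. This preserves the distances from centres up to \<open>2\<close>, and a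
  shortest path that is left at its first missing edge for the centre of the cluster there
  loses \<open>2\<close> more.

  In the network, the vertex with the least identifier first finds its eccentricity and the number
  of vertices, which fixes a common schedule. Then all breadth-first searches run at the same time:
  \<open>v\<close> announces its distance to \<open>s\<close> after \<open>d(s, v)\<close> rounds plus one for each source that comes before
  \<open>s\<close> in the order by distance from \<open>v\<close>. Predecessors of \<open>v\<close> on shortest paths announce \<open>s\<close> strictly
  earlier, so every edge carries one announcement per round. The same schedule run backwards, with
  each announcement acknowledged by a single bit, marks the selected paths.
\<close>

section \<open>Deterministic protocols with random coins\<close>

text \<open>All coins are tossed at the start, when a vertex does not yet know \<open>n\<close> and
  hence no sampling probability. They are therefore geometric: comparing a coin with a threshold
  \<open>l\<close> fixed later has probability \<open>2^-l\<close>, and rounding to powers of two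
  costs a factor of two. After the toss a run is a function of the coins \<open>\<omega>\<close>.
  Correctness is proved for every \<open>\<omega>\<close> that is \<open>good\<close>; bandwidth and
  the common halting time hold for every \<open>\<omega>\<close>. Root coins are separate from
  centre coins: once the centres are fixed, so are the clusters that a path touches, and these are
  hit independently. Let \<open>S\<close> be the number of centres, \<open>R\<close> that of roots,
  \<open>M\<close> that of missing edges allowed on a selected path and \<open>L = log n\<close>.
  The choice is governed by \<open>S R = n L\<close> (degree \<open>R\<close> suffices to be
  clustered), \<open>R M = S L\<close> (roots hit long paths) and \<open>n R = S^2 M\<close> (trees
  cost as much as paths), which force \<open>S^5 = n^3 L\<close>. The obstacle in the search is that
  slots are computed from incomplete knowledge; ignorance must never make a vertex speak too
  early.\<close>

fun nat_bits :: "nat \<Rightarrow> bool list" where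
  "nat_bits x = (if x = 0 then [False] else True # odd x # nat_bits (x div 2))"

declare nat_bits.simps [simp del]

text \<open>Each binary digit follows a flag \<open>True\<close> and \<open>False\<close> marks the
  end, so the end of a number is recognised without looking beyond it.\<close>

lemma nat_bits_prefix_free: "nat_bits x @ r = nat_bits y @ r' \<Longrightarrow> x = y \<and> r = r'"
proof (induction x arbitrary: y rule: nat_bits.induct)
  case (1 x)
  show ?case
  proof (cases "x = 0 \<or> y = 0")
    case True
    with 1(2) show ?thesis
      by (cases "x = 0"; cases "y = 0")
        (simp_all add: nat_bits.simps[of x] nat_bits.simps[of y] nat_bits.simps[of 0])
  next
    case False
    with 1(2) have "odd x = odd y" "nat_bits (x div 2) @ r = nat_bits (y div 2) @ r'"
      by (simp_all add: nat_bits.simps[of x] nat_bits.simps[of y])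
    with 1(1) False have "x div 2 = y div 2" "r = r'" by auto
    with \<open>odd x = odd y\<close> show ?thesis
      by (metis odd_iff_mod_2_eq_one parity_cases mult_div_mod_eq)
  qed
qed

definition encode_nats :: "nat list \<Rightarrow> bool list" where
  "encode_nats xs = concat (map nat_bits xs)"

lemma inj_encode_nats: "inj encode_nats"
proof (rule injI)
  fix xs ys :: "nat list"
  have ne: "nat_bits x \<noteq> []" for x by (simp add: nat_bits.simps)
  show "encode_nats xs = encode_nats ys \<Longrightarrow> xs = ys"
  proof (induction xs arbitrary: ys)
    case Nil
    then show ?case by (cases ys) (auto simp: encode_nats_def ne)
  next
    case (Cons x xs)
    then show ?case
      by (cases ys) (auto simp: encode_nats_def ne dest: nat_bits_prefix_free)
  qed
qed

lemma length_nat_bits_le: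
  assumes "x \<le> B" "1 \<le> B"
  shows "real (length (nat_bits x)) \<le> 2 * log 2 (real B) + 3"
  using assms
proof (induction x arbitrary: B rule: nat_bits.induct)
  case (1 x)
  have B: "0 \<le> log 2 (real B)" using 1 by simp
  consider "x = 0" | "x = 1" | "2 \<le> x" by linarith
  then show ?case
  proof cases
    case 3
    have "real (length (nat_bits (x div 2))) \<le> 2 * log 2 (real (B div 2)) + 3"
      using 1 3 by (intro 1(1)) auto
    also have "real (B div 2) \<le> real B / 2" by linarith
    then have "log 2 (real (B div 2)) \<le> log 2 (real B / 2)"
      using 1 3 by (intro log_mono) auto
    also have "log 2 (real B / 2) = log 2 (real B) - 1"
      using 1 by (simp add: log_divide)
    finally show ?thesis using 3 by (simp add: nat_bits.simps[of x])
  qed (use B in \<open>simp_all add: nat_bits.simps\<close>)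
qed

lemma length_encode_nats_le:
  assumes "\<And>x. x \<in> set xs \<Longrightarrow> x \<le> B" "1 \<le> B"
  shows "real (length (encode_nats xs)) \<le> real (length xs) * (2 * log 2 (real B) + 3)"
  using assms(1)
proof (induction xs)
  case (Cons x xs)
  have "real (length (nat_bits x)) \<le> 2 * log 2 (real B) + 3"
    using Cons assms by (intro length_nat_bits_le) auto
  with Cons show ?case by (simp add: encode_nats_def algebra_simps)
qed (simp add: encode_nats_def)

text \<open>Needed because the initial state of a vertex depends on its identifier and its
  neighbours as well as on its coin.\<close>

lemma Pi_pmf_map_dependent:
  assumes "finite A"
  shows "Pi_pmf A d' (\<lambda>x. map_pmf (f x) (p x)) =
         map_pmf (\<lambda>g x. if x \<in> A then f x (g x) else d') (Pi_pmf A d p)"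
proof -
  have "Pi_pmf A d' (\<lambda>x. bind_pmf (p x) (\<lambda>y. return_pmf (f x y))) =
        bind_pmf (Pi_pmf A d p) (\<lambda>g. Pi_pmf A d' (\<lambda>x. return_pmf (f x (g x))))"
    by (rule Pi_pmf_bind[OF assms])
  then show ?thesis using assms by (simp add: map_pmf_def)
qed

text \<open>The states of a protocol may have any type: the states of the simulating algorithm are
  encoded histories, from which the state of the protocol is recomputed.\<close>

locale protocol =
  fixes init :: "nat \<Rightarrow> nat set \<Rightarrow> 'c::countable \<Rightarrow> 's"
    and msg :: "'s \<Rightarrow> nat \<Rightarrow> 'm"
    and upd :: "'s \<Rightarrow> (nat \<Rightarrow> 'm) \<Rightarrow> 's"
    and res :: "'s \<Rightarrow> nat set option"
    and enc :: "'m \<Rightarrow> nat list"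
    and coins :: "'c pmf" and dflt :: 'c
  assumes inj_enc: "inj enc"
begin

definition encode :: "'m \<Rightarrow> bool list" where
  "encode m = encode_nats (enc m)"

lemma inv_encode [simp]: "inv encode (encode m) = m"
  by (rule inv_f_f) (metis encode_def inj_def inj_enc inj_encode_nats)

text \<open>Non-neighbours and halted neighbours deliver \<open>undefined\<close>, the same value
  that \<open>state_of\<close> substitutes for an absent message; otherwise the two would not agree
  as functions.\<close>

primrec run :: "nat set set \<Rightarrow> (nat \<Rightarrow> 'c) \<Rightarrow> nat \<Rightarrow> nat \<Rightarrow> 's" where
  "run E \<omega> 0 v = init v (nbrs E v) (\<omega> v)"
| "run E \<omega> (Suc t) v = (if res (run E \<omega> t v) = None
     then upd (run E \<omega> t v)
       (\<lambda>w. if w \<in> nbrs E v \<and> res (run E \<omega> t w) = None then msg (run E \<omega> t w) v else undefined)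
     else run E \<omega> t v)"

primrec state_of :: "nat \<Rightarrow> nat list \<Rightarrow> 'c \<Rightarrow> bool list option list list \<Rightarrow> 's" where
  "state_of v ns c [] = init v (set ns) c"
| "state_of v ns c (x # hs) = upd (state_of v ns c hs)
     (\<lambda>w. case map_of (zip ns x) w of Some (Some b) \<Rightarrow> inv encode b | _ \<Rightarrow> undefined)"

definition decode_state :: "nat \<Rightarrow> 's" where
  "decode_state s = (case from_nat s of (v, ns, c, hs) \<Rightarrow> state_of v ns c hs)"

definition alg :: "nat congest_alg" where
  "alg = \<lparr> start = (\<lambda>v N. map_pmf (\<lambda>c. to_nat (v, sorted_list_of_set N, c, [] :: bool list option list list)) coins),
     send = (\<lambda>s w. Some (encode (msg (decode_state s) w))),
     step = (\<lambda>s inb. case from_nat s :: nat \<times> nat list \<times> 'c \<times> bool list option list list of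
       (v, ns, c, hs) \<Rightarrow> return_pmf (to_nat (v, ns, c, map inb ns # hs))),
     result = (\<lambda>s. res (decode_state s)) \<rparr>"

primrec hist :: "nat set set \<Rightarrow> (nat \<Rightarrow> 'c) \<Rightarrow> nat \<Rightarrow> nat \<Rightarrow> bool list option list list" where
  "hist E \<omega> 0 v = []"
| "hist E \<omega> (Suc t) v = (if res (run E \<omega> t v) = None
     then map (\<lambda>w. if res (run E \<omega> t w) = None then Some (encode (msg (run E \<omega> t w) v)) else None)
       (sorted_list_of_set (nbrs E v)) # hist E \<omega> t v
     else hist E \<omega> t v)"

definition code :: "nat set set \<Rightarrow> (nat \<Rightarrow> 'c) \<Rightarrow> nat \<Rightarrow> nat \<Rightarrow> nat" where
  "code E \<omega> t v = to_nat (v, sorted_list_of_set (nbrs E v), \<omega> v, hist E \<omega> t v)"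

lemma state_of_hist:
  assumes "\<And>v. finite (nbrs E v)"
  shows "state_of v (sorted_list_of_set (nbrs E v)) (\<omega> v) (hist E \<omega> t v) = run E \<omega> t v"
proof (induction t)
  case (Suc t)
  then show ?case using assms
    by (auto simp: map_of_zip_map fun_eq_iff
        intro!: arg_cong2[where f = upd])
qed (use assms in simp)

lemma decode_code:
  "(\<And>v. finite (nbrs E v)) \<Longrightarrow> decode_state (code E \<omega> t v) = run E \<omega> t v"
  by (simp add: decode_state_def code_def state_of_hist)

text \<open>Only the initial coins are random, so a run of any length is the image of one product
  distribution and independence across rounds need not be tracked.\<close>

lemma congest_run_alg:
  assumes V: "finite V" and nb: "\<And>v. nbrs E v \<subseteq> V"
  shows "congest_run alg V E t =
    map_pmf (\<lambda>\<omega> v. if v \<in> V then code E \<omega> t v else undefined) (Pi_pmf V dflt (\<lambda>_. coins))"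
proof (induction t)
  case 0
  show ?case using V
    by (simp add: alg_def code_def Pi_pmf_map_dependent[of _ _ _ _ dflt] cong: if_cong)
next
  case (Suc t)
  have fin: "\<And>v. finite (nbrs E v)" using assms finite_subset by blast
  have nbV: "w \<in> V" if "w \<in> nbrs E v" for v w using nb that by blast
  have step: "congest_round alg V E (\<lambda>v. if v \<in> V then code E \<omega> t v else undefined) =
      return_pmf (\<lambda>v. if v \<in> V then code E \<omega> (Suc t) v else undefined)" for \<omega>
  proof -
    have *: "(if result alg (code E \<omega> t v) = None
        then step alg (code E \<omega> t v) (inbox alg E (\<lambda>v. if v \<in> V then code E \<omega> t v else undefined) v)
        else return_pmf (code E \<omega> t v)) = return_pmf (code E \<omega> (Suc t) v)" if "v \<in> V" for v
    proof -
      let ?\<sigma> = "\<lambda>v. if v \<in> V then code E \<omega> t v else undefined"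
      have 1: "result alg (code E \<omega> t w) = res (run E \<omega> t w)" for w
        by (simp add: alg_def decode_code[OF fin])
      have 2: "inbox alg E ?\<sigma> v w = (if res (run E \<omega> t w) = None
          then Some (encode (msg (run E \<omega> t w) v)) else None)" if "w \<in> nbrs E v" for w
        using nbV[OF that] that
        by (simp add: inbox_def message_def 1) (simp add: alg_def decode_code[OF fin])
      have 3: "step alg (code E \<omega> t v) inb = return_pmf (to_nat (v, sorted_list_of_set (nbrs E v),
          \<omega> v, map inb (sorted_list_of_set (nbrs E v)) # hist E \<omega> t v))" for inb
        by (simp add: alg_def code_def)
      show ?thesis
        unfolding 1 3 using 2 fin by (auto simp: code_def)
    qed
    have "congest_round alg V E (\<lambda>v. if v \<in> V then code E \<omega> t v else undefined) =
        Pi_pmf V undefined (\<lambda>v. return_pmf (code E \<omega> (Suc t) v))"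
      unfolding congest_round_def by (intro Pi_pmf_cong) (simp_all only: if_P * refl)
    with V show ?thesis by simp
  qed
  show ?case
    by (simp add: Suc bind_map_pmf step map_pmf_def[symmetric])
qed

lemma message_bits_le_alg:
  assumes V: "finite V" and nb: "\<And>v. nbrs E v \<subseteq> V"
    and le: "\<And>\<omega> t u v. \<lbrakk>u \<in> V; v \<in> nbrs E u; res (run E \<omega> t u) = None\<rbrakk> \<Longrightarrow>
               real (length (encode (msg (run E \<omega> t u) v))) \<le> b"
  shows "message_bits_le alg V E b"
  unfolding message_bits_le_def
proof (intro allI ballI impI)
  fix t \<sigma> u v m
  assume \<sigma>: "\<sigma> \<in> set_pmf (congest_run alg V E t)" and u: "u \<in> V" and v: "v \<in> nbrs E u"
    and m: "message alg \<sigma> u v = Some m"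
  have fin: "\<And>v. finite (nbrs E v)" using assms finite_subset by blast
  obtain \<omega> where "\<sigma> = (\<lambda>v. if v \<in> V then code E \<omega> t v else undefined)"
    using \<sigma> by (auto simp: congest_run_alg[OF V nb])
  then have "res (run E \<omega> t u) = None" "m = encode (msg (run E \<omega> t u) v)"
    using m u by (auto simp: message_def alg_def decode_code[OF fin] split: if_splits)
  with le u v show "real (length m) \<le> b" by blast
qed

lemma computed_subgraph_alg:
  assumes "finite V" "\<And>v. nbrs E v \<subseteq> V"
  shows "computed_subgraph alg V (\<lambda>v. if v \<in> V then code E \<omega> t v else undefined) F \<longleftrightarrow>
    (\<forall>v\<in>V. res (run E \<omega> t v) = Some (nbrs F v))"
proof -
  have fin: "\<And>v. finite (nbrs E v)" using assms finite_subset by blast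
  show ?thesis by (simp add: computed_subgraph_def alg_def decode_code[OF fin])
qed

section \<open>Runs in which halting is ignored\<close>

primrec free_run :: "nat set set \<Rightarrow> (nat \<Rightarrow> 'c) \<Rightarrow> nat \<Rightarrow> nat \<Rightarrow> 's" where
  "free_run E \<omega> 0 v = init v (nbrs E v) (\<omega> v)"
| "free_run E \<omega> (Suc t) v = upd (free_run E \<omega> t v)
     (\<lambda>w. if w \<in> nbrs E v then msg (free_run E \<omega> t w) v else undefined)"

text \<open>All vertices halt in the same round \<open>T\<close>, so nobody misses a message because
  a neighbour halted earlier.\<close>

lemma run_eq_free_run:
  assumes nb: "\<And>v. nbrs E v \<subseteq> V"
    and before: "\<And>t v. \<lbrakk>t < T; v \<in> V\<rbrakk> \<Longrightarrow> res (free_run E \<omega> t v) = None"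
    and at: "\<And>v. v \<in> V \<Longrightarrow> res (free_run E \<omega> T v) \<noteq> None"
    and v: "v \<in> V"
  shows "run E \<omega> t v = free_run E \<omega> (min t T) v"
  using v
proof (induction t arbitrary: v)
  case (Suc t)
  show ?case
  proof (cases "t < T")
    case True
    have "(\<lambda>w. if w \<in> nbrs E v \<and> res (run E \<omega> t w) = None then msg (run E \<omega> t w) v else undefined) =
      (\<lambda>w. if w \<in> nbrs E v then msg (free_run E \<omega> t w) v else undefined)"
      using Suc.IH before True nb[of v] by (auto simp: fun_eq_iff)
    with True Suc before show ?thesis by (simp add: min_def)
  next
    case False
    with at[of v] Suc show ?thesis by (auto simp: min_def)
  qed
qed simp

end

section \<open>Graph distances\<close>

lemma graph_dist_le: "(u, v) \<in> {(x, y). {x, y} \<in> E} ^^ k \<Longrightarrow> graph_dist E u v \<le> enat k"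
  unfolding graph_dist_def by (rule Inf_lower) auto

lemma graph_dist_walk:
  assumes "graph_dist E u v = enat k"
  shows "(u, v) \<in> {(x, y). {x, y} \<in> E} ^^ k"
proof -
  let ?A = "{enat k | k. (u, v) \<in> {(x, y). {x, y} \<in> E} ^^ k}"
  have "?A \<noteq> {}" using assms unfolding graph_dist_def
    by (metis Inf_empty enat.distinct(1) top_enat_def)
  then have "graph_dist E u v \<in> ?A"
    unfolding graph_dist_def Inf_enat_def by (metis (mono_tags, lifting) LeastI_ex ex_in_conv)
  with assms show ?thesis by auto
qed

lemma graph_dist_self [simp]: "graph_dist E u u = 0"
  using graph_dist_le[of u u 0 E] by (simp add: zero_enat_def[symmetric])

lemma graph_dist_edge: "{u, v} \<in> E \<Longrightarrow> graph_dist E u v \<le> 1"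
  using graph_dist_le[of u v 1 E] by (simp add: one_enat_def)

lemma graph_dist_commute: "graph_dist E u v = graph_dist E v u"
proof -
  have "(u, v) \<in> {(x, y). {x, y} \<in> E} ^^ k \<Longrightarrow> (v, u) \<in> {(x, y). {x, y} \<in> E} ^^ k" for u v k
  proof (induction k arbitrary: v)
    case (Suc k)
    then obtain y where "(u, y) \<in> {(x, y). {x, y} \<in> E} ^^ k" "{y, v} \<in> E" by auto
    with Suc.IH show ?case by (intro relpow_Suc_I2[of v y]) (auto simp: insert_commute)
  qed auto
  then have "(u, v) \<in> {(x, y). {x, y} \<in> E} ^^ k \<longleftrightarrow> (v, u) \<in> {(x, y). {x, y} \<in> E} ^^ k" for k by blast
  then show ?thesis unfolding graph_dist_def by simp
qed

lemma graph_dist_triangle: "graph_dist E u w \<le> graph_dist E u v + graph_dist E v w"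
proof (cases "graph_dist E u v")
  case (enat i)
  show ?thesis
  proof (cases "graph_dist E v w")
    case e: (enat j)
    have "(u, w) \<in> {(x, y). {x, y} \<in> E} ^^ (i + j)"
      using graph_dist_walk[OF enat] graph_dist_walk[OF e] unfolding relpow_add by blast
    then show ?thesis using graph_dist_le enat e by fastforce
  qed simp
qed simp

lemma nbrs_sym: "w \<in> nbrs E v \<longleftrightarrow> v \<in> nbrs E w"
  by (simp add: nbrs_def insert_commute)

text \<open>Meaningful only for vertices of a connected graph: \<open>the_enat \<infinity>\<close> is junk.\<close>

definition ndist :: "nat set set \<Rightarrow> nat \<Rightarrow> nat \<Rightarrow> nat" where
  "ndist E u v = the_enat (graph_dist E u v)"

locale conn_graph =
  fixes V :: "nat set" and E :: "nat set set"
  assumes connected: "connected_graph V E"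
begin

abbreviation "N \<equiv> nbrs E"
abbreviation "d \<equiv> ndist E"

lemma finite_V: "finite V" and V_nonempty: "V \<noteq> {}"
  and edge_sub: "e \<in> E \<Longrightarrow> e \<subseteq> V" and card_edge: "e \<in> E \<Longrightarrow> card e = 2"
  using connected by (auto simp: connected_graph_def simple_graph_def)

lemma nbrs_V: "w \<in> N v \<Longrightarrow> w \<in> V" "w \<in> N v \<Longrightarrow> v \<in> V"
  using edge_sub by (auto simp: nbrs_def)

lemma nbrs_sub: "N v \<subseteq> V"
  using nbrs_V by blast

lemma finite_nbrs: "finite (N v)"
  using nbrs_sub finite_V finite_subset by blast

lemma nbrs_irrefl: "v \<notin> N v"
  using card_edge[of "{v, v}"] by (auto simp: nbrs_def)

lemma graph_dist_eq: "u \<in> V \<Longrightarrow> v \<in> V \<Longrightarrow> graph_dist E u v = enat (d u v)"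
  using connected unfolding ndist_def connected_graph_def by fastforce

lemma d_self [simp]: "d u u = 0"
  by (simp add: ndist_def zero_enat_def)

lemma d_commute: "d u v = d v u"
  unfolding ndist_def by (simp add: graph_dist_commute)

lemma d_triangle: "u \<in> V \<Longrightarrow> v \<in> V \<Longrightarrow> w \<in> V \<Longrightarrow> d u w \<le> d u v + d v w"
  using graph_dist_triangle[of E u w v] by (simp add: graph_dist_eq)

lemma d_pos: "u \<in> V \<Longrightarrow> v \<in> V \<Longrightarrow> u \<noteq> v \<Longrightarrow> 0 < d u v"
  using graph_dist_walk[OF graph_dist_eq, of u v] by (cases "d u v") auto

lemma d_edge: "w \<in> N v \<Longrightarrow> d v w = 1"
  using graph_dist_edge[of v w E] d_pos[of v w] nbrs_V[of w v] nbrs_irrefl[of v]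
  by (cases "v = w") (auto simp: nbrs_def graph_dist_eq one_enat_def)

lemma d_nbr_le: "u \<in> V \<Longrightarrow> w \<in> N v \<Longrightarrow> d u v \<le> d u w + 1"
  using d_triangle[of u w v] d_edge[of v w] nbrs_V[of w v] nbrs_sym[of w E v] d_edge[of w v] by auto

lemma d_pred:
  assumes "u \<in> V" "v \<in> V" "u \<noteq> v"
  obtains w where "w \<in> N v" "d u w + 1 = d u v"
proof -
  have "(u, v) \<in> {(x, y). {x, y} \<in> E} ^^ d u v"
    using assms by (intro graph_dist_walk graph_dist_eq)
  then obtain k w where k: "d u v = Suc k" and w: "(u, w) \<in> {(x, y). {x, y} \<in> E} ^^ k" "w \<in> N v"
    using d_pos[OF assms] by (cases "d u v") (auto simp: nbrs_def insert_commute)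
  have "d u w \<le> k"
    using graph_dist_le[OF w(1)] assms nbrs_V[OF w(2)] by (simp add: graph_dist_eq)
  then have "d u w + 1 = d u v" using d_nbr_le[OF assms(1) w(2)] k by simp
  with w(2) that show ?thesis by blast
qed

lemma d_level:
  assumes "u \<in> V" "v \<in> V" "i \<le> d u v"
  obtains x where "x \<in> V" "d u x = i" "d x v = d u v - i"
proof -
  have "\<exists>x\<in>V. d u x = i \<and> d x v = d u v - i"
    using assms
  proof (induction "d u v - i" arbitrary: v)
    case 0
    then show ?case by (intro bexI[of _ v]) auto
  next
    case (Suc k)
    from Suc.hyps(2) have "u \<noteq> v" by auto
    then obtain w where w: "w \<in> N v" "d u w + 1 = d u v" using d_pred Suc.prems by metis
    have "k = d u w - i" "i \<le> d u w" using w(2) Suc.hyps(2) by auto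
    then obtain x where x: "x \<in> V" "d u x = i" "d x w = d u w - i"
      using Suc.hyps(1)[of w] Suc.prems nbrs_V[OF w(1)] by auto
    have "d x v \<le> d u v - i"
      using d_nbr_le[OF x(1) w(1)] x w Suc.hyps(2) by linarith
    moreover have "d u v \<le> i + d x v" using d_triangle[OF _ x(1)] Suc.prems x by metis
    ultimately show ?case using x by (intro bexI[of _ x]) auto
  qed
  then show ?thesis using that by blast
qed

text \<open>All distances from 0 to \<open>d u v\<close> occur along a shortest path, which
  therefore has \<open>d u v + 1\<close> different vertices.\<close>

lemma d_less_card:
  assumes "u \<in> V" "v \<in> V"
  shows "d u v < card V"
proof -
  have "{..d u v} \<subseteq> d u ` V"
  proof
    fix i assume "i \<in> {..d u v}"
    then obtain x where "x \<in> V" "d u x = i" using d_level[OF assms, of i] by auto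
    then show "i \<in> d u ` V" by blast
  qed
  then have "card {..d u v} \<le> card (d u ` V)" using finite_V by (intro card_mono) auto
  also have "\<dots> \<le> card V" using finite_V by (rule card_image_le)
  finally show ?thesis by simp
qed

lemma d_le_diameter: "u \<in> V \<Longrightarrow> v \<in> V \<Longrightarrow> graph_diameter V E = enat D \<Longrightarrow> d u v \<le> D"
proof -
  assume *: "u \<in> V" "v \<in> V" "graph_diameter V E = enat D"
  have "graph_dist E u v \<le> graph_diameter V E"
    unfolding graph_diameter_def using * by (meson SUP_upper2 order_refl)
  with * show ?thesis by (simp add: graph_dist_eq)
qed

end

section \<open>Clusters, missing edges and canonical shortest paths\<close>

locale clustering = conn_graph +
  fixes S :: "nat set"
  assumes S_sub: "S \<subseteq> V"
begin

definition ctr :: "nat \<Rightarrow> nat option" where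
  "ctr v = (if v \<in> S then Some v else if S \<inter> N v = {} then None else Some (Min (S \<inter> N v)))"

definition miss :: "nat \<Rightarrow> nat \<Rightarrow> bool" where
  "miss v w \<longleftrightarrow> ctr v \<noteq> None \<and> ctr w \<noteq> None \<and> ctr v \<noteq> Some w \<and> ctr w \<noteq> Some v"

text \<open>The level is an argument to make the recursion primitive; the value is meaningful only
  if it is the distance from \<open>s\<close> to \<open>v\<close>, as in
  \<open>nmiss\<close>.\<close>

primrec level_miss :: "nat \<Rightarrow> nat \<Rightarrow> nat \<Rightarrow> nat" where
  "level_miss s 0 v = 0"
| "level_miss s (Suc i) v =
     Min ((\<lambda>w. level_miss s i w + of_bool (miss w v)) ` {w \<in> N v. d s w = i})"

text \<open>The least number of missing edges on a shortest path from \<open>s\<close> to \<open>v\<close>.\<close>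

definition nmiss :: "nat \<Rightarrow> nat \<Rightarrow> nat" where
  "nmiss s v = level_miss s (d s v) v"

text \<open>Breaking ties by identifier makes the paths towards one source a tree that every vertex
  can find locally.\<close>

definition parent :: "nat \<Rightarrow> nat \<Rightarrow> nat" where
  "parent s v = Min {w \<in> N v. d s w + 1 = d s v \<and> nmiss s w + of_bool (miss w v) = nmiss s v}"

definition touched :: "nat \<Rightarrow> nat \<Rightarrow> nat set" where
  "touched s v = {c. \<exists>i \<le> d s v. ctr ((parent s ^^ i) v) = Some c}"

lemma ctr_Some: "ctr v = Some c \<Longrightarrow> c \<in> S \<and> (c = v \<or> c \<in> N v)"
  using Min_in[of "S \<inter> N v"] finite_nbrs[of v] by (auto simp: ctr_def split: if_splits)

lemma ctr_V: "ctr v = Some c \<Longrightarrow> c \<in> V" "ctr v = Some c \<Longrightarrow> v \<in> V"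
  using ctr_Some[of v c] S_sub nbrs_V by auto

lemma ctr_None: "ctr v = None \<longleftrightarrow> v \<notin> S \<and> S \<inter> N v = {}"
  by (simp add: ctr_def)

lemma d_ctr_le: "ctr v = Some c \<Longrightarrow> d c v \<le> 1"
  using ctr_Some[of v c] d_edge[of c v] d_commute[of c v] by auto

lemma miss_commute: "miss v w = miss w v"
  by (auto simp: miss_def)

lemma nmiss_self [simp]: "nmiss s s = 0"
  by (simp add: nmiss_def)

lemma nmiss_eq:
  assumes "s \<in> V" "v \<in> V" "v \<noteq> s"
  shows "nmiss s v = Min ((\<lambda>w. nmiss s w + of_bool (miss w v)) ` {w \<in> N v. d s w + 1 = d s v})"
proof -
  obtain i where i: "d s v = Suc i" using d_pos[of s v] assms by (cases "d s v") auto
  then show ?thesis unfolding nmiss_def by (auto intro!: arg_cong[where f = Min] image_cong)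
qed

lemma preds:
  assumes "s \<in> V" "v \<in> V" "v \<noteq> s"
  shows "finite {w \<in> N v. d s w + 1 = d s v}" "{w \<in> N v. d s w + 1 = d s v} \<noteq> {}"
  using d_pred[of s v] assms finite_nbrs[of v] by auto

lemma parent_props:
  assumes "s \<in> V" "v \<in> V" "v \<noteq> s"
  shows "parent s v \<in> N v" "d s (parent s v) + 1 = d s v"
    "nmiss s v = nmiss s (parent s v) + of_bool (miss (parent s v) v)"
proof -
  let ?A = "{w \<in> N v. d s w + 1 = d s v \<and> nmiss s w + of_bool (miss w v) = nmiss s v}"
  have "nmiss s v \<in> (\<lambda>w. nmiss s w + of_bool (miss w v)) ` {w \<in> N v. d s w + 1 = d s v}"
    unfolding nmiss_eq[OF assms] by (rule Min_in) (simp_all only: preds[OF assms] finite_imageI image_is_empty not_False_eq_True)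
  then obtain w where "nmiss s v = nmiss s w + of_bool (miss w v)" "w \<in> {w \<in> N v. d s w + 1 = d s v}"
    by (rule imageE)
  then have "w \<in> ?A" by simp
  then have "?A \<noteq> {}" by blast
  moreover have "finite ?A" using finite_nbrs[of v] by auto
  ultimately have "parent s v \<in> ?A" unfolding parent_def by (rule Min_in[rotated])
  then show "parent s v \<in> N v" "d s (parent s v) + 1 = d s v"
    "nmiss s v = nmiss s (parent s v) + of_bool (miss (parent s v) v)" by simp_all
qed

lemma parent_V: "s \<in> V \<Longrightarrow> v \<in> V \<Longrightarrow> v \<noteq> s \<Longrightarrow> parent s v \<in> V"
  using parent_props(1) nbrs_V by blast

lemma parent_pow:
  assumes "s \<in> V" "v \<in> V" "i \<le> d s v"
  shows "(parent s ^^ i) v \<in> V" "d s ((parent s ^^ i) v) = d s v - i" "d ((parent s ^^ i) v) v \<le> i"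
proof -
  have "(parent s ^^ i) v \<in> V \<and> d s ((parent s ^^ i) v) = d s v - i \<and> d ((parent s ^^ i) v) v \<le> i"
    using assms(3)
  proof (induction i)
    case (Suc i)
    let ?x = "(parent s ^^ i) v"
    have x: "?x \<in> V" "d s ?x = d s v - i" "d ?x v \<le> i" using Suc by auto
    then have "?x \<noteq> s" using Suc.prems by auto
    note p = parent_props[OF assms(1) x(1) this]
    have "d (parent s ?x) v \<le> d (parent s ?x) ?x + d ?x v"
      using x p(1) nbrs_V assms by (intro d_triangle) auto
    also have "d (parent s ?x) ?x = 1" using d_edge[OF p(1)] by (simp add: d_commute)
    finally show ?case using p x nbrs_V[OF p(1)] by auto
  qed (use assms in auto)
  then show "(parent s ^^ i) v \<in> V" "d s ((parent s ^^ i) v) = d s v - i"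
    "d ((parent s ^^ i) v) v \<le> i" by auto
qed

lemma parent_pow_top: "s \<in> V \<Longrightarrow> v \<in> V \<Longrightarrow> (parent s ^^ d s v) v = s"
  using parent_pow[of s v "d s v"] d_pos[of s "(parent s ^^ d s v) v"] by force

definition miss_steps :: "nat \<Rightarrow> nat \<Rightarrow> nat set" where
  "miss_steps s v = {i. i < d s v \<and> miss ((parent s ^^ Suc i) v) ((parent s ^^ i) v)}"

text \<open>Parents attain the minimum in \<open>nmiss\<close>. Step 0 is the edge at
  \<open>v\<close>, and the other steps are those of the parent shifted by one.\<close>

lemma card_miss_steps:
  assumes "s \<in> V" "v \<in> V"
  shows "card (miss_steps s v) = nmiss s v"
  using assms(2)
proof (induction "d s v" arbitrary: v)
  case 0
  then have "v = s" using d_pos[of s v] assms by auto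
  with 0 show ?case by (simp add: miss_steps_def)
next
  case (Suc n)
  then have vs: "v \<noteq> s" by auto
  note p = parent_props[OF assms(1) Suc.prems vs]
  let ?p = "parent s v"
  have "miss_steps s v = {i. i = 0 \<and> miss ?p v} \<union> Suc ` miss_steps s ?p"
  proof (intro equalityI subsetI)
    fix i assume "i \<in> miss_steps s v"
    then show "i \<in> {i. i = 0 \<and> miss ?p v} \<union> Suc ` miss_steps s ?p"
      using p(2) by (cases i) (auto simp: miss_steps_def funpow_swap1)
  next
    fix i assume "i \<in> {i. i = 0 \<and> miss ?p v} \<union> Suc ` miss_steps s ?p"
    then show "i \<in> miss_steps s v"
      using p(2) by (auto simp: miss_steps_def funpow_swap1)
  qed
  moreover have "finite (miss_steps s ?p)" by (simp add: miss_steps_def)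
  ultimately have "card (miss_steps s v) = card {i::nat. i = 0 \<and> miss ?p v} + card (miss_steps s ?p)"
    by (simp add: card_Un_disjoint card_image disjoint_iff)
  also have "card {i::nat. i = 0 \<and> miss ?p v} = of_bool (miss ?p v)" by simp
  also have "card (miss_steps s ?p) = nmiss s ?p"
    using Suc p nbrs_V[OF p(1)] by auto
  finally show ?case using p(3) by simp
qed

lemma nmiss_le_d: "s \<in> V \<Longrightarrow> v \<in> V \<Longrightarrow> nmiss s v \<le> d s v"
  using card_mono[of "{..<d s v}" "miss_steps s v"]
  by (auto simp: card_miss_steps[symmetric]) (auto simp: miss_steps_def)

lemma finite_touched: "finite (touched s v)"
proof -
  have "touched s v \<subseteq> (\<lambda>i. the (ctr ((parent s ^^ i) v))) ` {..d s v}"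
    unfolding touched_def by (auto intro!: rev_image_eqI)
  then show ?thesis by (rule finite_subset) auto
qed

lemma touched_sub: "touched s v \<subseteq> S"
  using ctr_Some by (auto simp: touched_def)

text \<open>A cluster has at most three vertices on a shortest path.\<close>

lemma nmiss_le_touched:
  assumes "s \<in> V" "v \<in> V"
  shows "nmiss s v \<le> 3 * card (touched s v)"
proof -
  \<comment> \<open>Missing step \<open>i\<close> is charged to the cluster of its endpoint farther
    from \<open>s\<close>; \<open>miss\<close> guarantees that this endpoint is clustered.\<close>
  define C where "C i = the (ctr ((parent s ^^ i) v))" for i
  have ctr: "ctr ((parent s ^^ i) v) = Some (C i)" if "i \<in> miss_steps s v" for i
    using that by (auto simp: miss_steps_def miss_def C_def)
  have "miss_steps s v \<subseteq> (\<Union>c\<in>touched s v. {i \<in> miss_steps s v. C i = c})"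
  proof
    fix i assume i: "i \<in> miss_steps s v"
    then have "i \<le> d s v" by (simp add: miss_steps_def)
    with ctr[OF i] have "C i \<in> touched s v" unfolding touched_def by blast
    with i show "i \<in> (\<Union>c\<in>touched s v. {i \<in> miss_steps s v. C i = c})" by blast
  qed
  then have "nmiss s v \<le> card (\<Union>c\<in>touched s v. {i \<in> miss_steps s v. C i = c})"
    unfolding card_miss_steps[OF assms, symmetric]
    by (intro card_mono) (auto simp: finite_touched miss_steps_def)
  also have "\<dots> \<le> (\<Sum>c\<in>touched s v. card {i \<in> miss_steps s v. C i = c})"
    by (rule card_UN_le[OF finite_touched])
  also have "\<dots> \<le> (\<Sum>c\<in>touched s v. 3)"
  proof (rule sum_mono)
    fix c assume "c \<in> touched s v"
    \<comment> \<open>Members of the cluster are at distances from \<open>d s c - 1\<close> to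
      \<open>d s c + 1\<close> from \<open>s\<close>, and the path has one vertex at each
      distance.\<close>
    have "{i \<in> miss_steps s v. C i = c} \<subseteq> {i. i < d s v \<and> d s v \<le> d s c + 1 + i \<and> d s c + i \<le> d s v + 1}"
    proof
      fix i assume "i \<in> {i \<in> miss_steps s v. C i = c}"
      then have i: "i < d s v" and c: "ctr ((parent s ^^ i) v) = Some c"
        using ctr by (auto simp: miss_steps_def)
      let ?x = "(parent s ^^ i) v"
      note x = parent_pow[OF assms, of i]
      have "d s ?x \<le> d s c + d c ?x" "d s c \<le> d s ?x + d ?x c"
        using ctr_V[OF c] assms by (auto intro!: d_triangle)
      with d_ctr_le[OF c] i x(2) show "i \<in> {i. i < d s v \<and> d s v \<le> d s c + 1 + i \<and> d s c + i \<le> d s v + 1}"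
        by (auto simp: d_commute[of ?x c])
    qed
    also have "\<dots> \<subseteq> {d s v - (d s c + 1)..<d s v - (d s c + 1) + 3}" by auto
    finally have "card {i \<in> miss_steps s v. C i = c} \<le> card {d s v - (d s c + 1)..<d s v - (d s c + 1) + 3}"
      by (rule card_mono[rotated]) simp
    then show "card {i \<in> miss_steps s v. C i = c} \<le> 3" by simp
  qed
  finally show ?thesis by (simp add: mult.commute)
qed

end

section \<open>The spanner\<close>

locale spanner_choice = clustering +
  fixes R :: "nat set" and k :: nat
  assumes R_sub: "R \<subseteq> S"
begin

definition chosen :: "nat \<Rightarrow> nat \<Rightarrow> nat \<Rightarrow> bool" where
  "chosen c s y \<longleftrightarrow> ctr y = Some c \<and> nmiss s y \<le> k \<and>
     (\<forall>y'. ctr y' = Some c \<and> nmiss s y' \<le> k \<longrightarrow> d s y < d s y' \<or> d s y = d s y' \<and> y \<le> y')"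

text \<open>The vertices whose whole parent path to \<open>s\<close> is put into the spanner;
  \<open>via_child\<close> closes the set towards \<open>s\<close>.\<close>

inductive incl :: "nat \<Rightarrow> nat \<Rightarrow> bool" for s where
  via_root: "s \<in> R \<Longrightarrow> v \<in> V \<Longrightarrow> incl s v"
| via_centre: "chosen c s v \<Longrightarrow> incl s v"
| via_child: "incl s v \<Longrightarrow> v \<noteq> s \<Longrightarrow> incl s (parent s v)"

definition spanner :: "nat set set" where
  "spanner = {{v, w} | v w. w \<in> N v \<and> \<not> miss v w} \<union>
     {{v, parent s v} | s v. s \<in> S \<and> v \<in> V \<and> incl s v \<and> v \<noteq> s}"

lemma incl_V: "incl s v \<Longrightarrow> s \<in> V \<Longrightarrow> v \<in> V"
  by (induction rule: incl.induct) (auto simp: chosen_def parent_V dest: ctr_V)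

lemma spanner_sub: "spanner \<subseteq> E"
  using parent_props(1) S_sub unfolding spanner_def nbrs_def by (auto simp: insert_commute subset_iff)

lemma nbrs_spanner:
  "nbrs spanner v = {w \<in> N v. \<not> miss v w} \<union> {parent s v | s. s \<in> S \<and> v \<in> V \<and> incl s v \<and> v \<noteq> s} \<union>
     {w. \<exists>s\<in>S. w \<in> V \<and> incl s w \<and> w \<noteq> s \<and> parent s w = v}"
proof -
  have "{v, w} \<in> spanner \<longleftrightarrow> w \<in> {w \<in> N v. \<not> miss v w} \<union> {parent s v | s. s \<in> S \<and> v \<in> V \<and> incl s v \<and> v \<noteq> s} \<union>
     {w. \<exists>s\<in>S. w \<in> V \<and> incl s w \<and> w \<noteq> s \<and> parent s w = v}" for w
    by (auto simp: spanner_def doubleton_eq_iff miss_commute nbrs_sym)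
  then show ?thesis by (auto simp: nbrs_def)
qed

lemma chosen_ex:
  assumes "ctr v = Some c" "nmiss s v \<le> k"
  obtains y where "chosen c s y" "d s y \<le> d s v"
proof -
  let ?A = "{y. ctr y = Some c \<and> nmiss s y \<le> k}"
  define m where "m = Min (d s ` ?A)"
  have fin: "finite ?A" using ctr_V by (auto intro: finite_subset[OF _ finite_V])
  have "v \<in> ?A" using assms by simp
  then have m: "m \<in> d s ` ?A" "\<And>y. y \<in> ?A \<Longrightarrow> m \<le> d s y"
    using fin unfolding m_def by (auto intro!: Min_in)
  define y where "y = Min {y \<in> ?A. d s y = m}"
  have fin2: "finite {y \<in> ?A. d s y = m}" by (rule finite_subset[OF _ fin]) auto
  have "y \<in> {y \<in> ?A. d s y = m}"
    unfolding y_def using m(1) fin2 by (intro Min_in) auto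
  moreover have "y \<le> y'" if "y' \<in> ?A" "d s y' = m" for y'
    unfolding y_def using that fin2 by (intro Min_le) auto
  ultimately have "chosen c s y" "d s y \<le> d s v"
    using m(2) \<open>v \<in> ?A\<close> unfolding chosen_def by (auto simp: order_less_le)
  with that show ?thesis by blast
qed

lemma chosen_unique: "chosen c s y \<Longrightarrow> chosen c s y' \<Longrightarrow> y = y'"
  unfolding chosen_def by (metis order_antisym less_asym less_irrefl)

lemma spanner_edge: "w \<in> N v \<Longrightarrow> \<not> miss v w \<Longrightarrow> graph_dist spanner v w \<le> 1"
  by (rule graph_dist_edge) (auto simp: spanner_def)

lemma spanner_ctr: "ctr v = Some c \<Longrightarrow> graph_dist spanner v c \<le> 1"
  using spanner_edge[of c v] ctr_Some[of v c] by (cases "c = v") (auto simp: miss_def)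

lemma incl_dist:
  assumes "s \<in> S" "v \<in> V" "incl s v"
  shows "graph_dist spanner s v \<le> enat (d s v)"
  using assms(2,3)
proof (induction "d s v" arbitrary: v)
  case 0
  then have "v = s" using d_pos[of s v] assms S_sub by auto
  then show ?case by simp
next
  case (Suc n)
  then have vs: "v \<noteq> s" by auto
  have sV: "s \<in> V" using assms S_sub by auto
  note p = parent_props[OF sV Suc.prems(1) vs]
  have "graph_dist spanner s v \<le> graph_dist spanner s (parent s v) + graph_dist spanner (parent s v) v"
    by (rule graph_dist_triangle)
  also have "\<dots> \<le> enat (d s (parent s v)) + 1"
  proof (rule add_mono)
    show "graph_dist spanner s (parent s v) \<le> enat (d s (parent s v))"
      using p nbrs_V[OF p(1)] vs Suc.prems Suc.hyps(2)
      by (intro Suc.hyps(1) incl.via_child) auto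
    show "graph_dist spanner (parent s v) v \<le> 1"
      using assms Suc vs by (intro graph_dist_edge) (auto simp: spanner_def insert_commute)
  qed
  also have "\<dots> = enat (d s v)" using p(2) by (simp add: one_enat_def)
  finally show ?case .
qed

section \<open>Stretch of the spanner\<close>

context
  assumes hit: "\<And>s v. s \<in> S \<Longrightarrow> v \<in> V \<Longrightarrow> k < nmiss s v \<Longrightarrow> touched s v \<inter> R \<noteq> {}"
begin

lemma sourcewise:
  assumes "s \<in> S" "v \<in> V"
  shows "graph_dist spanner s v \<le> enat (d s v + 2)"
  using assms(2)
proof (induction "d s v" arbitrary: v rule: less_induct)
  case less
  have sV: "s \<in> V" using assms S_sub by auto
  consider "v = s" | "v \<noteq> s" "\<not> miss (parent s v) v"
    | c where "v \<noteq> s" "ctr v = Some c" "nmiss s v \<le> k" | "v \<noteq> s" "k < nmiss s v"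
    unfolding miss_def by (metis linorder_not_le not_None_eq)
  then show ?case
  proof cases
    case 2
    note p = parent_props[OF sV less.prems 2(1)]
    have "graph_dist spanner s v \<le> graph_dist spanner s (parent s v) + graph_dist spanner (parent s v) v"
      by (rule graph_dist_triangle)
    also have "\<dots> \<le> enat (d s (parent s v) + 2) + 1"
      using p nbrs_V[OF p(1)] 2 nbrs_sym[of v E "parent s v"]
      by (intro add_mono less.hyps spanner_edge) auto
    also have "\<dots> = enat (d s v + 2)" using p(2) by (simp add: one_enat_def)
    finally show ?thesis .
  next
    case 3
    obtain y where y: "chosen c s y" "d s y \<le> d s v" using chosen_ex 3 by blast
    then have cy: "ctr y = Some c" by (simp add: chosen_def)
    \<comment> \<open>Both \<open>y\<close> and \<open>v\<close> are joined to the centre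
      \<open>c\<close>, and \<open>y\<close> is no farther from \<open>s\<close> than
      \<open>v\<close>.\<close>
    have "graph_dist spanner s v \<le> graph_dist spanner s y + graph_dist spanner y v"
      by (rule graph_dist_triangle)
    also have "\<dots> \<le> graph_dist spanner s y + (graph_dist spanner y c + graph_dist spanner c v)"
      by (intro add_left_mono graph_dist_triangle)
    also have "\<dots> \<le> enat (d s y) + (1 + 1)"
      using spanner_ctr[OF cy] spanner_ctr[OF 3(2)] assms(1) ctr_V[OF cy] y(1)
      by (intro add_mono incl_dist) (auto intro: incl.via_centre simp: graph_dist_commute)
    also have "\<dots> \<le> enat (d s v + 2)" using y(2) by (simp add: one_enat_def)
    finally show ?thesis .
  next
    case 4
    then obtain r i where r: "r \<in> R" and i: "i \<le> d s v" and c: "ctr ((parent s ^^ i) v) = Some r"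
      using hit[OF assms(1) less.prems] by (auto simp: touched_def)
    let ?x = "(parent s ^^ i) v"
    note x = parent_pow[OF sV less.prems i]
    have rV: "r \<in> V" "r \<in> S" using r R_sub S_sub by auto
    have "graph_dist spanner s v \<le> graph_dist spanner r s + graph_dist spanner r v"
      using graph_dist_triangle[of spanner s v r] by (simp add: graph_dist_commute)
    also have "\<dots> \<le> enat (d r s) + enat (d r v)"
      using rV r sV less.prems by (intro add_mono incl_dist) (auto intro: incl.via_root)
    \<comment> \<open>The shortest path passes through \<open>?x\<close>, at distance at most 1 from
      \<open>r\<close>, so going through \<open>r\<close> loses at most 1 on either side.\<close>
    also have "\<dots> \<le> enat (d s v + 2)"
      using d_triangle[OF rV(1) x(1) sV] d_triangle[OF rV(1) x(1) less.prems] x i d_ctr_le[OF c]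
      by (simp add: d_commute[of s])
    finally show ?thesis .
  qed simp
qed

lemma additive_spanner: "additive_spanner 4 V E spanner"
proof -
  have "graph_dist spanner u v \<le> enat (d u v + 4)" if u: "u \<in> V" and v: "v \<in> V" for u v
    using u
  proof (induction "d v u" arbitrary: u rule: less_induct)
    case less
    show ?case
    proof (cases "u = v")
      case False
      then obtain w where w: "w \<in> N u" "d v w + 1 = d v u" using d_pred[of v u] less.prems v by metis
      show ?thesis
      proof (cases "miss u w")
        case False
        have "graph_dist spanner u v \<le> graph_dist spanner u w + graph_dist spanner w v"
          by (rule graph_dist_triangle)
        also have "\<dots> \<le> 1 + enat (d w v + 4)"
          using w False nbrs_V[OF w(1)] by (intro add_mono less.hyps spanner_edge) auto
        also have "\<dots> = enat (d u v + 4)" using w(2) by (simp add: one_enat_def d_commute[of v])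
        finally show ?thesis .
      next
        case True
        then obtain s where s: "ctr u = Some s" by (auto simp: miss_def)
        then have sS: "s \<in> S" "s \<in> V" using ctr_Some ctr_V by auto
        have "graph_dist spanner u v \<le> graph_dist spanner u s + graph_dist spanner s v"
          by (rule graph_dist_triangle)
        also have "\<dots> \<le> 1 + enat (d s v + 2)"
          using sS v by (intro add_mono sourcewise spanner_ctr s) auto
        also have "\<dots> \<le> enat (d u v + 4)"
          using d_triangle[OF sS(2) less.prems v] d_ctr_le[OF s] by (simp add: one_enat_def)
        finally show ?thesis .
      qed
    qed simp
  qed
  then show ?thesis
    unfolding additive_spanner_def using spanner_sub by (simp add: graph_dist_eq)
qed

end

section \<open>Size of the spanner\<close>

lemma incl_cases:
  assumes "incl s v" "s \<in> S"
  shows "s \<in> R \<or> (\<exists>c y i. c \<in> S \<and> chosen c s y \<and> i \<le> d s y \<and> v = (parent s ^^ i) y)"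
  using assms(1)
proof (induction rule: incl.induct)
  case (via_centre c v)
  then have "c \<in> S" using ctr_Some[of v c] by (auto simp: chosen_def)
  with via_centre show ?case by (intro disjI2 exI[of _ c] exI[of _ v] exI[of _ 0]) auto
next
  case (via_child v)
  then show ?case
  proof (elim disjE exE conjE)
    fix c y i assume *: "c \<in> S" "chosen c s y" "i \<le> d s y" "v = (parent s ^^ i) y"
    have "y \<in> V" "s \<in> V" using *(2) assms ctr_V S_sub by (auto simp: chosen_def)
    then have "i \<noteq> d s y" using * via_child.hyps parent_pow_top by auto
    with * show ?thesis
      by (intro disjI2 exI[of _ c] exI[of _ y] exI[of _ "Suc i"]) auto
  qed simp
qed simp

text \<open>\<open>B1\<close> has the edges at unclustered vertices, \<open>B2\<close> those to
  centres, \<open>T\<close> the trees of the roots and \<open>Q\<close> the missing edges of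
  selected paths. The other edges of a selected path are in \<open>B1\<close> or \<open>B2\<close>,
  so each pair of a source and a cluster contributes at most \<open>k\<close>.\<close>

lemma card_spanner_le:
  assumes deg: "\<And>v. v \<in> V \<Longrightarrow> ctr v = None \<Longrightarrow> card (N v) \<le> \<Delta>"
  shows "card spanner \<le> card V * \<Delta> + card V + card R * card V + (card S)\<^sup>2 * k"
proof -
  have finS: "finite S" "finite R" using finite_subset[OF S_sub finite_V] finite_subset[OF R_sub] by auto
  define B1 where "B1 = (\<Union>v\<in>{v\<in>V. ctr v = None}. (\<lambda>w. {v, w}) ` N v)"
  define B2 where "B2 = (\<lambda>v. {v, the (ctr v)}) ` V"
  define T where "T = (\<lambda>(s, v). {v, parent s v}) ` (R \<times> V)"
  define Y where "Y p = (THE y. chosen (snd p) (fst p) y)" for p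
  define Q where "Q = (\<Union>p\<in>{p \<in> S \<times> S. \<exists>y. chosen (snd p) (fst p) y}. (\<lambda>i. {(parent (fst p) ^^ i) (Y p),
     (parent (fst p) ^^ Suc i) (Y p)}) ` miss_steps (fst p) (Y p))"
  have Y: "Y (s, c) = y" if "chosen c s y" for s c y
    unfolding Y_def fst_conv snd_conv using that chosen_unique by blast
  have "spanner \<subseteq> B1 \<union> B2 \<union> T \<union> Q"
  proof
    fix e assume e: "e \<in> spanner"
    then obtain v w where vw: "e = {v, w}" "w \<in> N v"
      using parent_props(1) S_sub by (auto simp: spanner_def)
    show "e \<in> B1 \<union> B2 \<union> T \<union> Q"
    proof (cases "miss v w")
      case False
      then consider "ctr v = None" | "ctr w = None" | "ctr v = Some w" | "ctr w = Some v"
        by (auto simp: miss_def)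
      then have "e \<in> B1 \<union> B2"
      proof cases
        case 1
        then have "{v, w} \<in> B1" unfolding B1_def using vw(2) nbrs_V(2)[OF vw(2)] by blast
        with vw(1) show ?thesis by simp
      next
        case 2
        then have "{w, v} \<in> B1"
          unfolding B1_def using vw(2) nbrs_V(1)[OF vw(2)] nbrs_sym[of w E v] by blast
        with vw(1) show ?thesis by (simp add: insert_commute)
      next
        case 3
        then have "e \<in> B2"
          unfolding B2_def vw(1) using nbrs_V(2)[OF vw(2)] by (intro rev_image_eqI[of v]) auto
        then show ?thesis by simp
      next
        case 4
        then have "e \<in> B2"
          unfolding B2_def vw(1) using nbrs_V(1)[OF vw(2)] by (intro rev_image_eqI[of w]) auto
        then show ?thesis by simp
      qed
      then show ?thesis by blast
    next
      case True
      from e consider v' w' where "e = {v', w'}" "\<not> miss v' w'"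
        | s u where "e = {u, parent s u}" "s \<in> S" "u \<in> V" "incl s u" "u \<noteq> s"
        by (auto simp: spanner_def)
      then show ?thesis
      proof cases
        case 1
        with True vw show ?thesis by (auto simp: doubleton_eq_iff miss_commute)
      next
        case 2
        from incl_cases[OF 2(4,2)] show ?thesis
        proof (elim disjE exE conjE)
          assume "s \<in> R"
          with 2 show ?thesis by (auto simp: T_def)
        next
          fix c y i assume *: "c \<in> S" "chosen c s y" "i \<le> d s y" "u = (parent s ^^ i) y"
          have "y \<in> V" "s \<in> V" using *(2) 2 ctr_V S_sub by (auto simp: chosen_def)
          then have "i \<noteq> d s y" using * 2 parent_pow_top by auto
          moreover have "miss (parent s u) u" using True vw(1) 2(1) by (auto simp: doubleton_eq_iff miss_commute)
          ultimately have "i \<in> miss_steps s y" using * by (auto simp: miss_steps_def)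
          then have "e \<in> Q"
            unfolding Q_def using * 2 by (intro UN_I[of "(s, c)"]) (auto simp: Y)
          then show ?thesis by simp
        qed
      qed
    qed
  qed
  moreover have "card B1 \<le> card V * \<Delta>" "finite B1"
  proof -
    have "card B1 \<le> (\<Sum>v\<in>{v\<in>V. ctr v = None}. card ((\<lambda>w. {v, w}) ` N v))"
      unfolding B1_def using finite_V by (intro card_UN_le) auto
    also have "\<dots> \<le> (\<Sum>v\<in>{v\<in>V. ctr v = None}. \<Delta>)"
      using deg finite_nbrs by (intro sum_mono order_trans[OF card_image_le]) auto
    also have "\<dots> \<le> card V * \<Delta>" using finite_V by (auto intro!: mult_right_mono card_mono)
    finally show "card B1 \<le> card V * \<Delta>" .
    show "finite B1" unfolding B1_def using finite_V finite_nbrs by auto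
  qed
  moreover have "card B2 \<le> card V" "finite B2"
    unfolding B2_def using finite_V by (auto intro: card_image_le)
  moreover have "card T \<le> card R * card V" "finite T"
    unfolding T_def using finS finite_V card_image_le[of "R \<times> V"] by (auto simp: card_cartesian_product)
  moreover have "card Q \<le> (card S)\<^sup>2 * k" "finite Q"
  proof -
    let ?I = "{p \<in> S \<times> S. \<exists>y. chosen (snd p) (fst p) y}"
    have finI: "finite ?I" using finS by auto
    have "card Q \<le> (\<Sum>p\<in>?I. card ((\<lambda>i. {(parent (fst p) ^^ i) (Y p),
        (parent (fst p) ^^ Suc i) (Y p)}) ` miss_steps (fst p) (Y p)))"
      unfolding Q_def by (rule card_UN_le[OF finI])
    also have "\<dots> \<le> (\<Sum>p\<in>?I. k)"
    proof (rule sum_mono)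
      fix p assume "p \<in> ?I"
      then obtain y where y: "chosen (snd p) (fst p) y" "fst p \<in> S" by auto
      then have Yp: "Y p = y" using Y[of "snd p" "fst p" y] by simp
      have "card ((\<lambda>i. {(parent (fst p) ^^ i) y, (parent (fst p) ^^ Suc i) y}) ` miss_steps (fst p) y)
          \<le> card (miss_steps (fst p) y)"
        by (rule card_image_le) (simp add: miss_steps_def)
      also have "\<dots> = nmiss (fst p) y"
        using y S_sub ctr_V by (intro card_miss_steps) (auto simp: chosen_def)
      also have "\<dots> \<le> k" using y by (simp add: chosen_def)
      finally show "card ((\<lambda>i. {(parent (fst p) ^^ i) (Y p),
          (parent (fst p) ^^ Suc i) (Y p)}) ` miss_steps (fst p) (Y p)) \<le> k" unfolding Yp .
    qed
    also have "card ?I \<le> card (S \<times> S)" by (rule card_mono) (use finS in auto)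
    then have "(\<Sum>p\<in>?I. k) \<le> card (S \<times> S) * k" by simp
    finally show "card Q \<le> (card S)\<^sup>2 * k" by (simp add: card_cartesian_product power2_eq_square)
    show "finite Q" unfolding Q_def using finI by (auto simp: miss_steps_def)
  qed
  ultimately have "card spanner \<le> card (B1 \<union> B2 \<union> T \<union> Q)" by (intro card_mono) auto
  also have "\<dots> \<le> card B1 + card B2 + card T + card Q"
    by (meson card_Un_le add_right_mono order_trans)
  finally show ?thesis
    using \<open>card B1 \<le> _\<close> \<open>card B2 \<le> _\<close> \<open>card T \<le> _\<close> \<open>card Q \<le> _\<close> by linarith
qed

end

section \<open>Random sets of vertices\<close>

lemma prob_geometric_ge:
  "measure_pmf.prob (geometric_pmf (1/2)) {l..} = (1/2) ^ l"
proof -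
  have "measure_pmf.prob (geometric_pmf (1/2)) {..<l} = (\<Sum>i<l. (1/2) ^ i * (1/2))"
    by (subst measure_measure_pmf_finite) auto
  also have "\<dots> = 1 - (1/2) ^ l" by (induction l) auto
  finally have "measure_pmf.prob (geometric_pmf (1/2)) {..<l} = 1 - (1/2) ^ l" .
  moreover have "{l..} = UNIV - {..<l}" by auto
  ultimately show ?thesis using measure_pmf.prob_compl[of "{..<l}" "geometric_pmf (1/2)"] by simp
qed

lemma prob_bind_le:
  assumes "\<And>x. measure_pmf.prob (f x) A \<le> b"
  shows "measure_pmf.prob (bind_pmf p f) A \<le> b"
proof -
  have b: "0 \<le> b" using assms measure_nonneg order_trans by blast
  have "emeasure (measure_pmf (bind_pmf p f)) A = (\<integral>\<^sup>+x. emeasure (measure_pmf (f x)) A \<partial>measure_pmf p)"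
    by (rule emeasure_bind_pmf)
  also have "\<dots> \<le> (\<integral>\<^sup>+x. ennreal b \<partial>measure_pmf p)"
    using assms by (intro nn_integral_mono) (simp add: measure_pmf.emeasure_eq_measure ennreal_leI)
  also have "\<dots> = ennreal b" by simp
  finally show ?thesis using b by (simp add: measure_pmf.emeasure_eq_measure)
qed

lemma Pi_pmf_pair:
  assumes "finite A"
  shows "Pi_pmf A (d1, d2) (\<lambda>_. pair_pmf p q) =
    bind_pmf (Pi_pmf A d1 (\<lambda>_. p)) (\<lambda>f. map_pmf (\<lambda>g v. (f v, g v)) (Pi_pmf A d2 (\<lambda>_. q)))"
proof -
  have "Pi_pmf A (d1, d2) (\<lambda>_. bind_pmf p (\<lambda>x. map_pmf (Pair x) q)) =
      bind_pmf (Pi_pmf A d1 (\<lambda>_. p)) (\<lambda>f. Pi_pmf A (d1, d2) (\<lambda>v. map_pmf (Pair (f v)) q))"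
    by (rule Pi_pmf_bind[OF assms])
  also have "\<dots> = bind_pmf (Pi_pmf A d1 (\<lambda>_. p)) (\<lambda>f. map_pmf (\<lambda>g v. (f v, g v)) (Pi_pmf A d2 (\<lambda>_. q)))"
  proof (rule bind_pmf_cong[OF refl])
    fix f assume "f \<in> set_pmf (Pi_pmf A d1 (\<lambda>_. p))"
    then have f: "f v = d1" if "v \<notin> A" for v using set_Pi_pmf_subset[OF assms] that by fastforce
    have "Pi_pmf A (d1, d2) (\<lambda>v. map_pmf (Pair (f v)) q) =
        map_pmf (\<lambda>g v. if v \<in> A then (f v, g v) else (d1, d2)) (Pi_pmf A d2 (\<lambda>_. q))"
      by (rule Pi_pmf_map_dependent[OF assms])
    also have "\<dots> = map_pmf (\<lambda>g v. (f v, g v)) (Pi_pmf A d2 (\<lambda>_. q))"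
    proof (rule map_pmf_cong[OF refl])
      fix g assume "g \<in> set_pmf (Pi_pmf A d2 (\<lambda>_. q))"
      then have "g v = d2" if "v \<notin> A" for v using set_Pi_pmf_subset[OF assms] that by fastforce
      with f show "(\<lambda>v. if v \<in> A then (f v, g v) else (d1, d2)) = (\<lambda>v. (f v, g v))" by auto
    qed
    finally show "Pi_pmf A (d1, d2) (\<lambda>v. map_pmf (Pair (f v)) q) =
        map_pmf (\<lambda>g v. (f v, g v)) (Pi_pmf A d2 (\<lambda>_. q))" .
  qed
  finally show ?thesis by (simp add: pair_pmf_def map_pmf_def)
qed

text \<open>Conditioning on the first coordinates: a bound over the second ones that is uniform in
  \<open>f\<close> suffices.\<close>

lemma prob_Pi_pair_le:
  assumes "finite A" "\<And>f. measure_pmf.prob (Pi_pmf A d2 (\<lambda>_. q)) {g. Q (\<lambda>v. (f v, g v))} \<le> b"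
  shows "measure_pmf.prob (Pi_pmf A (d1, d2) (\<lambda>_. pair_pmf p q)) {\<omega>. Q \<omega>} \<le> b"
  unfolding Pi_pmf_pair[OF assms(1)]
  using assms(2) by (intro prob_bind_le) (simp add: vimage_def)

lemma prob_Pi_avoid:
  assumes "finite A" "T \<subseteq> A"
  shows "measure_pmf.prob (Pi_pmf A d (\<lambda>_. p)) {\<omega>. \<forall>v\<in>T. \<omega> v \<notin> B} = (1 - measure_pmf.prob p B) ^ card T"
proof -
  have "{\<omega>. \<forall>v\<in>T. \<omega> v \<notin> B} = Pi A (\<lambda>v. if v \<in> T then - B else UNIV)"
    using assms(2) by (auto simp: Pi_def)
  then have "measure_pmf.prob (Pi_pmf A d (\<lambda>_. p)) {\<omega>. \<forall>v\<in>T. \<omega> v \<notin> B} =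
      (\<Prod>v\<in>A. measure_pmf.prob p (if v \<in> T then - B else UNIV))"
    by (simp add: measure_Pi_pmf_Pi[OF assms(1)])
  also have "\<dots> = (\<Prod>v\<in>T. measure_pmf.prob p (- B))"
    using assms by (intro prod.mono_neutral_cong_right) auto
  also have "measure_pmf.prob p (- B) = 1 - measure_pmf.prob p B"
    using measure_pmf.prob_compl[of B p] by (simp add: Compl_eq_Diff_UNIV)
  finally show ?thesis by simp
qed

text \<open>Markov's inequality for \<open>2 ^ X\<close>, where \<open>X\<close> counts the hits:
  its factors are independent with mean \<open>1 + p\<close>, at most \<open>exp p\<close>.\<close>

lemma prob_Pi_card_ge:
  fixes B :: "'b set"
  assumes "finite A"
  shows "measure_pmf.prob (Pi_pmf A d (\<lambda>_. p)) {\<omega>. K \<le> card {v \<in> A. \<omega> v \<in> B}}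
     \<le> exp (real (card A) * measure_pmf.prob p B) / 2 ^ K"
proof -
  define X where "X \<omega> = (\<Prod>v\<in>A. 1 + indicator B (\<omega> v) :: real)" for \<omega>
  have X: "X \<omega> = 2 ^ card {v \<in> A. \<omega> v \<in> B}" for \<omega>
  proof -
    have "X \<omega> = (\<Prod>v\<in>A. if \<omega> v \<in> B then 2 else 1)"
      unfolding X_def by (intro prod.cong) (auto simp: indicator_def)
    also have "\<dots> = (\<Prod>v\<in>{v\<in>A. \<omega> v \<in> B}. 2)"
      using assms by (intro prod.inter_filter[symmetric])
    finally show ?thesis by simp
  qed
  let ?M = "measure_pmf (Pi_pmf A d (\<lambda>_. p))"
  have bd: "norm (X \<omega>) \<le> 2 ^ card A" for \<omega>
    unfolding X using assms by (auto intro!: power_increasing card_mono)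
  have int: "integrable ?M X"
    by (rule measure_pmf.integrable_const_bound[where B = "2 ^ card A"]) (use bd in auto)
  have "measure ?M {\<omega>. K \<le> card {v \<in> A. \<omega> v \<in> B}} \<le> measure ?M {\<omega> \<in> space ?M. 2 ^ K \<le> X \<omega>}"
    by (intro measure_pmf.finite_measure_mono) (auto simp: X)
  also have "\<dots> \<le> (LINT \<omega>|?M. X \<omega>) / 2 ^ K"
    by (rule integral_Markov_inequality_measure[OF int, where A = "{}"]) (auto simp: X)
  also have "(LINT \<omega>|?M. X \<omega>) = (\<Prod>v\<in>A. LINT x|measure_pmf p. 1 + indicator B x)"
    unfolding X_def by (rule expectation_prod_Pi_pmf[OF assms])
      (auto intro!: measure_pmf.integrable_const_bound[where B = 2] simp: indicator_def)
  also have "(LINT x|measure_pmf p. 1 + indicator B x) = 1 + measure_pmf.prob p B"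
    by (subst Bochner_Integration.integral_add)
      (auto intro!: integrable_real_indicator simp: less_top[symmetric])
  also have "(\<Prod>v\<in>A. 1 + measure_pmf.prob p B) = (1 + measure_pmf.prob p B) ^ card A" by simp
  also have "\<dots> \<le> exp (measure_pmf.prob p B) ^ card A"
    by (intro power_mono exp_ge_add_one_self) auto
  also have "\<dots> = exp (real (card A) * measure_pmf.prob p B)"
    by (simp add: exp_of_nat_mult)
  finally show ?thesis by (simp add: divide_right_mono)
qed

section \<open>Parameters\<close>

text \<open>For \<open>0 < x \<le> 1\<close>, the exponent of the least power of \<open>1/2\<close>
  that is at least \<open>x\<close>; 0 for larger \<open>x\<close>.\<close>

definition level :: "real \<Rightarrow> nat" where
  "level x = nat \<lfloor>log 2 (1 / x)\<rfloor>"

lemma level_bounds: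
  assumes "0 < x"
  shows "(1/2) ^ level x \<le> 2 * x" "min 1 x \<le> (1/2) ^ level x"
proof -
  have "(1/2) ^ level x \<le> 2 * x \<and> min 1 x \<le> (1/2) ^ level x"
  proof (cases "1 \<le> x")
    case True
    then have "log 2 (1 / x) \<le> 0" using assms by (simp add: log_divide)
    then have "level x = 0" by (simp add: level_def)
    with True show ?thesis by simp
  next
    case False
    define l where "l = level x"
    have "0 \<le> log 2 (1 / x)" using assms False by (simp add: log_divide)
    then have l: "real l \<le> log 2 (1 / x)" "log 2 (1 / x) < real l + 1"
      unfolding l_def level_def by linarith+
    have "2 ^ l \<le> 1 / x"
      using l(1) assms by (simp add: le_log_iff powr_realpow)
    moreover have "1 / x < 2 ^ Suc l"
      using l(2) assms by (simp add: log_less_iff powr_realpow powr_add)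
    ultimately show ?thesis using assms False unfolding l_def[symmetric]
      by (simp add: field_simps power_divide)
  qed
  then show "(1/2) ^ level x \<le> 2 * x" "min 1 x \<le> (1/2) ^ level x" by auto
qed

section \<open>Rates of centres, roots and missing edges\<close>

definition rateS :: "nat \<Rightarrow> real" where
  "rateS n = real n powr (3/5) * log 2 (real n) powr (1/5)"

definition rateR :: "nat \<Rightarrow> real" where
  "rateR n = real n powr (2/5) * log 2 (real n) powr (4/5)"

definition rate_miss :: "nat \<Rightarrow> real" where
  "rate_miss n = real n powr (1/5) * log 2 (real n) powr (2/5)"

definition rate_edges :: "nat \<Rightarrow> real" where
  "rate_edges n = real n powr (7/5) * log 2 (real n) powr (4/5)"

context
  fixes n :: nat
  assumes n: "2 \<le> n"
begin

lemma log_n: "1 \<le> log 2 (real n)" "ln (real n) \<le> log 2 (real n)"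
proof -
  show "1 \<le> log 2 (real n)" using n by simp
  have "ln 2 \<le> (1::real)" using ln_2_less_1 by simp
  then show "ln (real n) \<le> log 2 (real n)"
    using n unfolding log_def by (simp add: le_divide_eq mult_left_le)
qed

lemma rates_ge_1: "1 \<le> rateS n" "1 \<le> rateR n" "1 \<le> rate_miss n" "real n \<le> rate_edges n"
proof -
  have 1: "1 \<le> real n powr a" "1 \<le> log 2 (real n) powr a" if "0 \<le> a" for a
    using n log_n that by (auto intro!: ge_one_powr_ge_zero)
  show "1 \<le> rateS n" "1 \<le> rateR n" "1 \<le> rate_miss n"
    unfolding rateS_def rateR_def rate_miss_def
    by (rule order_trans[OF _ mult_mono[OF 1]], simp_all add: 1)+
  have "real n powr 1 * 1 \<le> rate_edges n"
    unfolding rate_edges_def using n 1 by (intro mult_mono powr_mono) auto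
  then show "real n \<le> rate_edges n" by simp
qed

text \<open>The first equation lets centres hit neighbourhoods of size about \<open>rateR\<close>,
  the second lets roots hit about \<open>rate_miss\<close> clusters, and the last two make the main
  terms of the size equal.\<close>

lemma rates_mult:
  "rateS n * rateR n = real n * log 2 (real n)"
  "rateS n * log 2 (real n) = rateR n * rate_miss n"
  "real n * rateR n = rate_edges n"
  "(rateS n)\<^sup>2 * rate_miss n = rate_edges n"
proof -
  \<comment> \<open>In terms of \<open>ln n\<close> and \<open>ln (log 2 n)\<close> only identities
    between exponents remain.\<close>
  define x where "x = ln (real n)"
  define y where "y = ln (log 2 (real n))"
  have pos: "0 < real n" "0 < log 2 (real n)" using n log_n(1) by linarith+
  have n0: "real n = exp x" "log 2 (real n) = exp y"
    unfolding x_def y_def by (simp_all only: exp_ln pos)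
  have pw: "real n powr a = exp (a * x)" "log 2 (real n) powr a = exp (a * y)" for a
    using less_imp_neq[OF pos(1)] less_imp_neq[OF pos(2), symmetric]
    by (simp_all only: powr_def x_def y_def if_False not_False_eq_True neq_commute[of 0])
  show "rateS n * rateR n = real n * log 2 (real n)"
    "rateS n * log 2 (real n) = rateR n * rate_miss n"
    "real n * rateR n = rate_edges n"
    "(rateS n)\<^sup>2 * rate_miss n = rate_edges n"
    unfolding rateS_def rateR_def rate_miss_def rate_edges_def pw
    unfolding n0(2) unfolding n0(1) power2_eq_square exp_add[symmetric]
    by (rule arg_cong[where f = exp], simp add: field_simps)+
qed

text \<open>Makes exponential tails in the rates polynomially small in \<open>n\<close>. The factor
  \<open>2/5\<close> is the smaller of the two exponents of \<open>n\<close>, by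
  \<open>ln y \<le> y\<close>.\<close>

lemma rates_ge_ln: "2/5 * ln (real n) \<le> rateS n" "2/5 * ln (real n) \<le> rateR n"
proof -
  have ln_le: "a * ln (real n) \<le> real n powr a" if "0 < a" for a
  proof -
    have "ln (real n powr a) \<le> real n powr a" using n by (intro ln_bound) auto
    then show ?thesis using n by (simp add: ln_powr)
  qed
  have 1: "1 \<le> log 2 (real n) powr a" if "0 \<le> a" for a
    using log_n that by (auto intro!: ge_one_powr_ge_zero)
  have "0 \<le> ln (real n)" using n by simp
  then have "2/5 * ln (real n) \<le> 3/5 * ln (real n)" by simp
  also have "\<dots> \<le> real n powr (3/5) * 1" using ln_le[of "3/5"] by simp
  also have "\<dots> \<le> rateS n" unfolding rateS_def using 1 by (intro mult_left_mono) auto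
  finally show "2/5 * ln (real n) \<le> rateS n" .
  have "2/5 * ln (real n) \<le> real n powr (2/5) * 1" using ln_le[of "2/5"] by simp
  also have "\<dots> \<le> rateR n" unfolding rateR_def using 1 by (intro mult_left_mono) auto
  finally show "2/5 * ln (real n) \<le> rateR n" .
qed

text \<open>The sampling probabilities are \<open>rateS n / n\<close> for centres and \<open>log n / rate_miss n\<close> for the
  roots among them, up to rounding to a power of two.\<close>

lemma rounded_prob_pow_le:
  assumes x: "0 < x" and m: "0 < m" "b * log 2 (real n) \<le> x * real m" and b: "0 \<le> b"
  shows "(1 - (1/2) ^ level x) ^ m \<le> real n powr (- b)"
proof (cases "1 \<le> x")
  \<comment> \<open>Rounding gives probability 1, and the power vanishes because \<open>m\<close> is
    positive.\<close>
  case True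
  then have "(1/2::real) ^ level x = 1"
    using level_bounds[OF x] by (simp add: min_def power_le_one antisym)
  then show ?thesis using m(1) by (simp add: power_0_left)
next
  case False
  let ?p = "(1/2::real) ^ level x"
  have p: "x \<le> ?p" "?p \<le> 1" using level_bounds[OF x] False by (auto simp: power_le_one)
  have "(1 - ?p) ^ m \<le> exp (- ?p) ^ m"
    using p exp_ge_add_one_self[of "- ?p"] by (intro power_mono) auto
  also have "\<dots> = exp (- (?p * real m))" by (simp add: exp_of_nat_mult[symmetric] mult.commute)
  also have "\<dots> \<le> exp (- (b * ln (real n)))"
  proof -
    have "b * ln (real n) \<le> b * log 2 (real n)" using log_n b by (intro mult_left_mono) auto
    also have "\<dots> \<le> x * real m" by (rule m)
    also have "\<dots> \<le> ?p * real m" using p by (intro mult_right_mono) auto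
    finally show ?thesis by simp
  qed
  also have "\<dots> = real n powr (- b)" using n by (simp add: powr_def)
  finally show ?thesis .
qed

text \<open>As \<open>2 ^ K \<ge> exp (K / 2)\<close>, the quotient is at most
  \<open>exp (- (a - 8) / 2 * z)\<close>, and \<open>2/5\<close> times \<open>1/2\<close> is
  \<open>1/5\<close>. The mean may reach \<open>4 * z\<close> because roots are sampled with two
  probabilities, each up to doubled by rounding.\<close>

lemma exp_div_power_le:
  assumes z: "2/5 * ln (real n) \<le> z" and np: "\<mu> \<le> 4 * z" and K: "a * z \<le> real K" and a: "8 \<le> a"
  shows "exp \<mu> / 2 ^ K \<le> real n powr (- ((a - 8) / 5))"
proof -
  have "exp (1/2 * real K) = exp (1/2) ^ K" by (rule exp_of_nat2_mult)
  also have "\<dots> \<le> (2::real) ^ K" by (intro power_mono exp_half_le2) auto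
  finally have "exp (1/2 * real K) \<le> (2::real) ^ K" .
  then have "exp \<mu> / 2 ^ K \<le> exp \<mu> / exp (1/2 * real K)"
    by (intro divide_left_mono) auto
  also have "\<dots> = exp (\<mu> - 1/2 * real K)" by (simp add: exp_diff)
  also have "\<dots> \<le> exp (- ((a - 8) / 5 * ln (real n)))"
  proof -
    have "(a - 8) / 2 * (2/5 * ln (real n)) \<le> (a - 8) / 2 * z" using z a by (intro mult_left_mono) auto
    also have "\<dots> = 1/2 * (a * z) - 4 * z" by (simp add: field_simps)
    also have "\<dots> \<le> 1/2 * real K - \<mu>" using K np by simp
    finally show ?thesis by simp
  qed
  also have "\<dots> = real n powr (- ((a - 8) / 5))" using n by (simp add: powr_def)
  finally show ?thesis .
qed

end

section \<open>The random choices are good with high probability\<close>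

definition coin_pmf :: "(nat \<times> nat) pmf" where
  "coin_pmf = pair_pmf (geometric_pmf (1/2)) (geometric_pmf (1/2))"

definition level_centre :: "nat \<Rightarrow> nat" where
  "level_centre n = level (rateS n / real n)"

definition level_root :: "nat \<Rightarrow> nat" where
  "level_root n = level (log 2 (real n) / rate_miss n)"

definition miss_bound :: "real \<Rightarrow> nat \<Rightarrow> nat" where
  "miss_bound a n = nat \<lceil>a * rate_miss n\<rceil>"

definition centre_bound :: "real \<Rightarrow> nat \<Rightarrow> nat" where
  "centre_bound a n = nat \<lceil>a * rateS n\<rceil>"

definition root_bound :: "real \<Rightarrow> nat \<Rightarrow> nat" where
  "root_bound a n = nat \<lceil>a * rateR n\<rceil>"

definition centres :: "nat set \<Rightarrow> (nat \<Rightarrow> nat \<times> nat) \<Rightarrow> nat set" where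
  "centres V \<omega> = {v \<in> V. level_centre (card V) \<le> fst (\<omega> v)}"

definition roots :: "nat set \<Rightarrow> (nat \<Rightarrow> nat \<times> nat) \<Rightarrow> nat set" where
  "roots V \<omega> = {v \<in> V. level_centre (card V) \<le> fst (\<omega> v) \<and> level_root (card V) \<le> snd (\<omega> v)}"

context conn_graph
begin

definition good :: "real \<Rightarrow> (nat \<Rightarrow> nat \<times> nat) \<Rightarrow> bool" where
  "good a \<omega> \<longleftrightarrow>
     card (centres V \<omega>) < centre_bound a (card V) \<and>
     card (roots V \<omega>) < root_bound a (card V) \<and>
     (\<forall>v\<in>V. root_bound a (card V) \<le> card (N v) \<longrightarrow> centres V \<omega> \<inter> N v \<noteq> {}) \<and>
     (\<forall>s\<in>centres V \<omega>. \<forall>v\<in>V. miss_bound a (card V) < clustering.nmiss E (centres V \<omega>) s v \<longrightarrow>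
        clustering.touched E (centres V \<omega>) s v \<inter> roots V \<omega> \<noteq> {})"

context
  fixes a :: real and n :: nat and M :: "(nat \<Rightarrow> nat \<times> nat) pmf"
  assumes n: "2 \<le> n" and card_V: "card V = n" and a: "8 \<le> a"
  defines "M \<equiv> Pi_pmf V (0, 0) (\<lambda>_. coin_pmf)"
begin

lemma prob_coin:
  "measure_pmf.prob coin_pmf {x. l \<le> fst x} = (1/2) ^ l"
  "measure_pmf.prob coin_pmf {x. l \<le> fst x \<and> l' \<le> snd x} = (1/2) ^ l * (1/2) ^ l'"
proof -
  have "{x. l \<le> fst x \<and> l' \<le> snd x} = {l..} \<times> {l'..}" "{x :: nat \<times> nat. l \<le> fst x} = {l..} \<times> UNIV"
    by auto
  then show "measure_pmf.prob coin_pmf {x. l \<le> fst x} = (1/2) ^ l"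
    "measure_pmf.prob coin_pmf {x. l \<le> fst x \<and> l' \<le> snd x} = (1/2) ^ l * (1/2) ^ l'"
    unfolding coin_pmf_def by (simp_all add: measure_pmf_prob_product prob_geometric_ge)
qed

lemma many_centres:
  "measure_pmf.prob M {\<omega>. centre_bound a n \<le> card (centres V \<omega>)} \<le> real n powr (- ((a - 8) / 5))"
proof -
  let ?B = "{x :: nat \<times> nat. level_centre n \<le> fst x}"
  have "centres V \<omega> = {v \<in> V. \<omega> v \<in> ?B}" for \<omega>
    by (simp add: centres_def card_V)
  then have "measure_pmf.prob M {\<omega>. centre_bound a n \<le> card (centres V \<omega>)}
      \<le> exp (real n * (1/2) ^ level_centre n) / 2 ^ centre_bound a n"
    using prob_Pi_card_ge[OF finite_V, of "(0, 0)" coin_pmf "centre_bound a n" ?B]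
    by (simp add: M_def prob_coin card_V)
  also have "\<dots> \<le> real n powr (- ((a - 8) / 5))"
  proof (rule exp_div_power_le[OF n rates_ge_ln(1)[OF n] _ _ a])
    have "(1/2) ^ level_centre n \<le> 2 * (rateS n / real n)"
      unfolding level_centre_def using rates_ge_1[OF n] n by (intro level_bounds) auto
    then show "real n * (1/2) ^ level_centre n \<le> 4 * rateS n"
      using n rates_ge_1[OF n] by (simp add: field_simps)
    show "a * rateS n \<le> real (centre_bound a n)"
      unfolding centre_bound_def by (rule real_nat_ceiling_ge)
  qed
  finally show ?thesis .
qed

lemma many_roots:
  "measure_pmf.prob M {\<omega>. root_bound a n \<le> card (roots V \<omega>)} \<le> real n powr (- ((a - 8) / 5))"
proof -
  let ?B = "{x :: nat \<times> nat. level_centre n \<le> fst x \<and> level_root n \<le> snd x}"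
  have "roots V \<omega> = {v \<in> V. \<omega> v \<in> ?B}" for \<omega>
    by (simp add: roots_def card_V)
  then have "measure_pmf.prob M {\<omega>. root_bound a n \<le> card (roots V \<omega>)}
      \<le> exp (real n * ((1/2) ^ level_centre n * (1/2) ^ level_root n)) / 2 ^ root_bound a n"
    using prob_Pi_card_ge[OF finite_V, of "(0, 0)" coin_pmf "root_bound a n" ?B]
    by (simp add: M_def prob_coin card_V)
  also have "\<dots> \<le> real n powr (- ((a - 8) / 5))"
  proof (rule exp_div_power_le[OF n rates_ge_ln(2)[OF n] _ _ a])
    have 1: "(1/2) ^ level_centre n \<le> 2 * (rateS n / real n)"
      unfolding level_centre_def using rates_ge_1[OF n] n by (intro level_bounds) auto
    have 2: "(1/2) ^ level_root n \<le> 2 * (log 2 (real n) / rate_miss n)"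
      unfolding level_root_def using rates_ge_1[OF n] log_n(1)[OF n] by (intro level_bounds divide_pos_pos) linarith+
    have "real n * ((1/2) ^ level_centre n * (1/2) ^ level_root n)
        \<le> real n * (2 * (rateS n / real n) * (2 * (log 2 (real n) / rate_miss n)))"
      using 1 2 rates_ge_1[OF n] by (intro mult_left_mono mult_mono) auto
    also have "\<dots> = 4 * ((rateS n * log 2 (real n)) / rate_miss n)"
      using n by (simp add: field_simps)
    also have "\<dots> = 4 * rateR n"
      unfolding rates_mult(2)[OF n] using rates_ge_1[OF n] by simp
    finally show "real n * ((1/2) ^ level_centre n * (1/2) ^ level_root n) \<le> 4 * rateR n" .
    show "a * rateR n \<le> real (root_bound a n)"
      unfolding root_bound_def by (rule real_nat_ceiling_ge)
  qed
  finally show ?thesis .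
qed

text \<open>A vertex of degree \<open>a * rateR n\<close> expects at least about
  \<open>a * log 2 n\<close> centres among its neighbours; the factor \<open>n\<close> is a union
  bound.\<close>

lemma unclustered:
  "measure_pmf.prob M {\<omega>. \<exists>v\<in>V. root_bound a n \<le> card (N v) \<and> centres V \<omega> \<inter> N v = {}}
     \<le> real n * real n powr (- a)"
proof -
  let ?B = "{x :: nat \<times> nat. level_centre n \<le> fst x}"
  let ?W = "{v \<in> V. root_bound a n \<le> card (N v)}"
  have "{\<omega>. \<exists>v\<in>V. root_bound a n \<le> card (N v) \<and> centres V \<omega> \<inter> N v = {}}
      \<subseteq> (\<Union>v\<in>?W. {\<omega>. \<forall>u\<in>N v. \<omega> u \<notin> ?B})"
  proof
    fix \<omega> assume "\<omega> \<in> {\<omega>. \<exists>v\<in>V. root_bound a n \<le> card (N v) \<and> centres V \<omega> \<inter> N v = {}}"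
    then obtain v where v: "v \<in> ?W" "centres V \<omega> \<inter> N v = {}" by auto
    then have "\<forall>u\<in>N v. \<omega> u \<notin> ?B" using nbrs_sub[of v] by (auto simp: centres_def card_V)
    with v(1) show "\<omega> \<in> (\<Union>v\<in>?W. {\<omega>. \<forall>u\<in>N v. \<omega> u \<notin> ?B})" by blast
  qed
  then have "measure_pmf.prob M {\<omega>. \<exists>v\<in>V. root_bound a n \<le> card (N v) \<and> centres V \<omega> \<inter> N v = {}}
      \<le> measure_pmf.prob M (\<Union>v\<in>?W. {\<omega>. \<forall>u\<in>N v. \<omega> u \<notin> ?B})"
    by (rule measure_pmf.finite_measure_mono) simp
  also have "\<dots> \<le> (\<Sum>v\<in>?W. measure_pmf.prob M {\<omega>. \<forall>u\<in>N v. \<omega> u \<notin> ?B})"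
    using finite_V by (intro measure_pmf.finite_measure_subadditive_finite) auto
  also have "\<dots> \<le> (\<Sum>v\<in>?W. real n powr (- a))"
  proof (rule sum_mono)
    fix v assume v: "v \<in> ?W"
    have root: "a * rateR n \<le> real (root_bound a n)"
      unfolding root_bound_def by (rule real_nat_ceiling_ge)
    have pos: "0 < a * rateR n" using a rates_ge_1[OF n] by simp
    have "measure_pmf.prob M {\<omega>. \<forall>u\<in>N v. \<omega> u \<notin> ?B} = (1 - (1/2) ^ level_centre n) ^ card (N v)"
      unfolding M_def by (simp only: prob_Pi_avoid[OF finite_V nbrs_sub] prob_coin)
    also have "\<dots> \<le> real n powr (- a)"
      unfolding level_centre_def
    proof (rule rounded_prob_pow_le[OF n])
      show "0 < rateS n / real n" using n rates_ge_1[OF n] by simp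
      show "0 < card (N v)" using v root pos by (cases "card (N v)") auto
      have "a * log 2 (real n) = a * (rateS n * rateR n / real n)"
        using rates_mult(1)[OF n] n by simp
      also have "\<dots> = rateS n / real n * (a * rateR n)" by simp
      also have "\<dots> \<le> rateS n / real n * real (card (N v))"
        using v root rates_ge_1[OF n] by (intro mult_left_mono) auto
      finally show "a * log 2 (real n) \<le> rateS n / real n * real (card (N v))" .
      show "0 \<le> a" using a by simp
    qed
    finally show "measure_pmf.prob M {\<omega>. \<forall>u\<in>N v. \<omega> u \<notin> ?B} \<le> real n powr (- a)" .
  qed
  also have "\<dots> = real (card ?W) * real n powr (- a)" by simp
  also have "\<dots> \<le> real n * real n powr (- a)"
    using finite_V card_V by (intro mult_right_mono) (auto intro!: card_mono)
  finally show ?thesis .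
qed

text \<open>Fixing the centre coins fixes \<open>touched s v\<close>, whose members then become
  roots independently. The factor \<open>n^2\<close> is a union bound over the pairs
  \<open>(s, v)\<close>; the 3 in the exponent counts the missing edges charged to one
  cluster.\<close>

lemma untouched_roots:
  "measure_pmf.prob M {\<omega>. \<exists>s\<in>centres V \<omega>. \<exists>v\<in>V.
      miss_bound a n < clustering.nmiss E (centres V \<omega>) s v \<and>
      clustering.touched E (centres V \<omega>) s v \<inter> roots V \<omega> = {}}
     \<le> (real n)\<^sup>2 * real n powr (- (a / 3))"
  unfolding M_def coin_pmf_def
proof (rule prob_Pi_pair_le[OF finite_V])
  fix f :: "nat \<Rightarrow> nat"
  define S where "S = {v \<in> V. level_centre n \<le> f v}"
  interpret clustering V E S by unfold_locales (auto simp: S_def)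
  let ?G = "Pi_pmf V 0 (\<lambda>_. geometric_pmf (1/2))"
  let ?bad = "{g. \<exists>s\<in>centres V (\<lambda>v. (f v, g v)). \<exists>v\<in>V.
      miss_bound a n < clustering.nmiss E (centres V (\<lambda>v. (f v, g v))) s v \<and>
      clustering.touched E (centres V (\<lambda>v. (f v, g v))) s v \<inter> roots V (\<lambda>v. (f v, g v)) = {}}"
  let ?I = "{(s, v). s \<in> S \<and> v \<in> V \<and> miss_bound a n < nmiss s v}"
  have I: "finite ?I" "card ?I \<le> n\<^sup>2"
  proof -
    have "?I \<subseteq> V \<times> V" using S_sub by auto
    then show "finite ?I" "card ?I \<le> n\<^sup>2"
      using finite_V card_mono[of "V \<times> V" ?I]
      by (auto simp: card_V card_cartesian_product power2_eq_square intro: finite_subset)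
  qed
  have cS: "centres V (\<lambda>v. (f v, g v)) = S" for g :: "nat \<Rightarrow> nat"
    by (simp add: centres_def S_def card_V)
  have "?bad \<subseteq> (\<Union>p\<in>?I. {g. \<forall>c\<in>touched (fst p) (snd p). g c \<notin> {level_root n..}})"
  proof
    fix g assume "g \<in> ?bad"
    then obtain s v where sv: "s \<in> S" "v \<in> V" "miss_bound a n < nmiss s v"
      and empty: "touched s v \<inter> roots V (\<lambda>v. (f v, g v)) = {}" unfolding cS by blast
    have "\<forall>c\<in>touched s v. g c \<notin> {level_root n..}"
      using empty touched_sub[of s v] by (auto simp: roots_def S_def card_V)
    with sv show "g \<in> (\<Union>p\<in>?I. {g. \<forall>c\<in>touched (fst p) (snd p). g c \<notin> {level_root n..}})" by auto
  qed
  then have "measure_pmf.prob ?G ?bad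
      \<le> measure_pmf.prob ?G (\<Union>p\<in>?I. {g. \<forall>c\<in>touched (fst p) (snd p). g c \<notin> {level_root n..}})"
    by (rule measure_pmf.finite_measure_mono) simp
  also have "\<dots> \<le> (\<Sum>p\<in>?I. measure_pmf.prob ?G {g. \<forall>c\<in>touched (fst p) (snd p). g c \<notin> {level_root n..}})"
    using I by (intro measure_pmf.finite_measure_subadditive_finite) auto
  also have "\<dots> \<le> (\<Sum>p\<in>?I. real n powr (- (a / 3)))"
  proof (rule sum_mono)
    fix p assume p: "p \<in> ?I"
    let ?T = "touched (fst p) (snd p)"
    have "fst p \<in> V" "snd p \<in> V" using p S_sub by auto
    from nmiss_le_touched[OF this] p have "miss_bound a n < 3 * card ?T" by (auto split: prod.splits)
    moreover have "a * rate_miss n \<le> real (miss_bound a n)"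
      unfolding miss_bound_def by (rule real_nat_ceiling_ge)
    ultimately have T: "a * rate_miss n \<le> 3 * real (card ?T)" "0 < card ?T" by linarith+
    have "measure_pmf.prob ?G {g. \<forall>c\<in>?T. g c \<notin> {level_root n..}} = (1 - (1/2) ^ level_root n) ^ card ?T"
      using touched_sub S_sub by (subst prob_Pi_avoid[OF finite_V]) (auto simp: prob_geometric_ge)
    also have "\<dots> \<le> real n powr (- (a / 3))"
      unfolding level_root_def
    proof (rule rounded_prob_pow_le[OF n _ T(2)])
      have L: "0 < log 2 (real n)" using log_n(1)[OF n] by linarith
      then show "0 < log 2 (real n) / rate_miss n" using rates_ge_1[OF n] by (intro divide_pos_pos) linarith+
      have "a / 3 * log 2 (real n) = log 2 (real n) / rate_miss n * (a * rate_miss n / 3)"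
        using rates_ge_1(3)[OF n] by simp
      also have "\<dots> \<le> log 2 (real n) / rate_miss n * real (card ?T)"
        using T L rates_ge_1(3)[OF n] by (intro mult_left_mono) auto
      finally show "a / 3 * log 2 (real n) \<le> log 2 (real n) / rate_miss n * real (card ?T)" .
      show "0 \<le> a / 3" using a by simp
    qed
    finally show "measure_pmf.prob ?G {g. \<forall>c\<in>?T. g c \<notin> {level_root n..}} \<le> real n powr (- (a / 3))" .
  qed
  also have "\<dots> = real (card ?I) * real n powr (- (a / 3))" by simp
  also have "\<dots> \<le> (real n)\<^sup>2 * real n powr (- (a / 3))"
    using I(2) by (intro mult_right_mono) (auto simp flip: of_nat_power)
  finally show "measure_pmf.prob ?G ?bad \<le> (real n)\<^sup>2 * real n powr (- (a / 3))" .
qed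

lemma prob_good:
  assumes c: "0 < c" and ac: "5 * c + 18 \<le> a"
  shows "1 - real n powr (- c) \<le> measure_pmf.prob M {\<omega>. good a \<omega>}"
proof -
  let ?A = "{\<omega>. centre_bound a n \<le> card (centres V \<omega>)}"
  let ?B = "{\<omega>. root_bound a n \<le> card (roots V \<omega>)}"
  let ?C = "{\<omega>. \<exists>v\<in>V. root_bound a n \<le> card (N v) \<and> centres V \<omega> \<inter> N v = {}}"
  let ?D = "{\<omega>. \<exists>s\<in>centres V \<omega>. \<exists>v\<in>V.
      miss_bound a n < clustering.nmiss E (centres V \<omega>) s v \<and>
      clustering.touched E (centres V \<omega>) s v \<inter> roots V \<omega> = {}}"
  \<comment> \<open>Each of the four events gets this probability, and \<open>4 \<le> n^2\<close>
    absorbs their number. The bounds on centres and roots are the tightest: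
    \<open>(a - 8) / 5 = c + 2\<close> at \<open>a = 5 * c + 18\<close>.\<close>
  let ?e = "real n powr (- c - 2)"
  have pw: "real n powr x \<le> ?e" if "x \<le> - c - 2" for x
    using n that by (intro powr_mono) auto
  have ex: "- ((a - 8) / 5) \<le> - c - 2" "1 + - a \<le> - c - 2" "2 + - (a / 3) \<le> - c - 2"
    using ac c by (simp_all add: field_simps)
  have n1: "real n * real n powr x = real n powr (1 + x)" "(real n)\<^sup>2 * real n powr x = real n powr (2 + x)" for x
    using n by (simp_all add: powr_add)
  have "measure_pmf.prob M {\<omega>. \<not> good a \<omega>} \<le> measure_pmf.prob M (?A \<union> ?B \<union> ?C \<union> ?D)"
    by (rule measure_pmf.finite_measure_mono) (auto simp: good_def card_V not_less)
  also have "\<dots> \<le> measure_pmf.prob M (?A \<union> ?B \<union> ?C) + measure_pmf.prob M ?D"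
    by (intro measure_subadditive) auto
  also have "measure_pmf.prob M (?A \<union> ?B \<union> ?C) \<le> measure_pmf.prob M (?A \<union> ?B) + measure_pmf.prob M ?C"
    by (intro measure_subadditive) auto
  also have "measure_pmf.prob M (?A \<union> ?B) \<le> measure_pmf.prob M ?A + measure_pmf.prob M ?B"
    by (intro measure_subadditive) auto
  also have "measure_pmf.prob M ?A \<le> ?e"
    by (rule order_trans[OF many_centres pw[OF ex(1)]])
  also have "measure_pmf.prob M ?B \<le> ?e"
    by (rule order_trans[OF many_roots pw[OF ex(1)]])
  also have "measure_pmf.prob M ?C \<le> ?e"
    by (rule order_trans[OF unclustered[unfolded n1] pw[OF ex(2)]])
  also have "measure_pmf.prob M ?D \<le> ?e"
    by (rule order_trans[OF untouched_roots[unfolded n1] pw[OF ex(3)]])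
  finally have "measure_pmf.prob M {\<omega>. \<not> good a \<omega>} \<le> 4 * ?e" by simp
  also have "\<dots> \<le> (real n)\<^sup>2 * ?e"
    using n power_mono[of 2 "real n" 2] by (intro mult_right_mono) auto
  also have "\<dots> = real n powr (- c)" unfolding n1 by simp
  finally have "measure_pmf.prob M {\<omega>. \<not> good a \<omega>} \<le> real n powr (- c)" .
  moreover have "measure_pmf.prob M {\<omega>. \<not> good a \<omega>} = 1 - measure_pmf.prob M {\<omega>. good a \<omega>}"
    using measure_pmf.prob_compl[of "{\<omega>. good a \<omega>}" M] by (simp add: Collect_neg_eq Compl_eq_Diff_UNIV)
  ultimately show ?thesis by simp
qed

end

lemma good_spanner:
  assumes n: "2 \<le> card V" and a: "1 \<le> a" and g: "good a \<omega>"
  defines "F \<equiv> spanner_choice.spanner V E (centres V \<omega>) (roots V \<omega>) (miss_bound a (card V))"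
  shows "additive_spanner 4 V E F"
    "real (card F) \<le> ((a + 1) ^ 3 + 2 * (a + 1) + 1) * rate_edges (card V)"
proof -
  let ?n = "card V"
  interpret spanner_choice V E "centres V \<omega>" "roots V \<omega>" "miss_bound a ?n"
    by unfold_locales (auto simp: centres_def roots_def)
  show "additive_spanner 4 V E F"
    unfolding F_def using g by (intro additive_spanner) (auto simp: good_def)
  have "card F \<le> ?n * root_bound a ?n + ?n + card (roots V \<omega>) * ?n + (card (centres V \<omega>))\<^sup>2 * miss_bound a ?n"
    unfolding F_def
  proof (rule card_spanner_le)
    fix v assume "v \<in> V" "ctr v = None"
    with g show "card (N v) \<le> root_bound a ?n"
      unfolding ctr_None good_def by (meson nat_le_linear)
  qed
  also have "\<dots> \<le> ?n * root_bound a ?n + ?n + root_bound a ?n * ?n + (centre_bound a ?n)\<^sup>2 * miss_bound a ?n"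
    using g by (intro add_mono mult_right_mono power_mono) (auto simp: good_def)
  finally have "real (card F) \<le> real (?n * root_bound a ?n + ?n + root_bound a ?n * ?n +
      (centre_bound a ?n)\<^sup>2 * miss_bound a ?n)" by (rule of_nat_mono)
  also have "\<dots> = 2 * (real ?n * real (root_bound a ?n)) + real ?n +
      (real (centre_bound a ?n))\<^sup>2 * real (miss_bound a ?n)" by simp
  also have "\<dots> \<le> 2 * (real ?n * ((a + 1) * rateR ?n)) + rate_edges ?n +
      ((a + 1) * rateS ?n)\<^sup>2 * ((a + 1) * rate_miss ?n)"
  proof -
    \<comment> \<open>Rounding up adds at most 1, and \<open>1 \<le> x\<close>.\<close>
    have *: "real (nat \<lceil>a * x\<rceil>) \<le> (a + 1) * x" if "1 \<le> x" for x
      using a that mult_nonneg_nonneg[of a x] by (simp add: algebra_simps) linarith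
    have "real (root_bound a ?n) \<le> (a + 1) * rateR ?n" "real (centre_bound a ?n) \<le> (a + 1) * rateS ?n"
      "real (miss_bound a ?n) \<le> (a + 1) * rate_miss ?n"
      unfolding root_bound_def centre_bound_def miss_bound_def using rates_ge_1[OF n] by (simp_all only: *)
    then show ?thesis
      using rates_ge_1[OF n] a by (intro add_mono mult_mono mult_left_mono power_mono) auto
  qed
  also have "\<dots> = 2 * ((a + 1) * (real ?n * rateR ?n)) + rate_edges ?n +
      (a + 1) ^ 3 * ((rateS ?n)\<^sup>2 * rate_miss ?n)"
    by (simp add: power2_eq_square power3_eq_cube)
  also have "\<dots> = 2 * ((a + 1) * rate_edges ?n) + rate_edges ?n + (a + 1) ^ 3 * rate_edges ?n"
    unfolding rates_mult[OF n] ..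
  finally show "real (card F) \<le> ((a + 1) ^ 3 + 2 * (a + 1) + 1) * rate_edges ?n"
    by (simp add: algebra_simps)
qed

end

section \<open>The distributed algorithm\<close>

text \<open>A token \<open>(s, d, m, r)\<close> announces the source \<open>s\<close>, its distance \<open>d\<close>, the least number \<open>m\<close> of
  missing edges on a shortest path, and whether \<open>s\<close> is a root. The elements of \<open>toks\<close> and \<open>marks\<close>
  begin with the time of receipt and the sender.\<close>

type_synonym token = "nat \<times> nat \<times> nat \<times> bool"

text \<open>\<open>lead\<close> is the least identifier heard of, \<open>cnt\<close> an estimate of
  the size of the subtree, \<open>info\<close> the eccentricity of the leader with the number of
  vertices; \<open>ndep\<close> and \<open>ncent\<close> hold the neighbours' values of the previous
  round.\<close>

record node =
  ident :: nat
  nb :: "nat set"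
  coin :: "nat \<times> nat"
  clock :: nat
  lead :: nat
  dep :: nat
  mx :: nat
  ndep :: "nat \<Rightarrow> nat"
  cnt :: nat
  info :: "(nat \<times> nat) option"
  cent :: "nat option"
  ncent :: "nat \<Rightarrow> nat option"
  toks :: "(nat \<times> nat \<times> token) set"
  marks :: "(nat \<times> nat) set"

record packet =
  p_lead :: nat
  p_mx :: nat
  p_dep :: nat
  p_child :: bool
  p_cnt :: nat
  p_info :: "(nat \<times> nat) option"
  p_samp :: bool
  p_cent :: "nat option"
  p_tok :: "token option"
  p_mark :: bool

text \<open>Absent fields are padded with zeros, so that every packet is a list of 17 numbers with
  fields at fixed positions.\<close>

definition encode_packet :: "packet \<Rightarrow> nat list" where
  "encode_packet p =
     [p_lead p, p_mx p, p_dep p, of_bool (p_child p), p_cnt p, of_bool (p_samp p), of_bool (p_mark p)] @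
     (case p_info p of None \<Rightarrow> [0, 0, 0] | Some (e, n) \<Rightarrow> [1, e, n]) @
     (case p_cent p of None \<Rightarrow> [0, 0] | Some c \<Rightarrow> [1, c]) @
     (case p_tok p of None \<Rightarrow> [0, 0, 0, 0, 0] | Some (s, d, m, r) \<Rightarrow> [1, s, d, m, of_bool r])"

lemma inj_encode_packet: "inj encode_packet"
proof (rule injI)
  fix p q assume eq: "encode_packet p = encode_packet q"
  have "p_lead p = p_lead q" "p_mx p = p_mx q" "p_dep p = p_dep q" "p_cnt p = p_cnt q"
    using eq by (simp_all add: encode_packet_def)
  moreover have "p_child p = p_child q" "p_samp p = p_samp q" "p_mark p = p_mark q"
    using eq by (auto simp: encode_packet_def of_bool_def split: if_splits)
  moreover have "p_info p = p_info q"
    using arg_cong[OF eq, of "\<lambda>l. take 3 (drop 7 l)"]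
    by (auto simp: encode_packet_def split: option.splits)
  moreover have "p_cent p = p_cent q"
    using arg_cong[OF eq, of "\<lambda>l. take 2 (drop 10 l)"]
    by (auto simp: encode_packet_def split: option.splits)
  moreover have "p_tok p = p_tok q"
    using arg_cong[OF eq, of "drop 12"]
    by (auto simp: encode_packet_def of_bool_def split: option.splits if_splits)
  ultimately show "p = q" by (intro packet.equality) auto
qed

text \<open>Here \<open>e\<close> is the eccentricity of the leader and \<open>n\<close> the number of vertices.\<close>

definition t_search :: "nat \<Rightarrow> nat" where
  "t_search e = 3 * e + 5"

text \<open>Bounds every slot: a distance is at most \<open>2 * e\<close>, by way of the leader, and
  a rank is at most the number of centres.\<close>

definition search_len :: "real \<Rightarrow> nat \<Rightarrow> nat \<Rightarrow> nat" where
  "search_len a e n = 2 * e + centre_bound a n"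

definition t_back :: "real \<Rightarrow> nat \<Rightarrow> nat \<Rightarrow> nat" where
  "t_back a e n = t_search e + search_len a e n + 1"

text \<open>A token sent at time \<open>t\<close> is acknowledged at time \<open>mirror a e n - t\<close>.\<close>

definition mirror :: "real \<Rightarrow> nat \<Rightarrow> nat \<Rightarrow> nat" where
  "mirror a e n = t_back a e n + t_search e + search_len a e n"

text \<open>The last acknowledgements, of tokens sent at \<open>t_search e\<close>, leave at
  \<open>t_back a e n + search_len a e n\<close> and travel for one round.\<close>

definition t_end :: "real \<Rightarrow> nat \<Rightarrow> nat \<Rightarrow> nat" where
  "t_end a e n = t_back a e n + search_len a e n + 1"

definition cands :: "node \<Rightarrow> nat set" where
  "cands s = {w \<in> nb s. ndep s w + 1 = dep s}"

text \<open>\<open>s\<close> regards \<open>w\<close> as its parent. A vertex that is its own leader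
  has no candidates, and membership keeps it away from \<open>Min {}\<close>.\<close>

definition child_of :: "node \<Rightarrow> nat \<Rightarrow> bool" where
  "child_of s w \<longleftrightarrow> w \<in> cands s \<and> w = Min (cands s)"

definition samp :: "node \<Rightarrow> bool" where
  "samp s = (case info s of None \<Rightarrow> False | Some (e, n) \<Rightarrow> level_centre n \<le> fst (coin s))"

definition is_root :: "node \<Rightarrow> bool" where
  "is_root s = (case info s of None \<Rightarrow> False
     | Some (e, n) \<Rightarrow> level_centre n \<le> fst (coin s) \<and> level_root n \<le> snd (coin s))"

definition lmiss :: "node \<Rightarrow> nat \<Rightarrow> bool" where
  "lmiss s w \<longleftrightarrow> cent s \<noteq> None \<and> ncent s w \<noteq> None \<and> cent s \<noteq> Some w \<and> ncent s w \<noteq> Some (ident s)"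

definition srcs :: "node \<Rightarrow> nat set" where
  "srcs s = {x. \<exists>t w d m r. (t, w, x, d, m, r) \<in> toks s} \<union> (if samp s then {ident s} else {})"

definition ldist :: "node \<Rightarrow> nat \<Rightarrow> nat" where
  "ldist s x = (if x = ident s then 0 else Min {d + 1 | t w d m r. (t, w, x, d, m, r) \<in> toks s})"

definition lnmiss :: "node \<Rightarrow> nat \<Rightarrow> nat" where
  "lnmiss s x = (if x = ident s then 0
     else Min {m + of_bool (lmiss s w) | t w d m r. (t, w, x, d, m, r) \<in> toks s \<and> d + 1 = ldist s x})"

definition lparent :: "node \<Rightarrow> nat \<Rightarrow> nat" where
  "lparent s x = Min {w | t w d m r. (t, w, x, d, m, r) \<in> toks s \<and> d + 1 = ldist s x \<and>
     m + of_bool (lmiss s w) = lnmiss s x}"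

definition lroot :: "node \<Rightarrow> nat \<Rightarrow> bool" where
  "lroot s x \<longleftrightarrow> (if x = ident s then is_root s else \<exists>t w d m. (t, w, x, d, m, True) \<in> toks s)"

definition rank :: "nat set \<Rightarrow> (nat \<Rightarrow> nat) \<Rightarrow> nat \<Rightarrow> nat" where
  "rank S f x = card {y \<in> S. f y < f x \<or> f y = f x \<and> y < x}"

definition slot :: "nat set \<Rightarrow> (nat \<Rightarrow> nat) \<Rightarrow> nat \<Rightarrow> nat" where
  "slot S f x = f x + rank S f x"

definition token_of :: "node \<Rightarrow> token option" where
  "token_of s = (case info s of None \<Rightarrow> None | Some (e, n) \<Rightarrow>
     let X = {x \<in> srcs s. t_search e + slot (srcs s) (ldist s) x = clock s}; x = Min X in
     if X = {} then None else Some (x, ldist s x, lnmiss s x, lroot s x))"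

text \<open>The view of a centre, which learns distances and missing edges of its cluster from the
  members' tokens. The second disjunct is the centre itself, which receives no token from
  itself.\<close>

definition lmember :: "node \<Rightarrow> nat \<Rightarrow> nat \<Rightarrow> nat \<Rightarrow> nat \<Rightarrow> bool" where
  "lmember s x y d m \<longleftrightarrow>
     (y \<in> nb s \<and> ncent s y = Some (ident s) \<and> (\<exists>t r. (t, y, x, d, m, r) \<in> toks s)) \<or>
     (y = ident s \<and> cent s = Some (ident s) \<and> x \<in> srcs s \<and> d = ldist s x \<and> m = lnmiss s x)"

definition lchosen :: "nat \<Rightarrow> node \<Rightarrow> nat \<Rightarrow> nat \<Rightarrow> bool" where
  "lchosen k s x y \<longleftrightarrow> (\<exists>d m. lmember s x y d m \<and> m \<le> k \<and>
     (\<forall>y' d' m'. lmember s x y' d' m' \<and> m' \<le> k \<longrightarrow> d < d' \<or> d = d' \<and> y \<le> y'))"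

definition lincl :: "real \<Rightarrow> nat \<Rightarrow> nat \<Rightarrow> node \<Rightarrow> nat \<Rightarrow> bool" where
  "lincl a e n s x \<longleftrightarrow> lroot s x \<or> lchosen (miss_bound a n) s x (ident s) \<or>
     (\<exists>t w. (t, w) \<in> marks s \<and> t_search e + slot (srcs s) (ldist s) x + t = mirror a e n)"

text \<open>Acknowledging the token for \<open>x\<close> from \<open>w\<close> asks \<open>w\<close> to put its path to \<open>x\<close> into the spanner.\<close>

definition mark :: "real \<Rightarrow> node \<Rightarrow> nat \<Rightarrow> bool" where
  "mark a s w = (case info s of None \<Rightarrow> False | Some (e, n) \<Rightarrow>
     \<exists>t x d m r. (t, w, x, d, m, r) \<in> toks s \<and> clock s + t = mirror a e n \<and>
       (w = lparent s x \<and> x \<noteq> ident s \<and> lincl a e n s x \<or> lchosen (miss_bound a n) s x w))"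

definition out :: "real \<Rightarrow> node \<Rightarrow> nat set option" where
  "out a s = (case info s of None \<Rightarrow> None | Some (e, n) \<Rightarrow>
     if clock s < t_end a e n then None
     else Some ({w \<in> nb s. \<not> lmiss s w} \<union> {lparent s x | x. x \<in> srcs s \<and> x \<noteq> ident s \<and> lincl a e n s x} \<union>
       {w. \<exists>t. (t, w) \<in> marks s}))"

definition init_node :: "nat \<Rightarrow> nat set \<Rightarrow> nat \<times> nat \<Rightarrow> node" where
  "init_node v A c = \<lparr>ident = v, nb = A, coin = c, clock = 0, lead = v, dep = 0, mx = 0, ndep = (\<lambda>_. 0),
     cnt = 1, info = None, cent = None, ncent = (\<lambda>_. None), toks = {}, marks = {}\<rparr>"

definition packet_to :: "real \<Rightarrow> node \<Rightarrow> nat \<Rightarrow> packet" where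
  "packet_to a s w = \<lparr>p_lead = lead s, p_mx = mx s, p_dep = dep s, p_child = child_of s w, p_cnt = cnt s,
     p_info = info s, p_samp = samp s, p_cent = cent s, p_tok = token_of s, p_mark = mark a s w\<rparr>"

text \<open>\<open>dep\<close> is the time of the last change of \<open>lead\<close>, and \<open>mx\<close> the largest value of \<open>dep\<close> heard
  of. A node that is still its own leader at time \<open>2 * mx + 2\<close> has the least identifier:
  otherwise news of a change at distance \<open>mx + 1\<close> or of a smaller identifier would have arrived.\<close>

definition upd_node :: "node \<Rightarrow> (nat \<Rightarrow> packet) \<Rightarrow> node" where
  "upd_node s inb =
    (let l = Min (insert (lead s) ((\<lambda>w. p_lead (inb w)) ` nb s));
         h = (if l = lead s then dep s else clock s + 1) in
     s\<lparr>clock := clock s + 1, lead := l, dep := h,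
       mx := Max (insert h (insert (mx s) ((\<lambda>w. p_mx (inb w)) ` nb s))),
       ndep := (\<lambda>w. p_dep (inb w)),
       cnt := 1 + (\<Sum>w\<in>{w \<in> nb s. p_child (inb w)}. p_cnt (inb w)),
       info := (if info s \<noteq> None then info s
         else if \<exists>w\<in>nb s. p_info (inb w) \<noteq> None then p_info (inb (Min {w \<in> nb s. p_info (inb w) \<noteq> None}))
         else if lead s = ident s \<and> 2 * mx s + 2 \<le> clock s then Some (mx s, cnt s) else None),
       cent := (if samp s then Some (ident s)
         else if \<exists>w\<in>nb s. p_samp (inb w) then Some (Min {w \<in> nb s. p_samp (inb w)}) else None),
       ncent := (\<lambda>w. p_cent (inb w)),
       toks := toks s \<union> {(clock s, w, x) | w x. w \<in> nb s \<and> p_tok (inb w) = Some x},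
       marks := marks s \<union> {(clock s, w) | w. w \<in> nb s \<and> p_mark (inb w)}\<rparr>)"

global_interpretation congest: protocol init_node "packet_to a" upd_node "out a" encode_packet coin_pmf "(0, 0)"
  for a
  defines spanner_alg = congest.alg
    and node_run = congest.free_run
    and node_hrun = congest.run
    and node_code = congest.code
  by unfold_locales (rule inj_encode_packet)

section \<open>Leader, eccentricity and counting\<close>

locale execution = conn_graph +
  fixes a :: real and \<omega> :: "nat \<Rightarrow> nat \<times> nat"
begin

abbreviation "g \<equiv> node_run a E \<omega>"

lemma g_const [simp]: "ident (g t v) = v" "nb (g t v) = N v" "coin (g t v) = \<omega> v" "clock (g t v) = t"
  by (induction t) (simp_all add: init_node_def upd_node_def Let_def)

lemma image_nb: "(\<lambda>w. f (if w \<in> N v then h w else z)) ` N v = (\<lambda>w. f (h w)) ` N v"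
  by auto

lemma lead_Suc: "lead (g (Suc t) v) = Min (insert (lead (g t v)) ((\<lambda>w. lead (g t w)) ` N v))"
  by (simp add: upd_node_def Let_def image_nb) (simp add: packet_to_def)

lemma dep_Suc: "dep (g (Suc t) v) = (if lead (g (Suc t) v) = lead (g t v) then dep (g t v) else Suc t)"
  by (simp add: upd_node_def Let_def)

lemma mx_Suc: "mx (g (Suc t) v) = Max (insert (dep (g (Suc t) v)) (insert (mx (g t v)) ((\<lambda>w. mx (g t w)) ` N v)))"
  by (simp add: upd_node_def Let_def image_nb) (simp add: packet_to_def)

lemma ndep_Suc: "w \<in> N v \<Longrightarrow> ndep (g (Suc t) v) w = dep (g t w)"
  by (simp add: upd_node_def Let_def packet_to_def)

lemma cnt_Suc: "cnt (g (Suc t) v) = 1 + (\<Sum>w\<in>{w \<in> N v. child_of (g t w) v}. cnt (g t w))"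
  by (auto simp: upd_node_def Let_def packet_to_def intro!: sum.cong)

lemma info_Suc: "info (g (Suc t) v) = (if info (g t v) \<noteq> None then info (g t v)
    else if \<exists>w\<in>N v. info (g t w) \<noteq> None then info (g t (Min {w \<in> N v. info (g t w) \<noteq> None}))
    else if lead (g t v) = v \<and> 2 * mx (g t v) + 2 \<le> t then Some (mx (g t v), cnt (g t v)) else None)"
proof -
  let ?A = "{w \<in> N v. info (g t w) \<noteq> None}"
  have A: "{w \<in> N v. p_info (if w \<in> N v then packet_to a (g t w) v else undefined) \<noteq> None} = ?A"
    by (auto simp: packet_to_def)
  have "Min ?A \<in> N v" if "?A \<noteq> {}"
    using Min_in[of ?A] that finite_nbrs[of v] by auto
  then show ?thesis
    unfolding congest.free_run.simps upd_node_def Let_def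
    by (simp add: A del: not_None_eq) (auto simp: packet_to_def)
qed

lemma cent_Suc: "cent (g (Suc t) v) = (if samp (g t v) then Some v
    else if \<exists>w\<in>N v. samp (g t w) then Some (Min {w \<in> N v. samp (g t w)}) else None)"
proof -
  have "{w \<in> N v. p_samp (if w \<in> N v then packet_to a (g t w) v else undefined)} = {w \<in> N v. samp (g t w)}"
    by (auto simp: packet_to_def)
  then show ?thesis by (simp add: upd_node_def Let_def) (auto simp: packet_to_def)
qed

lemma ncent_Suc: "w \<in> N v \<Longrightarrow> ncent (g (Suc t) v) w = cent (g t w)"
  by (simp add: upd_node_def Let_def packet_to_def)

lemma toks_Suc: "toks (g (Suc t) v) = toks (g t v) \<union> {(t, w, x) | w x. w \<in> N v \<and> token_of (g t w) = Some x}"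
  by (auto simp: upd_node_def Let_def packet_to_def)

lemma marks_Suc: "marks (g (Suc t) v) = marks (g t v) \<union> {(t, w) | w. w \<in> N v \<and> mark a (g t w) v}"
  by (auto simp: upd_node_def Let_def packet_to_def)

lemma init_simps [simp]: "lead (g 0 v) = v" "dep (g 0 v) = 0" "mx (g 0 v) = 0" "cnt (g 0 v) = 1"
  "info (g 0 v) = None" "toks (g 0 v) = {}" "marks (g 0 v) = {}"
  by (simp_all add: init_node_def)

declare congest.free_run.simps [simp del]

section \<open>Spread of the least identifier\<close>

lemma lead_near: "v \<in> V \<Longrightarrow> lead (g t v) \<in> V \<and> d v (lead (g t v)) \<le> t"
proof (induction t arbitrary: v)
  case (Suc t)
  have "lead (g (Suc t) v) \<in> insert (lead (g t v)) ((\<lambda>w. lead (g t w)) ` N v)"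
    unfolding lead_Suc using finite_nbrs by (intro Min_in) auto
  then consider "lead (g (Suc t) v) = lead (g t v)"
    | w where "w \<in> N v" "lead (g (Suc t) v) = lead (g t w)" by auto
  then show ?case
  proof cases
    case 1
    with Suc show ?thesis by (simp add: le_SucI)
  next
    case 2
    then have "w \<in> V" using nbrs_V by auto
    with Suc.IH[of w] 2 d_triangle[of v w "lead (g t w)"] d_edge[OF 2(1)] Suc.prems
    show ?thesis by auto
  qed
qed simp

lemma lead_le: "v \<in> V \<Longrightarrow> w \<in> V \<Longrightarrow> d v w \<le> t \<Longrightarrow> lead (g t v) \<le> w"
proof (induction t arbitrary: v)
  case 0
  then show ?case using d_pos[of v w] by auto
next
  case (Suc t)
  have le: "lead (g (Suc t) v) \<le> lead (g t v)" "u \<in> N v \<Longrightarrow> lead (g (Suc t) v) \<le> lead (g t u)" for u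
    unfolding lead_Suc using finite_nbrs by (auto intro!: Min_le)
  show ?case
  proof (cases "d v w \<le> t")
    case True
    with Suc.IH[of v] Suc.prems le(1) show ?thesis by auto
  next
    case False
    then have "w \<noteq> v" by auto
    then obtain u where u: "u \<in> N v" "d w u + 1 = d w v" using d_pred[of w v] Suc.prems by metis
    have "lead (g t u) \<le> w"
      using Suc.IH[of u] nbrs_V(1)[OF u(1)] u(2) Suc.prems by (simp add: d_commute)
    with le(2)[OF u(1)] show ?thesis by simp
  qed
qed

text \<open>An identifier adopted at time \<open>t\<close> is at distance exactly \<open>t\<close>:
  if it were nearer, it would have been adopted before.\<close>

lemma dep_eq: "v \<in> V \<Longrightarrow> dep (g t v) = d v (lead (g t v))"
proof (induction t)
  case (Suc t)
  show ?case
  proof (cases "lead (g (Suc t) v) = lead (g t v)")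
    case True
    with Suc show ?thesis by (simp add: dep_Suc)
  next
    case False
    let ?u = "lead (g (Suc t) v)"
    have u: "?u \<in> V" "d v ?u \<le> Suc t" using lead_near Suc.prems by auto
    have "?u \<le> lead (g t v)" unfolding lead_Suc using finite_nbrs by (intro Min_le) auto
    then have "\<not> d v ?u \<le> t" using lead_le[OF Suc.prems u(1), of t] False by auto
    with u False show ?thesis by (simp add: dep_Suc)
  qed
qed simp

definition leader :: nat where
  "leader = Min V"

definition ecc :: nat where
  "ecc = Max (d leader ` V)"

lemma leader_V: "leader \<in> V" and leader_le: "v \<in> V \<Longrightarrow> leader \<le> v"
  unfolding leader_def using finite_V V_nonempty by auto

lemma d_leader_le: "v \<in> V \<Longrightarrow> d leader v \<le> ecc"
  unfolding ecc_def using finite_V by auto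

lemma ecc_attained: obtains v where "v \<in> V" "d leader v = ecc"
proof -
  have "ecc \<in> d leader ` V" unfolding ecc_def using finite_V V_nonempty by (intro Max_in) auto
  with that show ?thesis by auto
qed

lemma lead_leader: "v \<in> V \<Longrightarrow> d leader v \<le> t \<Longrightarrow> lead (g t v) = leader"
  using lead_le[of v leader t] leader_V lead_near[of v t] leader_le by (metis d_commute order_antisym)

lemma dep_le_ecc: "v \<in> V \<Longrightarrow> dep (g t v) \<le> ecc"
proof (cases "d leader v \<le> t")
  assume "v \<in> V" "\<not> d leader v \<le> t"
  then show ?thesis using dep_eq[of v t] lead_near[of v t] d_leader_le[of v] by auto
qed (use dep_eq lead_leader d_leader_le d_commute in metis)

lemma mx_le_ecc: "v \<in> V \<Longrightarrow> mx (g t v) \<le> ecc"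
proof (induction t arbitrary: v)
  case (Suc t)
  then show ?case unfolding mx_Suc using finite_nbrs dep_le_ecc nbrs_V by auto
qed simp

text \<open>News of a change travels one edge per round, and \<open>mx\<close> never
  decreases.\<close>

lemma dep_le_mx: "v \<in> V \<Longrightarrow> w \<in> V \<Longrightarrow> t' + d v w \<le> t \<Longrightarrow> dep (g t' w) \<le> mx (g t v)"
proof (induction t arbitrary: v)
  case (Suc t)
  have le: "dep (g (Suc t) v) \<le> mx (g (Suc t) v)" "mx (g t v) \<le> mx (g (Suc t) v)"
    "u \<in> N v \<Longrightarrow> mx (g t u) \<le> mx (g (Suc t) v)" for u
    unfolding mx_Suc[of t v] using finite_nbrs by (intro Max_ge; simp)+
  show ?case
  proof (cases "v = w")
    case True
    show ?thesis
    proof (cases "t' = Suc t")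
      case False
      with Suc.IH[of v] Suc.prems le(2) True show ?thesis by auto
    qed (use le(1) True in simp)
  next
    case False
    then obtain u where u: "u \<in> N v" "d w u + 1 = d w v" using d_pred[of w v] Suc.prems by metis
    have "dep (g t' w) \<le> mx (g t u)"
      using Suc.IH[of u] nbrs_V(1)[OF u(1)] u(2) Suc.prems by (simp add: d_commute)
    with le(3)[OF u(1)] show ?thesis by simp
  qed
qed simp

lemma detection:
  assumes v: "v \<in> V" and lead: "lead (g t v) = v" and t: "2 * mx (g t v) + 2 \<le> t"
  shows "v = leader" "mx (g t v) = ecc" "2 * ecc + 2 \<le> t"
proof -
  let ?j = "mx (g t v)"
  \<comment> \<open>At time \<open>?j + 1\<close> such a \<open>w\<close> would follow
    \<open>v\<close>, since a smaller identifier that near to \<open>w\<close> would reach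
    \<open>v\<close> by time \<open>2 * ?j + 2\<close>. The resulting \<open>dep\<close> of
    \<open>?j + 1\<close> would have reached \<open>v\<close> by then too, against the value of
    \<open>mx\<close>.\<close>
  have no: "d v w \<noteq> ?j + 1" if w: "w \<in> V" for w
  proof
    assume dw: "d v w = ?j + 1"
    let ?u = "lead (g (?j + 1) w)"
    have u: "?u \<in> V" "d w ?u \<le> ?j + 1" using lead_near[OF w] by auto
    have "?u \<le> v" using lead_le[OF w v] dw by (simp add: d_commute)
    moreover have "d v ?u \<le> t" using d_triangle[OF v w u(1)] u(2) dw t by simp
    then have "v \<le> ?u" using lead_le[OF v u(1), of t] lead by simp
    ultimately have "dep (g (?j + 1) w) = ?j + 1" using dep_eq[OF w, of "?j + 1"] dw by (simp add: d_commute)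
    moreover have "dep (g (?j + 1) w) \<le> ?j" using t dw by (intro dep_le_mx[OF v w]) auto
    ultimately show False by simp
  qed
  have le: "d v w \<le> ?j" if w: "w \<in> V" for w
  proof (rule ccontr)
    assume "\<not> d v w \<le> ?j"
    then obtain x where "x \<in> V" "d v x = ?j + 1" using d_level[OF v w, of "?j + 1"] by auto
    with no show False by blast
  qed
  have "v \<le> leader" using lead_le[OF v leader_V, of t] le[OF leader_V] t lead by auto
  then show vl: "v = leader" using leader_le[OF v] by simp
  obtain w where "w \<in> V" "d leader w = ecc" by (rule ecc_attained)
  with le[of w] vl have "ecc \<le> ?j" by simp
  with mx_le_ecc[OF v] show "mx (g t v) = ecc" by (rule order_antisym)
  with t show "2 * ecc + 2 \<le> t" by simp
qed

subsection \<open>Counting along a breadth-first tree\<close>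

definition up :: "nat \<Rightarrow> nat" where
  "up v = Min {w \<in> N v. d leader w + 1 = d leader v}"

text \<open>The bound on \<open>i\<close> stops the iteration at the leader, where \<open>up\<close>
  is unspecified.\<close>

definition below :: "nat \<Rightarrow> nat set" where
  "below v = {u \<in> V. \<exists>i \<le> d leader u. (up ^^ i) u = v}"

definition children :: "nat \<Rightarrow> nat set" where
  "children v = {w \<in> N v. w \<noteq> leader \<and> up w = v}"

lemma up: "v \<in> V \<Longrightarrow> v \<noteq> leader \<Longrightarrow> up v \<in> N v \<and> d leader (up v) + 1 = d leader v"
proof -
  assume "v \<in> V" "v \<noteq> leader"
  then have "up v \<in> {w \<in> N v. d leader w + 1 = d leader v}"
    unfolding up_def using d_pred[OF leader_V, of v] finite_nbrs by (intro Min_in) auto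
  then show ?thesis by auto
qed

lemma up_pow: "u \<in> V \<Longrightarrow> i \<le> d leader u \<Longrightarrow> (up ^^ i) u \<in> V \<and> d leader ((up ^^ i) u) = d leader u - i"
proof (induction i)
  case (Suc i)
  then have *: "(up ^^ i) u \<in> V" "d leader ((up ^^ i) u) = d leader u - i" by auto
  with Suc.prems have "(up ^^ i) u \<noteq> leader" by auto
  with up[of "(up ^^ i) u"] * show ?case using nbrs_V by auto
qed simp

lemma below_leader: "below leader = V"
proof -
  have "(up ^^ d leader u) u = leader" if "u \<in> V" for u
    using up_pow[OF that order_refl] d_pos[OF leader_V, of "(up ^^ d leader u) u"] by force
  then show ?thesis unfolding below_def by auto
qed

lemma below_level: "u \<in> below v \<Longrightarrow> d leader v \<le> d leader u \<and> (up ^^ (d leader u - d leader v)) u = v"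
  using up_pow unfolding below_def by fastforce

lemma below_eq:
  assumes v: "v \<in> V"
  shows "below v = insert v (\<Union>w\<in>children v. below w)"
proof (intro equalityI subsetI)
  fix u assume "u \<in> below v"
  then obtain i where u: "u \<in> V" "i \<le> d leader u" "(up ^^ i) u = v" unfolding below_def by auto
  show "u \<in> insert v (\<Union>w\<in>children v. below w)"
  proof (cases i)
    case (Suc k)
    let ?w = "(up ^^ k) u"
    have w: "?w \<in> V" "d leader ?w = d leader u - k" using up_pow[of u k] u Suc by auto
    then have "?w \<noteq> leader" using u Suc by auto
    then have "?w \<in> children v"
      using up[OF w(1)] u Suc nbrs_sym[of v E ?w] unfolding children_def by auto
    moreover have "k \<le> d leader u" using u Suc by simp
    then have "u \<in> below ?w" using u(1) unfolding below_def by blast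
    ultimately show ?thesis by blast
  qed (use u in simp)
next
  fix u assume "u \<in> insert v (\<Union>w\<in>children v. below w)"
  then consider "u = v" | w where "w \<in> children v" "u \<in> below w" by auto
  then show "u \<in> below v"
  proof cases
    case 1
    with v show ?thesis unfolding below_def by (auto intro: exI[of _ 0])
  next
    case 2
    then obtain i where i: "u \<in> V" "i \<le> d leader u" "(up ^^ i) u = w" unfolding below_def by auto
    have w: "w \<noteq> leader" "up w = v" using 2 by (auto simp: children_def)
    have "i \<noteq> d leader u"
      using up_pow[OF i(1,2)] i(3) w(1) d_pos[OF leader_V, of w] by auto
    with i w show ?thesis unfolding below_def by (auto intro!: exI[of _ "Suc i"])
  qed
qed

lemma children_level: "w \<in> children v \<Longrightarrow> d leader w = d leader v + 1"
  using up[of w] nbrs_V unfolding children_def by auto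

lemma card_below:
  assumes v: "v \<in> V"
  shows "card (below v) = 1 + (\<Sum>w\<in>children v. card (below w))"
proof -
  have fin: "finite (below w)" for w unfolding below_def using finite_V by auto
  have finc: "finite (children v)" unfolding children_def using finite_nbrs by auto
  have "below w \<inter> below w' = {}" if "w \<in> children v" "w' \<in> children v" "w \<noteq> w'" for w w'
    using below_level[of _ w] below_level[of _ w'] children_level that by fastforce
  then have "card (\<Union>w\<in>children v. below w) = (\<Sum>w\<in>children v. card (below w))"
    using fin finc by (intro card_UN_disjoint) auto
  moreover have "v \<notin> (\<Union>w\<in>children v. below w)"
    using below_level children_level by fastforce
  ultimately show ?thesis unfolding below_eq[OF v] using fin finc by simp
qed

lemma dep_stable: "v \<in> V \<Longrightarrow> ecc \<le> t \<Longrightarrow> dep (g t v) = d leader v"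
  using dep_eq[of v t] lead_leader[of v t] d_leader_le[of v] by (simp add: d_commute)

lemma child_of_stable:
  assumes "w \<in> N v" "ecc + 1 \<le> t"
  shows "child_of (g t w) v \<longleftrightarrow> w \<in> children v"
proof -
  obtain t' where t: "t = Suc t'" "ecc \<le> t'" using assms(2) by (cases t) auto
  have w: "w \<in> V" "v \<in> N w" using assms nbrs_V nbrs_sym by auto
  have "cands (g t w) = {u \<in> N w. d leader u + 1 = d leader w}"
    unfolding cands_def using t dep_stable nbrs_V[of _ w] w by (auto simp: ndep_Suc)
  then show ?thesis
    using up[OF w(1)] assms w unfolding child_of_def children_def up_def by auto
qed

text \<open>Child flags are right from \<open>ecc + 1\<close> on, counts at depth \<open>ecc\<close>
  one round later, and each level above takes one more round. For the leader this is
  \<open>2 * ecc + 2\<close>, exactly what \<open>detection\<close> guarantees.\<close>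

lemma cnt_stable: "v \<in> V \<Longrightarrow> ecc + 2 + (ecc - d leader v) \<le> t \<Longrightarrow> cnt (g t v) = card (below v)"
proof (induction "ecc - d leader v" arbitrary: v t rule: less_induct)
  case less
  obtain t' where t: "t = Suc t'" "ecc + 1 \<le> t'" using less.prems(2) by (cases t) auto
  have "{w \<in> N v. child_of (g t' w) v} = children v"
    using child_of_stable[OF _ t(2)] unfolding children_def by auto
  moreover have "cnt (g t' w) = card (below w)" if w: "w \<in> children v" for w
  proof -
    have "w \<in> V" using w nbrs_V unfolding children_def by auto
    with children_level[OF w] d_leader_le[of w] less.prems t(1) show ?thesis
      by (intro less.hyps) auto
  qed
  ultimately show ?case using card_below[OF less.prems(1)] t(1) by (simp add: cnt_Suc)
qed

text \<open>Before the tree is stable, the counts are bounded because each node still has only one parent.\<close>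

lemma sum_cnt_le: "(\<Sum>v\<in>V. cnt (g t v)) \<le> card V * (t + 1)"
proof (induction t)
  case (Suc t)
  have "(\<Sum>v\<in>V. \<Sum>w\<in>{w \<in> N v. child_of (g t w) v}. cnt (g t w))
      = (\<Sum>v\<in>V. \<Sum>w\<in>{w \<in> V. w \<in> N v \<and> child_of (g t w) v}. cnt (g t w))"
    using nbrs_V by (intro sum.cong) auto
  also have "\<dots> = (\<Sum>v\<in>V. \<Sum>w\<in>V. if w \<in> N v \<and> child_of (g t w) v then cnt (g t w) else 0)"
    using finite_V by (intro sum.cong refl sum.inter_filter) auto
  also have "\<dots> = (\<Sum>w\<in>V. \<Sum>v\<in>V. if w \<in> N v \<and> child_of (g t w) v then cnt (g t w) else 0)"
    by (rule sum.swap)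
  also have "\<dots> \<le> (\<Sum>w\<in>V. cnt (g t w))"
  proof (rule sum_mono)
    fix w assume "w \<in> V"
    let ?A = "{v \<in> V. w \<in> N v \<and> child_of (g t w) v}"
    have "?A \<subseteq> {Min (cands (g t w))}" by (auto simp: child_of_def)
    then have "card ?A \<le> 1" using card_mono[of "{Min (cands (g t w))}" ?A] by simp
    moreover have "(\<Sum>v\<in>V. if w \<in> N v \<and> child_of (g t w) v then cnt (g t w) else 0) = (\<Sum>v\<in>?A. cnt (g t w))"
      using finite_V by (intro sum.inter_filter[symmetric])
    ultimately show "(\<Sum>v\<in>V. if w \<in> N v \<and> child_of (g t w) v then cnt (g t w) else 0) \<le> cnt (g t w)"
      using mult_right_mono[of "card ?A" 1 "cnt (g t w)"] by simp
  qed
  finally show ?case using Suc by (simp add: cnt_Suc sum.distrib sum_Suc)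
qed simp

text \<open>Counts are transmitted from the start, so the bandwidth bound also concerns the rounds
  in which they are still wrong.\<close>

lemma cnt_le:
  assumes v: "v \<in> V"
  shows "cnt (g t v) \<le> card V * (2 * ecc + 3)"
proof (cases "2 * ecc + 2 \<le> t")
  case True
  then have "cnt (g t v) = card (below v)" using v by (intro cnt_stable) auto
  also have "\<dots> \<le> card V" unfolding below_def using finite_V by (intro card_mono) auto
  also have "\<dots> \<le> card V * (2 * ecc + 3)" by simp
  finally show ?thesis .
next
  case False
  have "cnt (g t v) \<le> (\<Sum>v\<in>V. cnt (g t v))" using finite_V v by (intro member_le_sum) auto
  also have "\<dots> \<le> card V * (t + 1)" by (rule sum_cnt_le)
  also have "\<dots> \<le> card V * (2 * ecc + 3)" using False by (intro mult_left_mono) auto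
  finally show ?thesis .
qed

lemma info_correct: "v \<in> V \<Longrightarrow> info (g t v) = Some x \<Longrightarrow> x = (ecc, card V)"
proof (induction t arbitrary: v)
  case (Suc t)
  consider "info (g t v) \<noteq> None" | "info (g t v) = None" "\<exists>w\<in>N v. info (g t w) \<noteq> None"
    | "info (g t v) = None" "\<not> (\<exists>w\<in>N v. info (g t w) \<noteq> None)" by blast
  then show ?case
  proof cases
    case 1
    with Suc show ?thesis by (simp add: info_Suc split: if_splits)
  next
    case 2
    let ?A = "{w \<in> N v. info (g t w) \<noteq> None}"
    have "Min ?A \<in> ?A" using 2 finite_nbrs by (intro Min_in) auto
    then have "Min ?A \<in> V" using nbrs_V by auto
    moreover have "info (g t (Min ?A)) = Some x" using 2 Suc.prems by (simp add: info_Suc del: not_None_eq)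
    ultimately show ?thesis by (rule Suc.IH)
  next
    case 3
    then have *: "lead (g t v) = v" "2 * mx (g t v) + 2 \<le> t" "x = (mx (g t v), cnt (g t v))"
      using Suc.prems(2) by (simp_all add: info_Suc del: not_None_eq split: if_splits)
    note det = detection[OF Suc.prems(1) *(1,2)]
    have "cnt (g t v) = card V"
      using cnt_stable[OF Suc.prems(1), of t] det below_leader by simp
    with * det show ?thesis by simp
  qed
qed simp

lemma info_reached: "v \<in> V \<Longrightarrow> 2 * ecc + 3 + d leader v \<le> t \<Longrightarrow> info (g t v) \<noteq> None"
proof (induction t arbitrary: v)
  case (Suc t)
  show ?case
  proof (cases "v = leader")
    case True
    have "lead (g t leader) = leader" using lead_leader[OF leader_V] by simp
    moreover have "2 * mx (g t leader) + 2 \<le> t" using Suc.prems mx_le_ecc[OF leader_V, of t] by simp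
    moreover have "info (g t (Min {w \<in> N v. info (g t w) \<noteq> None})) \<noteq> None" if "\<exists>w\<in>N v. info (g t w) \<noteq> None"
      using Min_in[of "{w \<in> N v. info (g t w) \<noteq> None}"] that finite_nbrs by auto
    ultimately show ?thesis using True unfolding info_Suc by (simp del: not_None_eq)
  next
    case False
    then have "info (g t (up v)) \<noteq> None" "up v \<in> N v"
      using up[of v] Suc nbrs_V by auto
    then have ex: "\<exists>w\<in>N v. info (g t w) \<noteq> None" by blast
    then have "info (g t (Min {w \<in> N v. info (g t w) \<noteq> None})) \<noteq> None"
      using Min_in[of "{w \<in> N v. info (g t w) \<noteq> None}"] finite_nbrs by auto
    with ex show ?thesis unfolding info_Suc by (simp del: not_None_eq)
  qed
qed simp

lemma info_all: "v \<in> V \<Longrightarrow> 3 * ecc + 3 \<le> t \<Longrightarrow> info (g t v) = Some (ecc, card V)"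
  using info_reached[of v t] info_correct[of v t] d_leader_le[of v] by force

end

section \<open>The search phase\<close>

lemma rank_less:
  assumes "finite S" "x \<in> S" "f x < f y \<or> f x = f y \<and> x < y"
  shows "rank S f x < rank S f y"
  unfolding rank_def using assms by (intro psubset_card_mono) auto

lemma slot_less:
  assumes "finite S" "x \<in> S" "f x < f y \<or> f x = f y \<and> x < y"
  shows "slot S f x < slot S f y"
  using rank_less[OF assms] assms(3) unfolding slot_def by auto

lemma slot_less_imp:
  assumes "finite S" "y \<in> S" "slot S f x < slot S f y"
  shows "f x < f y \<or> f x = f y \<and> x < y"
  using assms slot_less[of S y f x] by (metis linorder_neqE_nat order_less_imp_not_less)

lemma slot_inj:
  assumes "finite S" "x \<in> S" "y \<in> S" "slot S f x = slot S f y"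
  shows "x = y"
  using assms slot_less[of S x f y] slot_less[of S y f x] by (metis linorder_neqE_nat order_less_irrefl)

text \<open>A node that knows only a part \<open>A\<close> of the sources, with estimates \<open>\<delta>\<close> of their
  distances \<open>f\<close>, computes the correct slots once the sources of the slots up to \<open>j\<close> are known.\<close>

lemma slot_estimate:
  assumes fin: "finite S" and A: "A \<subseteq> S" and ge: "\<And>x. x \<in> A \<Longrightarrow> f x \<le> \<delta> x"
    and known: "\<And>x. x \<in> S \<Longrightarrow> slot S f x \<le> j \<Longrightarrow> x \<in> A \<and> \<delta> x = f x"
  shows "x \<in> S \<Longrightarrow> slot S f x \<le> j \<Longrightarrow> slot A \<delta> x = slot S f x"
    and "x \<in> A \<Longrightarrow> j < slot S f x \<Longrightarrow> j < slot A \<delta> x"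
proof -
  assume x: "x \<in> S" "slot S f x \<le> j"
  have "{y \<in> A. \<delta> y < \<delta> x \<or> \<delta> y = \<delta> x \<and> y < x} = {y \<in> S. f y < f x \<or> f y = f x \<and> y < x}"
  proof (intro equalityI subsetI)
    fix y assume "y \<in> {y \<in> A. \<delta> y < \<delta> x \<or> \<delta> y = \<delta> x \<and> y < x}"
    with known[OF x] A ge[of y] show "y \<in> {y \<in> S. f y < f x \<or> f y = f x \<and> y < x}" by auto
  next
    fix y assume y: "y \<in> {y \<in> S. f y < f x \<or> f y = f x \<and> y < x}"
    then have "slot S f y \<le> j" using slot_less[OF fin, of y f x] x by auto
    with y known[of y] known[OF x] show "y \<in> {y \<in> A. \<delta> y < \<delta> x \<or> \<delta> y = \<delta> x \<and> y < x}" by auto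
  qed
  with known[OF x] show "slot A \<delta> x = slot S f x" by (simp add: slot_def rank_def)
next
  assume x: "x \<in> A" "j < slot S f x"
  let ?K = "{y \<in> S. slot S f y \<le> j}"
  \<comment> \<open>Let \<open>z\<close> have the least slot after \<open>j\<close>. All sources
    ranked before \<open>z\<close> are known and also precede \<open>x\<close> in the local order,
    so the estimated slot of \<open>x\<close> is at least the true slot of \<open>z\<close>.\<close>
  have "\<exists>z. (z \<in> S \<and> j < slot S f z) \<and> (\<forall>y. y \<in> S \<and> j < slot S f y \<longrightarrow> slot S f z \<le> slot S f y)"
    using x A by (intro ex_has_least_nat[of _ x "slot S f"]) auto
  then obtain z where z: "z \<in> S" "j < slot S f z"
    and least: "\<And>y. y \<in> S \<Longrightarrow> j < slot S f y \<Longrightarrow> slot S f z \<le> slot S f y" by blast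
  have "{y \<in> S. f y < f z \<or> f y = f z \<and> y < z} \<subseteq> ?K"
    using slot_less[OF fin, of _ f z] least by (fastforce simp: not_le)
  then have "rank S f z \<le> card ?K" unfolding rank_def using fin by (intro card_mono) auto
  moreover have "f z \<le> f x"
  proof (rule ccontr)
    assume "\<not> f z \<le> f x"
    then have "slot S f x < slot S f z" using x A by (intro slot_less[OF fin]) auto
    moreover have "slot S f z \<le> slot S f x" using least x A by blast
    ultimately show False by simp
  qed
  moreover have "f x \<le> \<delta> x" using ge x by auto
  moreover have "card ?K \<le> rank A \<delta> x"
  proof -
    have "?K \<subseteq> {y \<in> A. \<delta> y < \<delta> x \<or> \<delta> y = \<delta> x \<and> y < x}"
    proof
      fix y assume y: "y \<in> ?K"
      then have "f y < f x \<or> f y = f x \<and> y < x" using x A by (intro slot_less_imp[OF fin]) auto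
      with y known[of y] \<open>f x \<le> \<delta> x\<close> show "y \<in> {y \<in> A. \<delta> y < \<delta> x \<or> \<delta> y = \<delta> x \<and> y < x}" by auto
    qed
    then show ?thesis
      unfolding rank_def using finite_subset[OF A fin] by (intro card_mono) auto
  qed
  ultimately show "j < slot A \<delta> x" using z(2) unfolding slot_def by linarith
qed

context execution
begin

abbreviation "S \<equiv> centres V \<omega>"
abbreviation "R \<equiv> roots V \<omega>"
abbreviation "n \<equiv> card V"

end

sublocale execution \<subseteq> spanner_choice V E S R "miss_bound a n"
  by unfold_locales (auto simp: centres_def roots_def)

context execution
begin

lemma finite_S: "finite S"
  using finite_V S_sub by (rule finite_subset[rotated])

lemma samp_iff: "v \<in> V \<Longrightarrow> 3 * ecc + 3 \<le> t \<Longrightarrow> samp (g t v) \<longleftrightarrow> v \<in> S"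
  by (simp add: samp_def info_all centres_def)

lemma samp_imp: "v \<in> V \<Longrightarrow> samp (g t v) \<Longrightarrow> v \<in> S"
  using info_correct[of v t] by (auto simp: samp_def centres_def split: option.splits)

lemma is_root_iff: "v \<in> V \<Longrightarrow> 3 * ecc + 3 \<le> t \<Longrightarrow> is_root (g t v) \<longleftrightarrow> v \<in> R"
  by (simp add: is_root_def info_all roots_def)

text \<open>The set-up proceeds in single rounds: \<open>info\<close> is known by
  \<open>3 * ecc + 3\<close>, \<open>cent\<close> one round later, and \<open>ncent\<close> at
  \<open>t_search ecc\<close>.\<close>

lemma cent_stable:
  assumes "v \<in> V" "3 * ecc + 4 \<le> t"
  shows "cent (g t v) = ctr v"
proof -
  obtain t' where t: "t = Suc t'" "3 * ecc + 3 \<le> t'" using assms(2) by (cases t) auto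
  have "{w \<in> N v. samp (g t' w)} = S \<inter> N v" using samp_iff[OF _ t(2)] nbrs_V by auto
  moreover have "(\<exists>w\<in>N v. samp (g t' w)) \<longleftrightarrow> S \<inter> N v \<noteq> {}" using samp_iff[OF _ t(2)] nbrs_V by auto
  ultimately show ?thesis using samp_iff[OF assms(1) t(2)] t(1) by (simp add: cent_Suc ctr_def)
qed

lemma ncent_stable:
  assumes "w \<in> N v" "t_search ecc \<le> t"
  shows "ncent (g t v) w = ctr w"
proof -
  obtain t' where t: "t = Suc t'" "3 * ecc + 4 \<le> t'" using assms(2) by (cases t) (auto simp: t_search_def)
  then show ?thesis using assms cent_stable nbrs_V by (simp add: ncent_Suc)
qed

lemma lmiss_stable: "w \<in> N v \<Longrightarrow> t_search ecc \<le> t \<Longrightarrow> lmiss (g t v) w \<longleftrightarrow> miss w v"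
  using cent_stable[of v t] ncent_stable[of w v t] nbrs_V[of w v]
  by (auto simp: lmiss_def miss_def t_search_def)

definition sched :: "nat \<Rightarrow> nat \<Rightarrow> nat" where
  "sched v s = slot S (\<lambda>s. d s v) s"

text \<open>From \<open>w\<close> to \<open>v\<close> the distance of \<open>s\<close> grows by
  exactly 1 and that of any other source by at most 1, so no source that came before
  \<open>s\<close> falls behind it.\<close>

lemma sched_nbr:
  assumes "s \<in> S" "w \<in> N v" "d s w + 1 = d s v"
  shows "sched w s < sched v s"
proof -
  have "rank S (\<lambda>s. d s w) s \<le> rank S (\<lambda>s. d s v) s"
    unfolding rank_def
  proof (rule card_mono)
    show "{y \<in> S. d y w < d s w \<or> d y w = d s w \<and> y < s} \<subseteq> {y \<in> S. d y v < d s v \<or> d y v = d s v \<and> y < s}"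
    proof
      fix y assume y: "y \<in> {y \<in> S. d y w < d s w \<or> d y w = d s w \<and> y < s}"
      then have "d y v \<le> d y w + 1" using d_nbr_le[of y w v] assms S_sub by auto
      with y assms(3) show "y \<in> {y \<in> S. d y v < d s v \<or> d y v = d s v \<and> y < s}" by auto
    qed
  qed (use finite_S in simp)
  with assms(3) show ?thesis unfolding sched_def slot_def by simp
qed

lemma sched_inj: "s \<in> S \<Longrightarrow> s' \<in> S \<Longrightarrow> sched v s = sched v s' \<Longrightarrow> s = s'"
  unfolding sched_def by (rule slot_inj[OF finite_S])

definition sent :: "nat \<Rightarrow> nat \<Rightarrow> (nat \<times> nat \<times> token) set" where
  "sent t v = {(t', w, s, d s w, nmiss s w, s \<in> R) | t' w s.
     t' < t \<and> w \<in> N v \<and> s \<in> S \<and> t' = t_search ecc + sched w s}"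

lemma in_sent: "(t', w, s, d', m, r) \<in> sent t v \<longleftrightarrow> t' < t \<and> w \<in> N v \<and> s \<in> S \<and>
    t' = t_search ecc + sched w s \<and> d' = d s w \<and> m = nmiss s w \<and> r = (s \<in> R)"
  unfolding sent_def by auto

text \<open>The assumption on \<open>toks\<close> is the induction hypothesis of
  \<open>toks_eq\<close>, isolated so that the values computed from it can be treated
  separately.\<close>

context
  fixes t v
  assumes v: "v \<in> V" and t: "t_search ecc \<le> t" and toks: "toks (g t v) = sent t v"
begin

lemma srcs_late:
  assumes "s \<in> srcs (g t v)"
  shows "s \<in> S" "d s v \<le> ldist (g t v) s"
proof -
  show s: "s \<in> S" using assms v samp_imp[OF v] by (auto simp: srcs_def toks in_sent split: if_splits)
  show "d s v \<le> ldist (g t v) s"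
  proof (cases "s = v")
    case False
    let ?X = "{d' + 1 | t' w d' m r. (t', w, s, d', m, r) \<in> sent t v}"
    have "?X \<subseteq> (\<lambda>w. d s w + 1) ` N v" by (auto simp: in_sent)
    then have "finite ?X" using finite_nbrs finite_subset by blast
    moreover have "?X \<noteq> {}" using assms False by (auto simp: srcs_def toks split: if_splits)
    ultimately have "Min ?X \<in> ?X" by (rule Min_in)
    then obtain w where "w \<in> N v" "Min ?X = d s w + 1" by (auto simp: in_sent)
    with d_nbr_le[of s w v] s S_sub have "d s v \<le> Min ?X" by auto
    with False show ?thesis by (simp add: ldist_def toks)
  qed simp
qed

text \<open>By \<open>sched_nbr\<close> all predecessors of \<open>v\<close> towards
  \<open>s\<close> have announced \<open>s\<close> before the slot of \<open>v\<close>, so the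
  minima run over complete data.\<close>

lemma known:
  assumes s: "s \<in> S" and early: "t_search ecc + sched v s \<le> t"
  shows "s \<in> srcs (g t v)" "ldist (g t v) s = d s v" "lnmiss (g t v) s = nmiss s v"
    "lroot (g t v) s \<longleftrightarrow> s \<in> R" "s \<noteq> v \<Longrightarrow> lparent (g t v) s = parent s v"
proof -
  have sV: "s \<in> V" using s S_sub by auto
  have t3: "3 * ecc + 3 \<le> t" using t by (simp add: t_search_def)
  have "s \<in> srcs (g t v) \<and> ldist (g t v) s = d s v \<and> lnmiss (g t v) s = nmiss s v \<and>
    (lroot (g t v) s \<longleftrightarrow> s \<in> R) \<and> (s \<noteq> v \<longrightarrow> lparent (g t v) s = parent s v)"
  proof (cases "s = v")
    case True
    then show ?thesis
      using samp_iff[OF v t3] is_root_iff[OF v t3] s by (simp add: srcs_def ldist_def lnmiss_def lroot_def)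
  next
    case False
    then have vs: "v \<noteq> s" by simp
    have pred: "(t_search ecc + sched w s, w, s, d s w, nmiss s w, s \<in> R) \<in> sent t v"
      if "w \<in> N v" "d s w + 1 = d s v" for w
      using sched_nbr[OF s that] early that s by (simp add: in_sent)
    obtain u where u: "u \<in> N v" "d s u + 1 = d s v" using d_pred[of s v] sV v vs by metis
    let ?X = "{d' + 1 | t' w d' m r. (t', w, s, d', m, r) \<in> sent t v}"
    have "?X \<subseteq> (\<lambda>w. d s w + 1) ` N v" by (auto simp: in_sent)
    then have "finite ?X" using finite_nbrs finite_subset by blast
    moreover have "d s v \<le> x" if "x \<in> ?X" for x
      using that d_nbr_le[OF sV] by (auto simp: in_sent)
    moreover have "d s v \<in> ?X" using pred[OF u] u(2)[symmetric] by blast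
    ultimately have "Min ?X = d s v" by (rule Min_eqI)
    then have 1: "ldist (g t v) s = d s v" using False by (simp add: ldist_def toks)
    have tok_iff: "(t', w, s, d', m, r) \<in> sent t v \<and> d' + 1 = d s v \<longleftrightarrow>
        w \<in> N v \<and> d s w + 1 = d s v \<and> t' = t_search ecc + sched w s \<and> d' = d s w \<and> m = nmiss s w \<and> r = (s \<in> R)"
      for t' w d' m r
      using pred[of w] by (auto simp: in_sent)
    have "{m + of_bool (lmiss (g t v) w) | t' w d' m r. (t', w, s, d', m, r) \<in> sent t v \<and> d' + 1 = d s v}
        = (\<lambda>w. nmiss s w + of_bool (miss w v)) ` {w \<in> N v. d s w + 1 = d s v}"
      (is "?A = ?B")
    proof (intro equalityI subsetI)
      fix x assume "x \<in> ?A"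
      then obtain t' w d' m r where *: "(t', w, s, d', m, r) \<in> sent t v \<and> d' + 1 = d s v"
        and x: "x = m + of_bool (lmiss (g t v) w)" by blast
      from * have w: "w \<in> N v" "d s w + 1 = d s v" "m = nmiss s w" unfolding tok_iff by simp_all
      have "x = nmiss s w + of_bool (miss w v)" using x w(3) lmiss_stable[OF w(1) t] by simp
      with w show "x \<in> ?B" by blast
    next
      fix x assume "x \<in> ?B"
      then obtain w where w: "w \<in> N v" "d s w + 1 = d s v" and x: "x = nmiss s w + of_bool (miss w v)"
        by blast
      have "x = nmiss s w + of_bool (lmiss (g t v) w)" using x lmiss_stable[OF w(1) t] by simp
      with pred[OF w] w(2) show "x \<in> ?A" by blast
    qed
    then have 2: "lnmiss (g t v) s = nmiss s v"
      using False nmiss_eq[OF sV v vs] by (simp add: lnmiss_def toks 1)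
    have "{w | t' w d' m r. (t', w, s, d', m, r) \<in> sent t v \<and> d' + 1 = d s v \<and>
        m + of_bool (lmiss (g t v) w) = nmiss s v}
        = {w \<in> N v. d s w + 1 = d s v \<and> nmiss s w + of_bool (miss w v) = nmiss s v}"
      (is "?A = ?B")
    proof (intro equalityI subsetI)
      fix w assume "w \<in> ?A"
      then obtain t' d' m r where *: "(t', w, s, d', m, r) \<in> sent t v \<and> d' + 1 = d s v"
        and m: "m + of_bool (lmiss (g t v) w) = nmiss s v" by blast
      from * have w: "w \<in> N v" "d s w + 1 = d s v" "m = nmiss s w" unfolding tok_iff by simp_all
      with m lmiss_stable[OF w(1) t] show "w \<in> ?B" by simp
    next
      fix w assume "w \<in> ?B"
      then have w: "w \<in> N v" "d s w + 1 = d s v" and m: "nmiss s w + of_bool (miss w v) = nmiss s v"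
        by blast+
      have "nmiss s w + of_bool (lmiss (g t v) w) = nmiss s v" using m lmiss_stable[OF w(1) t] by simp
      with pred[OF w] w(2) show "w \<in> ?A" by blast
    qed
    then have 3: "lparent (g t v) s = parent s v"
      by (simp add: lparent_def parent_def toks 1 2)
    have 4: "lroot (g t v) s \<longleftrightarrow> s \<in> R"
    proof -
      have "lroot (g t v) s \<longleftrightarrow> (\<exists>t' w d' m. (t', w, s, d', m, True) \<in> sent t v)"
        using False by (simp add: lroot_def toks)
      also have "\<dots> \<longleftrightarrow> s \<in> R" using pred[OF u] by (auto simp: in_sent)
      finally show ?thesis .
    qed
    have 5: "s \<in> srcs (g t v)" unfolding srcs_def toks using pred[OF u] by blast
    from 1 2 3 4 5 show ?thesis by simp
  qed
  then show "s \<in> srcs (g t v)" "ldist (g t v) s = d s v" "lnmiss (g t v) s = nmiss s v"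
    "lroot (g t v) s \<longleftrightarrow> s \<in> R" "s \<noteq> v \<Longrightarrow> lparent (g t v) s = parent s v" by auto
qed

text \<open>\<open>slot_estimate\<close> with \<open>j\<close> the number of search rounds so far:
  slots that have come are exact, and no later slot is mistaken for the present one.\<close>

lemma local_slot:
  shows "s \<in> S \<Longrightarrow> t_search ecc + sched v s \<le> t \<Longrightarrow>
      slot (srcs (g t v)) (ldist (g t v)) s = sched v s"
    and "s \<in> srcs (g t v) \<Longrightarrow> t < t_search ecc + sched v s \<Longrightarrow>
      t < t_search ecc + slot (srcs (g t v)) (ldist (g t v)) s"
proof -
  let ?j = "t - t_search ecc"
  have A: "srcs (g t v) \<subseteq> S" using srcs_late(1) by blast
  have K: "x \<in> srcs (g t v) \<and> ldist (g t v) x = d x v" if "x \<in> S" "slot S (\<lambda>s. d s v) x \<le> ?j" for x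
    using known(1,2)[of x] that t by (auto simp: sched_def)
  note est = slot_estimate[OF finite_S A, of "\<lambda>s. d s v" "ldist (g t v)" ?j, OF srcs_late(2) K]
  show "s \<in> S \<Longrightarrow> t_search ecc + sched v s \<le> t \<Longrightarrow> slot (srcs (g t v)) (ldist (g t v)) s = sched v s"
    using est(1)[of s] t by (simp add: sched_def)
  show "s \<in> srcs (g t v) \<Longrightarrow> t < t_search ecc + sched v s \<Longrightarrow>
      t < t_search ecc + slot (srcs (g t v)) (ldist (g t v)) s"
    using est(2)[of s] t unfolding sched_def by linarith
qed

lemma token_of_late: "token_of (g t v) = Some x \<longleftrightarrow>
  (\<exists>s\<in>S. t_search ecc + sched v s = t \<and> x = (s, d s v, nmiss s v, s \<in> R))"
proof -
  let ?X = "{x \<in> srcs (g t v). t_search ecc + slot (srcs (g t v)) (ldist (g t v)) x = t}"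
  have X: "?X = {s \<in> S. t_search ecc + sched v s = t}"
  proof (intro equalityI subsetI)
    fix s assume s: "s \<in> ?X"
    then have sS: "s \<in> S" using srcs_late(1) by blast
    have "t_search ecc + sched v s \<le> t" using s local_slot(2)[of s] by (auto simp: not_less[symmetric])
    with s sS local_slot(1)[of s] show "s \<in> {s \<in> S. t_search ecc + sched v s = t}" by auto
  next
    fix s assume "s \<in> {s \<in> S. t_search ecc + sched v s = t}"
    then show "s \<in> ?X" using known(1)[of s] local_slot(1)[of s] by auto
  qed
  have info: "info (g t v) = Some (ecc, n)" using t v by (intro info_all) (auto simp: t_search_def)
  show ?thesis
  proof (cases "?X = {}")
    case True
    then have "token_of (g t v) = None" by (simp add: token_of_def info)
    with True X show ?thesis by auto
  next
    case False
    then obtain s where s: "s \<in> S" "t_search ecc + sched v s = t" using X by auto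
    then have "?X = {s}" unfolding X using sched_inj[OF _ s(1), of _ v] by auto
    have "token_of (g t v) = (if ?X = {} then None
        else Some (Min ?X, ldist (g t v) (Min ?X), lnmiss (g t v) (Min ?X), lroot (g t v) (Min ?X)))"
      by (simp add: token_of_def info Let_def)
    then have "token_of (g t v) = Some (s, ldist (g t v) s, lnmiss (g t v) s, lroot (g t v) s)"
      unfolding \<open>?X = {s}\<close> by simp
    then have "token_of (g t v) = Some (s, d s v, nmiss s v, s \<in> R)"
      using known[OF s(1)] s(2) by simp
    moreover have "s' = s" if "s' \<in> S" "t_search ecc + sched v s' = t" for s'
      using that s sched_inj[of s' s v] by auto
    then have "(\<exists>s'\<in>S. t_search ecc + sched v s' = t \<and> x = (s', d s' v, nmiss s' v, s' \<in> R)) \<longleftrightarrow>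
        x = (s, d s v, nmiss s v, s \<in> R)"
      using s by blast
    ultimately show ?thesis by auto
  qed
qed

end

lemma token_of_early: "v \<in> V \<Longrightarrow> t < t_search ecc \<Longrightarrow> token_of (g t v) = None"
  using info_correct[of v t] by (auto simp: token_of_def Let_def split: option.splits)

lemma toks_eq: "v \<in> V \<Longrightarrow> toks (g t v) = sent t v"
proof (induction t arbitrary: v)
  case 0
  then show ?case by (simp add: sent_def)
next
  case (Suc t)
  have "token_of (g t w) = Some x \<longleftrightarrow> (\<exists>s\<in>S. t_search ecc + sched w s = t \<and> x = (s, d s w, nmiss s w, s \<in> R))"
    if "w \<in> N v" for w x
  proof (cases "t_search ecc \<le> t")
    case True
    with that nbrs_V Suc.IH show ?thesis by (intro token_of_late) auto
  next
    case False
    with that nbrs_V token_of_early[of w t] show ?thesis by auto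
  qed
  then have "{(t, w, x) | w x. w \<in> N v \<and> token_of (g t w) = Some x} =
      {(t, w, s, d s w, nmiss s w, s \<in> R) | w s. w \<in> N v \<and> s \<in> S \<and> t_search ecc + sched w s = t}"
    by auto
  then show ?case
    unfolding toks_Suc using Suc.IH[OF Suc.prems] by (auto simp: sent_def less_Suc_eq)
qed

lemma token_of_Some: "v \<in> V \<Longrightarrow> token_of (g t v) = Some x \<Longrightarrow> \<exists>s\<in>S. x = (s, d s v, nmiss s v, s \<in> R)"
  using token_of_early[of v t] token_of_late[of v t x] toks_eq[of v t] by (cases "t_search ecc \<le> t") auto

lemma d_le_ecc: "u \<in> V \<Longrightarrow> v \<in> V \<Longrightarrow> d u v \<le> 2 * ecc"
  using d_triangle[of u leader v] d_leader_le[of u] d_leader_le[of v] leader_V by (simp add: d_commute)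

section \<open>The backward phase\<close>

context
  assumes few: "card S < centre_bound a n"
begin

lemma sched_le: "s \<in> S \<Longrightarrow> v \<in> V \<Longrightarrow> sched v s \<le> search_len a ecc n"
proof -
  assume "s \<in> S" "v \<in> V"
  then have "d s v \<le> 2 * ecc" using d_le_ecc S_sub by auto
  moreover have "rank S (\<lambda>s. d s v) s \<le> card S" unfolding rank_def using finite_S by (intro card_mono) auto
  ultimately show ?thesis using few unfolding sched_def slot_def search_len_def by linarith
qed

lemma back_known:
  assumes v: "v \<in> V" and t: "t_back a ecc n \<le> t"
  shows "t_search ecc \<le> t" "srcs (g t v) = S"
    and "s \<in> S \<Longrightarrow> ldist (g t v) s = d s v" "s \<in> S \<Longrightarrow> lnmiss (g t v) s = nmiss s v"
    and "s \<in> S \<Longrightarrow> lroot (g t v) s \<longleftrightarrow> s \<in> R" "s \<in> S \<Longrightarrow> s \<noteq> v \<Longrightarrow> lparent (g t v) s = parent s v"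
    and "s \<in> S \<Longrightarrow> slot (srcs (g t v)) (ldist (g t v)) s = sched v s"
    and "(t', w, s, d', m, r) \<in> toks (g t v) \<longleftrightarrow> w \<in> N v \<and> s \<in> S \<and>
      t' = t_search ecc + sched w s \<and> d' = d s w \<and> m = nmiss s w \<and> r = (s \<in> R)"
proof -
  show t2: "t_search ecc \<le> t" using t by (simp add: t_back_def)
  have early: "t_search ecc + sched w s < t" if "s \<in> S" "w \<in> V" for w s
    using sched_le[OF that] t by (simp add: t_back_def)
  note kn = known[OF v t2 toks_eq[OF v]] srcs_late[OF v t2 toks_eq[OF v]] local_slot[OF v t2 toks_eq[OF v]]
  show "srcs (g t v) = S" using kn(1) kn(6) early[OF _ v] by (auto intro: less_imp_le)
  show "s \<in> S \<Longrightarrow> ldist (g t v) s = d s v" "s \<in> S \<Longrightarrow> lnmiss (g t v) s = nmiss s v"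
    "s \<in> S \<Longrightarrow> lroot (g t v) s \<longleftrightarrow> s \<in> R" "s \<in> S \<Longrightarrow> s \<noteq> v \<Longrightarrow> lparent (g t v) s = parent s v"
    "s \<in> S \<Longrightarrow> slot (srcs (g t v)) (ldist (g t v)) s = sched v s"
    using kn early[OF _ v, of s] by (simp_all add: less_imp_le)
  show "(t', w, s, d', m, r) \<in> toks (g t v) \<longleftrightarrow> w \<in> N v \<and> s \<in> S \<and>
      t' = t_search ecc + sched w s \<and> d' = d s w \<and> m = nmiss s w \<and> r = (s \<in> R)"
    unfolding toks_eq[OF v] in_sent using early[of s w] nbrs_V(1)[of w v] by auto
qed

text \<open>Members of the cluster of \<open>v\<close> are \<open>v\<close> and neighbours of
  \<open>v\<close>, and by now all their tokens have arrived.\<close>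

lemma lchosen_iff:
  assumes v: "v \<in> V" and t: "t_back a ecc n \<le> t" and s: "s \<in> S"
  shows "lchosen (miss_bound a n) (g t v) s y \<longleftrightarrow> chosen v s y"
proof -
  note b = back_known[OF v t]
  have cent: "cent (g t v) = ctr v" using b(1) v by (intro cent_stable) (auto simp: t_search_def)
  have "lmember (g t v) s y d' m \<longleftrightarrow> ctr y = Some v \<and> d' = d s y \<and> m = nmiss s y" for y d' m
  proof (cases "y = v")
    case True
    have "v \<notin> N v" by (rule nbrs_irrefl)
    with True show ?thesis using s b(2) b(3,4)[OF s] by (auto simp: lmember_def cent)
  next
    case False
    show ?thesis
    proof (cases "y \<in> N v")
      case True
      then show ?thesis using False s ncent_stable[OF True b(1)] by (auto simp: lmember_def b(8))
    next
      case nN: False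
      then have "ctr y \<noteq> Some v" using ctr_Some[of y v] False nbrs_sym[of y E v] by auto
      with nN False show ?thesis by (auto simp: lmember_def)
    qed
  qed
  then show ?thesis unfolding lchosen_def chosen_def by auto
qed

definition wants :: "nat \<Rightarrow> nat \<Rightarrow> nat \<Rightarrow> bool" where
  "wants w v s \<longleftrightarrow> v = parent s w \<and> w \<noteq> s \<and> incl s w \<or> chosen w s v"

text \<open>The bit from \<open>w\<close> to \<open>v\<close> need not name the source: the time
  determines the slot of \<open>v\<close>, and \<open>sched_inj\<close> recovers
  \<open>s\<close>.\<close>

definition acks :: "nat \<Rightarrow> nat \<Rightarrow> nat \<Rightarrow> bool" where
  "acks t w v \<longleftrightarrow> (\<exists>s\<in>S. t_search ecc + sched v s + t = mirror a ecc n \<and> wants w v s)"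

text \<open>By \<open>due\<close>, the round in which \<open>v\<close> is acknowledged for
  \<open>s\<close> is over, so every child on a selected path and the centre of \<open>v\<close>
  have been heard.\<close>

lemma lincl_iff:
  assumes v: "v \<in> V" and t: "t_back a ecc n \<le> t" and s: "s \<in> S"
    and marks: "marks (g t v) = {(t', w). t' < t \<and> w \<in> N v \<and> acks t' w v}"
    and due: "mirror a ecc n < t + (t_search ecc + sched v s)"
  shows "lincl a ecc n (g t v) s \<longleftrightarrow> incl s v"
proof -
  note b = back_known[OF v t]
  have l: "lincl a ecc n (g t v) s \<longleftrightarrow> s \<in> R \<or> chosen v s v \<or>
      (\<exists>t' w. t' < t \<and> w \<in> N v \<and> acks t' w v \<and> t_search ecc + sched v s + t' = mirror a ecc n)"
    unfolding lincl_def g_const lchosen_iff[OF v t s] b(5)[OF s] b(7)[OF s] marks by blast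
  show ?thesis
  proof
    assume "lincl a ecc n (g t v) s"
    then consider "s \<in> R" | "chosen v s v"
      | t' w where "w \<in> N v" "acks t' w v" "t_search ecc + sched v s + t' = mirror a ecc n"
      unfolding l by blast
    then show "incl s v"
    proof cases
      case 3
      then obtain s' where s': "s' \<in> S" "sched v s' = sched v s" "wants w v s'"
        unfolding acks_def by auto
      then have "s' = s" using sched_inj s by blast
      with s' have "wants w v s" by simp
      then show ?thesis unfolding wants_def by (auto intro: incl.intros)
    qed (use v in \<open>auto intro: incl.intros\<close>)
  next
    assume "incl s v"
    moreover have ack: "lincl a ecc n (g t v) s" if w: "w \<in> N v" "wants w v s" for w
    proof -
      have "t_search ecc + sched v s \<le> mirror a ecc n"
        using sched_le[OF s v] by (simp add: mirror_def)
      then obtain t' where t': "mirror a ecc n = t_search ecc + sched v s + t'" using le_Suc_ex by blast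
      then have "acks t' w v" using w s unfolding acks_def by auto
      moreover have "t' < t" using t' due by simp
      ultimately show ?thesis unfolding l using w t' by auto
    qed
    ultimately show "lincl a ecc n (g t v) s"
    proof cases
      case via_root
      then show ?thesis unfolding l by simp
    next
      case (via_centre c)
      show ?thesis
      proof (cases "c = v")
        case True
        with via_centre show ?thesis unfolding l by simp
      next
        case False
        have "c \<in> N v" using via_centre False ctr_Some[of v c] by (auto simp: chosen_def)
        with via_centre show ?thesis by (intro ack) (auto simp: wants_def)
      qed
    next
      case (via_child u)
      have "u \<in> V" "s \<in> V" using via_child incl_V s S_sub by auto
      then have "u \<in> N v" using parent_props(1)[of s u] via_child nbrs_sym[of v E u] by auto
      with via_child show ?thesis by (intro ack) (auto simp: wants_def)
    qed
  qed
qed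

lemma marks_eq: "v \<in> V \<Longrightarrow> marks (g t v) = {(t', w). t' < t \<and> w \<in> N v \<and> acks t' w v}"
proof (induction t arbitrary: v)
  case (Suc t)
  have "mark a (g t w) v \<longleftrightarrow> acks t w v" if w: "w \<in> N v" for w
  proof -
    have wV: "w \<in> V" "v \<in> N w" using w nbrs_V nbrs_sym by auto
    show ?thesis
    proof (cases "t_back a ecc n \<le> t")
      case True
      note b = back_known[OF wV(1) True]
      have info: "info (g t w) = Some (ecc, n)" using b(1) wV by (intro info_all) (auto simp: t_search_def)
      have want: "v = lparent (g t w) s \<and> s \<noteq> w \<and> lincl a ecc n (g t w) s \<or> lchosen (miss_bound a n) (g t w) s v
          \<longleftrightarrow> wants w v s"
        if s: "s \<in> S" "t_search ecc + sched v s + t = mirror a ecc n" for s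
      proof -
        \<comment> \<open>The parent \<open>v\<close> has the earlier slot for \<open>s\<close>,
          hence the later acknowledgement: \<open>w\<close> has its own marks for \<open>s\<close>
          before it must answer \<open>v\<close>.\<close>
        have "lincl a ecc n (g t w) s \<longleftrightarrow> incl s w" if ws: "w \<noteq> s" "v = parent s w"
        proof (rule lincl_iff[OF wV(1) True s(1) Suc.IH[OF wV(1)]])
          have "d s v + 1 = d s w" using parent_props(2)[of s w] ws s(1) S_sub wV by auto
          then have "sched v s < sched w s" using sched_nbr[OF s(1) wV(2)] by simp
          with s(2) show "mirror a ecc n < t + (t_search ecc + sched w s)" by simp
        qed
        then show ?thesis
          unfolding wants_def lchosen_iff[OF wV(1) True s(1)] using b(6)[OF s(1)] by auto
      qed
      have "mark a (g t w) v \<longleftrightarrow> (\<exists>s\<in>S. t + (t_search ecc + sched v s) = mirror a ecc n \<and>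
          (v = lparent (g t w) s \<and> s \<noteq> w \<and> lincl a ecc n (g t w) s \<or> lchosen (miss_bound a n) (g t w) s v))"
        unfolding mark_def info b(8) using wV(2) by auto
      also have "\<dots> \<longleftrightarrow> acks t w v"
        unfolding acks_def using want by (auto simp: add.commute)
      finally show ?thesis .
    next
      case False
      have "\<not> acks t w v"
      proof
        assume "acks t w v"
        then obtain s where "s \<in> S" "t_search ecc + sched v s + t = mirror a ecc n"
          by (auto simp: acks_def)
        with sched_le[of s v] False Suc.prems show False by (simp add: mirror_def)
      qed
      moreover have "\<not> mark a (g t w) v"
      proof
        assume "mark a (g t w) v"
        then obtain t' s d' m r where "(t', v, s, d', m, r) \<in> toks (g t w)" "t + t' = mirror a ecc n"
          using info_correct[OF wV(1)] by (auto simp: mark_def split: option.splits)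
        then show False
          using False sched_le[of s v] Suc.prems by (auto simp: toks_eq[OF wV(1)] in_sent mirror_def)
      qed
      ultimately show ?thesis by simp
    qed
  qed
  then show ?case unfolding marks_Suc Suc.IH[OF Suc.prems] by (auto simp: less_Suc_eq)
qed simp

lemma out_eq:
  assumes v: "v \<in> V" and t: "t_end a ecc n \<le> t"
  shows "out a (g t v) = Some (nbrs spanner v)"
proof -
  have tb: "t_back a ecc n \<le> t" using t by (simp add: t_end_def)
  note b = back_known[OF v tb]
  have info: "info (g t v) = Some (ecc, n)" using b(1) v by (intro info_all) (auto simp: t_search_def)
  have incl: "lincl a ecc n (g t v) s \<longleftrightarrow> incl s v" if "s \<in> S" for s
    using t by (intro lincl_iff[OF v tb that marks_eq[OF v]]) (simp add: t_end_def mirror_def)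
  have 1: "{lparent (g t v) s | s. s \<in> srcs (g t v) \<and> s \<noteq> v \<and> lincl a ecc n (g t v) s} =
      {parent s v | s. s \<in> S \<and> v \<in> V \<and> incl s v \<and> v \<noteq> s}"
    unfolding b(2) using b(6) incl v by (auto; metis)
  have 2: "{w. \<exists>t'. (t', w) \<in> marks (g t v)} = {w \<in> N v. \<exists>s\<in>S. wants w v s}"
  proof (intro equalityI subsetI)
    fix w assume "w \<in> {w \<in> N v. \<exists>s\<in>S. wants w v s}"
    then obtain s where w: "w \<in> N v" and s: "s \<in> S" "wants w v s" by auto
    have "t_search ecc + sched v s \<le> mirror a ecc n"
      using sched_le[OF s(1) v] by (simp add: mirror_def)
    then obtain t' where t': "mirror a ecc n = t_search ecc + sched v s + t'" using le_Suc_ex by blast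
    then have "acks t' w v" using s unfolding acks_def by auto
    moreover have "t' < t" using t' t by (simp add: t_end_def mirror_def)
    ultimately show "w \<in> {w. \<exists>t'. (t', w) \<in> marks (g t v)}" unfolding marks_eq[OF v] using w by auto
  qed (auto simp: marks_eq[OF v] acks_def)
  have 3: "{w \<in> N v. \<not> lmiss (g t v) w} = {w \<in> N v. \<not> miss v w}"
    using lmiss_stable[OF _ b(1)] miss_commute by auto
  \<comment> \<open>A mark that only tells \<open>v\<close> of being chosen by its centre
    \<open>w\<close> contributes the edge to \<open>w\<close>, which is in the spanner
    anyway.\<close>
  have 4: "\<not> miss v w" if "chosen w s v" for w s
    using that by (auto simp: chosen_def miss_def)
  have 5: "w \<in> V \<and> w \<in> N v" if "s \<in> S" "incl s w" "w \<noteq> s" "parent s w = v" for w s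
    using that incl_V[of s w] parent_props(1)[of s w] nbrs_sym[of v E w] S_sub by auto
  have "{w \<in> N v. \<not> miss v w} \<union> {w \<in> N v. \<exists>s\<in>S. wants w v s} =
      {w \<in> N v. \<not> miss v w} \<union> {w. \<exists>s\<in>S. w \<in> V \<and> incl s w \<and> w \<noteq> s \<and> parent s w = v}"
    unfolding wants_def using 4 5 by blast
  then show ?thesis
    unfolding out_def info nbrs_spanner using t by (simp add: 1 2 3 Un_ac) blast
qed

end

text \<open>Nothing is assumed about the coins here: vertices halt simultaneously in bad runs too,
  as the bandwidth bound requires.\<close>

lemma out_None: "v \<in> V \<Longrightarrow> t < t_end a ecc n \<Longrightarrow> out a (g t v) = None"
  using info_correct[of v t] by (auto simp: out_def split: option.splits)

lemma out_not_None: "v \<in> V \<Longrightarrow> t_end a ecc n \<le> t \<Longrightarrow> out a (g t v) \<noteq> None"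
  using info_all[of v t] by (auto simp: out_def t_end_def t_back_def t_search_def)

end

section \<open>Bandwidth and running time\<close>

context execution
begin

lemma cent_V: "v \<in> V \<Longrightarrow> cent (g t v) = Some c \<Longrightarrow> c \<in> V"
proof (cases t)
  case (Suc t')
  assume v: "v \<in> V" and c: "cent (g t v) = Some c"
  let ?A = "{w \<in> N v. samp (g t' w)}"
  have fin: "finite ?A" using finite_nbrs by simp
  have c': "(if samp (g t' v) then Some v else if \<exists>w\<in>N v. samp (g t' w) then Some (Min ?A) else None) = Some c"
    using c unfolding Suc cent_Suc .
  show ?thesis
  proof (cases "samp (g t' v)")
    case True
    with c' v show ?thesis by simp
  next
    case False
    with c' have ne: "\<exists>w\<in>N v. samp (g t' w)" and Min: "Min ?A = c" by (simp_all split: if_splits)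
    then have "?A \<noteq> {}" by blast
    from Min_in[OF fin this] show ?thesis unfolding Min using nbrs_V by blast
  qed
qed (simp add: init_node_def congest.free_run.simps)

text \<open>Identifiers need the exponent \<open>\<kappa>\<close>; the additional 4 accommodates
  \<open>cnt\<close>, which is at most \<open>n * (2 * ecc + 3)\<close>.\<close>

lemma packet_le:
  assumes ids: "\<And>v. v \<in> V \<Longrightarrow> v < n ^ \<kappa>" and n: "2 \<le> n" and v: "v \<in> V"
    and x: "x \<in> set (encode_packet (packet_to a (g t v) w))"
  shows "x \<le> n ^ (\<kappa> + 4)"
proof -
  let ?B = "n ^ (\<kappa> + 4)"
  have pow: "n ^ i \<le> ?B" if "i \<le> \<kappa> + 4" for i using n that by (intro power_increasing) auto
  have id: "u \<le> ?B" if "u \<in> V" for u using ids[OF that] pow[of \<kappa>] by simp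
  have nB: "n \<le> ?B" using pow[of 1] by simp
  have bool: "of_bool b \<le> ?B" for b using n by (cases b) auto
  have ecc: "ecc < n" using ecc_attained d_less_card leader_V by metis
  have "n * (2 * ecc + 3) \<le> n * (4 * n)" using ecc n by (intro mult_left_mono) auto
  also have "\<dots> \<le> n * (n ^ 2 * n)" using power_mono[of 2 n 2] n by (intro mult_left_mono mult_right_mono) auto
  also have "\<dots> = n ^ 4" by (simp add: power_numeral_reduce)
  finally have "cnt (g t v) \<le> n ^ 4" using cnt_le[OF v, of t] by linarith
  then have cnt: "cnt (g t v) \<le> ?B" using pow[of 4] by simp
  have lead: "lead (g t v) \<le> ?B" using lead_near[OF v] id by auto
  have mx: "mx (g t v) \<le> ?B" using mx_le_ecc[OF v, of t] ecc nB by simp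
  have dep: "dep (g t v) \<le> ?B" using dep_le_ecc[OF v, of t] ecc nB by simp
  have info: "e \<le> ?B \<and> n' \<le> ?B" if "info (g t v) = Some (e, n')" for e n'
    using info_correct[OF v that] ecc nB by simp
  have cent: "c \<le> ?B" if "cent (g t v) = Some c" for c
    using cent_V[OF v that] id by auto
  have tok: "s \<le> ?B \<and> d' \<le> ?B \<and> m \<le> ?B" if "token_of (g t v) = Some (s, d', m, r)" for s d' m r
  proof -
    have s: "s \<in> V" "d' = d s v" "m = nmiss s v" using token_of_Some[OF v that] S_sub by auto
    have "d s v < n" using d_less_card s v by simp
    moreover have "nmiss s v \<le> d s v" using s v by (intro nmiss_le_d) auto
    ultimately show ?thesis using s id nB by simp
  qed
  have one: "1 \<le> ?B" using n by simp
  show ?thesis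
    using x lead mx dep cnt bool info cent tok one
    by (auto simp: encode_packet_def packet_to_def split: option.splits)
qed

lemma packet_bits_le:
  assumes ids: "\<And>v. v \<in> V \<Longrightarrow> v < n ^ \<kappa>" and n: "2 \<le> n" and v: "v \<in> V"
  shows "real (length (encode_nats (encode_packet (packet_to a (g t v) w))))
    \<le> 17 * (2 * real \<kappa> + 11) * log 2 (real n)"
proof -
  have "length (encode_packet p) = 17" for p
    by (auto simp: encode_packet_def split: option.splits prod.splits)
  moreover have "real (length (encode_nats (encode_packet (packet_to a (g t v) w))))
      \<le> real (length (encode_packet (packet_to a (g t v) w))) * (2 * log 2 (real (n ^ (\<kappa> + 4))) + 3)"
    using packet_le[OF ids n v] n by (intro length_encode_nats_le) auto
  ultimately have "real (length (encode_nats (encode_packet (packet_to a (g t v) w))))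
      \<le> 17 * (2 * log 2 (real (n ^ (\<kappa> + 4))) + 3)" by simp
  also have "log 2 (real (n ^ (\<kappa> + 4))) = real (\<kappa> + 4) * log 2 (real n)"
    using n by (simp only: of_nat_power log_nat_power)
  also have "17 * (2 * (real (\<kappa> + 4) * log 2 (real n)) + 3)
      \<le> 17 * (2 * (real (\<kappa> + 4) * log 2 (real n)) + 3 * log 2 (real n))"
    using log_n(1)[OF n] by simp
  also have "\<dots> = 17 * (2 * real \<kappa> + 11) * log 2 (real n)" by (simp add: algebra_simps)
  finally show ?thesis .
qed

lemma hrun_eq: "v \<in> V \<Longrightarrow> node_hrun a E \<omega> t v = g (min t (t_end a ecc n)) v"
  using nbrs_sub out_None out_not_None by (intro congest.run_eq_free_run) auto

lemma t_end_le:
  assumes n: "2 \<le> n" and D: "graph_diameter V E = enat D" and a: "0 \<le> a"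
  shows "real (t_end a ecc n) \<le> (2 * a + 9) * (rateS n + real D)"
proof -
  have "ecc \<le> D" using ecc_attained d_le_diameter[OF leader_V _ D] by metis
  moreover have "real (centre_bound a n) \<le> a * rateS n + 1"
    using a rates_ge_1(1)[OF n] unfolding centre_bound_def by (simp add: mult_nonneg_nonneg)
  moreover have "t_end a ecc n = 7 * ecc + 2 * centre_bound a n + 7"
    by (simp add: t_end_def t_back_def search_len_def t_search_def)
  ultimately have "real (t_end a ecc n) \<le> 7 * real D + 2 * (a * rateS n) + 9"
    by simp
  also have "\<dots> \<le> (2 * a + 9) * real D + (2 * a + 9) * rateS n"
  proof -
    have "7 * real D \<le> (2 * a + 9) * real D" using a by (intro mult_right_mono) auto
    moreover have "9 \<le> 9 * rateS n" using rates_ge_1(1)[OF n] by simp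
    ultimately show ?thesis by (simp add: algebra_simps)
  qed
  finally show ?thesis by (simp add: algebra_simps)
qed

end

context conn_graph
begin

lemma message_bits_spanner_alg:
  assumes ids: "\<And>v. v \<in> V \<Longrightarrow> v < card V ^ \<kappa>"
  shows "message_bits_le (spanner_alg a) V E (17 * (2 * real \<kappa> + 11) * log 2 (real (card V)))"
proof (rule congest.message_bits_le_alg[OF finite_V nbrs_sub])
  fix \<omega> t u v
  assume u: "u \<in> V" and v: "v \<in> N u"
  interpret execution V E a \<omega> by unfold_locales
  have "card {u, v} \<le> card V" using u v nbrs_V finite_V by (intro card_mono) auto
  then have "2 \<le> card V" using v nbrs_irrefl[of u] by (cases "u = v") auto
  then show "real (length (congest.encode (packet_to a (node_hrun a E \<omega> t u) v)))
      \<le> 17 * (2 * real \<kappa> + 11) * log 2 (real (card V))"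
    unfolding hrun_eq[OF u] congest.encode_def using ids u by (intro packet_bits_le)
qed

lemma computed_spanner:
  assumes n: "2 \<le> card V" and D: "graph_diameter V E = enat D" and a: "1 \<le> a" and g: "good a \<omega>"
    and t: "(2 * a + 9) * (rateS (card V) + real D) < real t + 1"
  shows "\<exists>F. computed_subgraph (spanner_alg a) V (\<lambda>v. if v \<in> V then node_code a E \<omega> t v else undefined) F \<and>
    additive_spanner 4 V E F \<and> real (card F) \<le> ((a + 1) ^ 3 + 2 * (a + 1) + 1) * rate_edges (card V)"
proof -
  interpret execution V E a \<omega> by unfold_locales
  \<comment> \<open>Since \<open>t_end\<close> is an integer, the strict inequality is enough; it
    absorbs the floor in the number of rounds.\<close>
  have "real (t_end a ecc n) < real t + 1" using t_end_le[OF n D] a t by simp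
  then have "t_end a ecc n \<le> t" by linarith
  then have "out a (node_hrun a E \<omega> t v) = Some (nbrs spanner v)" if "v \<in> V" for v
    unfolding hrun_eq[OF that] using g that by (intro out_eq) (auto simp: good_def)
  then have "computed_subgraph (spanner_alg a) V (\<lambda>v. if v \<in> V then node_code a E \<omega> t v else undefined) spanner"
    by (simp add: congest.computed_subgraph_alg[OF finite_V nbrs_sub])
  with good_spanner[OF n a g] show ?thesis by blast
qed

end

theorem theorem5:
  fixes c :: real and \<kappa> :: nat
  assumes "c > 0"
  shows "\<exists>(A :: nat congest_alg) (\<beta> :: real) (C\<^sub>r :: real) (C\<^sub>e :: real).
    \<forall>(V :: nat set) (E :: nat set set) (n :: nat) (D :: nat).
      connected_graph V E \<longrightarrow> card V = n \<longrightarrow> graph_diameter V E = enat D \<longrightarrow>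
      (\<forall>v\<in>V. v < n ^ \<kappa>) \<longrightarrow>
      message_bits_le A V E (\<beta> * log 2 (real n)) \<and>
      measure_pmf.prob
        (congest_run A V E
          (nat \<lfloor>C\<^sub>r * (real n powr (3/5) * log 2 (real n) powr (1/5) + real D)\<rfloor>))
        {\<sigma>. \<exists>F. computed_subgraph A V \<sigma> F \<and> additive_spanner 4 V E F \<and>
             real (card F) \<le> C\<^sub>e * (real n powr (7/5) * log 2 (real n) powr (4/5))}
      \<ge> 1 - real n powr (- c)"
proof -
  define a where "a = 5 * c + 18"
  have a: "1 \<le> a" "8 \<le> a" "5 * c + 18 \<le> a" using assms by (simp_all add: a_def)
  show ?thesis
  proof (rule exI[of _ "spanner_alg a"], rule exI[of _ "17 * (2 * real \<kappa> + 11)"], rule exI[of _ "2 * a + 9"],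
      rule exI[of _ "(a + 1) ^ 3 + 2 * (a + 1) + 1"], intro allI impI conjI)
    fix V :: "nat set" and E :: "nat set set" and n D :: nat
    assume conn: "connected_graph V E" and card: "card V = n" and D: "graph_diameter V E = enat D"
      and ids: "\<forall>v\<in>V. v < n ^ \<kappa>"
    interpret conn_graph V E by unfold_locales (rule conn)
    show "message_bits_le (spanner_alg a) V E (17 * (2 * real \<kappa> + 11) * log 2 (real n))"
      using message_bits_spanner_alg[of \<kappa> a] ids by (simp add: card)
    define t where "t = nat \<lfloor>(2 * a + 9) * (rateS n + real D)\<rfloor>"
    let ?good = "{\<sigma>. \<exists>F. computed_subgraph (spanner_alg a) V \<sigma> F \<and> additive_spanner 4 V E F \<and>
      real (card F) \<le> ((a + 1) ^ 3 + 2 * (a + 1) + 1) * rate_edges n}"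
    have "1 - real n powr (- c) \<le> measure_pmf.prob (congest_run (spanner_alg a) V E t) ?good"
    proof (cases "2 \<le> n")
      case False
      \<comment> \<open>For a single vertex \<open>n powr (- c)\<close> is 1 and the probability
        bound is trivial.\<close>
      have "n \<noteq> 0" using card finite_V V_nonempty by auto
      with False have "n = 1" by simp
      then show ?thesis by simp
    next
      case True
      have "(2 * a + 9) * (rateS n + real D) < real t + 1" unfolding t_def by linarith
      then have "{\<omega>. good a \<omega>} \<subseteq> (\<lambda>\<omega> v. if v \<in> V then node_code a E \<omega> t v else undefined) -` ?good"
        using computed_spanner[OF _ D a(1), folded card] True card by auto
      then have "measure_pmf.prob (Pi_pmf V (0, 0) (\<lambda>_. coin_pmf)) {\<omega>. good a \<omega>} \<le>
          measure_pmf.prob (Pi_pmf V (0, 0) (\<lambda>_. coin_pmf))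
            ((\<lambda>\<omega> v. if v \<in> V then node_code a E \<omega> t v else undefined) -` ?good)"
        by (rule measure_pmf.finite_measure_mono) simp
      then show ?thesis
        using prob_good[OF True card a(2) assms a(3)]
        by (simp add: congest.congest_run_alg[OF finite_V nbrs_sub])
    qed
    then show "1 - real n powr (- c) \<le> measure_pmf.prob (congest_run (spanner_alg a) V E
        (nat \<lfloor>(2 * a + 9) * (real n powr (3/5) * log 2 (real n) powr (1/5) + real D)\<rfloor>))
        {\<sigma>. \<exists>F. computed_subgraph (spanner_alg a) V \<sigma> F \<and> additive_spanner 4 V E F \<and>
          real (card F) \<le> ((a + 1) ^ 3 + 2 * (a + 1) + 1) * (real n powr (7/5) * log 2 (real n) powr (4/5))}"
      by (simp only: t_def rateS_def rate_edges_def)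
  qed
qed

end
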